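(* Let $m\ge2$, $1<p_0<\infty$, $\frac1{p_0}+\frac1{p_0'}=1$, and let $T_\alpha$ be an $m$-linear fractional integral operator with generalized kernel on $\mathbb{R}^n$ (with constants $C_k$, $k\ge1$, in its smoothness condition) such that $\sum_{k=1}^\infty C_k<\infty$. Let $p_1(\cdot),\ldots,p_m(\cdot)$ be such that $\frac{p_i(\cdot)}{p_0'}\in\mathscr P^{log}(\mathbb{R}^n)$ and $0<\alpha_i<\frac{n}{p_{i,+}}$ for $i=1,\ldots,m$, where $p_{i,+}=(p_i)_+$ and $\alpha=\alpha_1+\cdots+\alpha_m$. Let $\frac1{p(\cdot)}=\frac1{p_1(\cdot)}+\cdots+\frac1{p_m(\cdot)}$, $\frac1{q(\cdot)}=\frac1{p(\cdot)}-\frac\alpha n$, and suppose $q(\cdot)\in\mathscr B(\mathbb{R}^n)$. Then there exists a positive constant $C$ such that for all $f_j\in L^{p_j(\cdot)}(\mathbb{R}^n)$, $j=1,\ldots,m$, $$\left\|T_\alpha(f_1,\ldots,f_m)\right\|_{L^{q(\cdot)}(\mathbb{R}^n)}\le C\prod_{j=1}^m\|f_j\|_{L^{p_j(\cdot)}(\mathbb{R}^n)}.$$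
   Context: Cubes in $\mathbb{R}^n$ have sides parallel to the axes; $Q(x,r)$ is the cube centered at $x$ with side length $r$; for a set $E$, $(E)^m=E\times\cdots\times E$ ($m$ factors); $\vec y=(y_1,\ldots,y_m)\in(\mathbb{R}^n)^m$, $d\vec y=dy_1\cdots dy_m$. Operator. Fix $1<p_0<\infty$, $\frac1{p_0}+\frac1{p_0'}=1$, and $\alpha$ with $0<\alpha p_0'<mn$. Let $K_\alpha(x,y_1,\ldots,y_m)$ be a locally integrable function defined away from the diagonal $x=y_1=\cdots=y_m$ in $(\mathbb{R}^n)^{m+1}$. Let $T_\alpha:\mathscr S(\mathbb{R}^n)\times\cdots\times\mathscr S(\mathbb{R}^n)\to\mathscr S'(\mathbb{R}^n)$ be $m$-linear with $$T_\alpha(\vec f)(x)=\int_{(\mathbb{R}^n)^m}K_\alpha(x,\vec y)\prod_{j=1}^m f_j(y_j)\,d\vec y\quad\text{for } x\notin\bigcap_{j=1}^m\operatorname{supp}f_j .$$ $T_\alpha$ is called an $m$-linear fractional integral operator with generalized kernel if: (1a) (size) for some $A>0$, $|K_\alpha(x,\vec y)|\le A\big(\sum_{j=1}^m|x-y_j|\big)^{-(mn-\alpha)}$; (1b) (smoothness) there are a constant $C>0$ and positive constants $C_k$, $k\in\{1,2,\ldots\}$, such that for all $k\geq 1$ and all $x\ne x'$ in $\mathbb{R}^n$, $$\left(\int_{Q(x,2^{k+2}\sqrt{mn}|x-x'|)^m\setminus Q(x,2^{k+1}\sqrt{mn}|x-x'|)^m}|K_\alpha(x,\vec y)-K_\alpha(x',\vec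 y)|^{p_0}d\vec y\right)^{1/p_0}\le C\,C_k\,2^{k(\alpha-\frac{mn}{p_0'})}|x-x'|^{\alpha-\frac{mn}{p_0'}};$$ (2) for some fixed $1\le s_1,\ldots,s_m\le p_0'$ with $\frac1s=\frac1{s_1}+\cdots+\frac1{s_m}$, $T_\alpha$ maps $L^{s_1}\times\cdots\times L^{s_m}$ boundedly into $L^{\frac{sn}{n-s\alpha},\infty}$. By (2), $T_\alpha$ is defined on $L^{s_1}\times\cdots\times L^{s_m}$, in particular on tuples of bounded measurable functions with compact support, and is still given there by the kernel formula. Norm estimates are understood in the usual sense: they hold for all bounded compactly supported measurable $f_j$, the operator on general tuples being the continuous extension from this dense class. Variable exponents. For measurable $q(\cdot):\mathbb{R}^n\to[1,\infty)$, $L^{q(\cdot)}(\mathbb{R}^n)$ is the space of measurable $f$ with $\int_{\mathbb{R}^n}(|f(x)|/\eta)^{q(x)}dx<\infty$ for some $\eta>0$, with norm $\|f\|_{L^{q(\cdot)}(\mathbb{R}^n)}=\inf\{\eta>0:\int_{\mathbb{R}^n}(|f(x)|/\eta)^{q(x)}dx\le1\}$. Put $q_-=\operatorname{ess\,inf}_{x\in\mathbb{R}^n}q(x)$, $q_+=\operatorname{ess\,sup}_{x\in\mathbb{R}^n}q(x)$. - $\mathscr P(\mathbb{R}^n)$: measurable $q(\cdot):\mathbb{R}^n\to(1,\infty)$ with $1<q_-\le q(x)\le q_+<\infty$. - $\mathscr B(\mathbb{R}^n)$: those $q(\cdot)\in\mathscr P(\mathbb{R}^n)$ for which the Hardy--Littlewood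 maximal operator is bounded on $L^{q(\cdot)}(\mathbb{R}^n)$. - $\mathscr L^{log}(\mathbb{R}^n)$: real-valued functions $q(\cdot)$ on $\mathbb{R}^n$ that satisfy both, for constants $C,C_\infty>0$ not depending on $x,y$: $|q(x)-q(y)|\le\frac{-C}{\ln(|x-y|)}$ for $|x-y|\le1/2$; and $|q(x)-q_\infty|\le\frac{C_\infty}{\ln(e+|x|)}$ for all $x\in\mathbb{R}^n$, where $q_\infty=\lim_{|x|\to\infty}q(x)$. - $\mathscr P^{log}(\mathbb{R}^n)=\mathscr L^{log}(\mathbb{R}^n)\cap\mathscr P(\mathbb{R}^n)$. *)

theory Defs
  imports "HOL-Probability.Essential_Supremum"
begin

text \<open>
  Points of $(\mathbf R^n)^m$ have type \<open>(real^'n)^'m\<close>, with $n$ = \<open>CARD('n)\<close> and $m$ = \<open>CARD('m)\<close>;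
  an $m$-tuple of functions on $\mathbf R^n$ has type \<open>'m \<Rightarrow> real^'n \<Rightarrow> complex\<close>. Measurability and
  integrals are with respect to Lebesgue measure.
\<close>

definition cube :: "real^'n \<Rightarrow> real \<Rightarrow> (real^'n) set" where
  "cube x r = {y. \<forall>i. \<bar>y $ i - x $ i\<bar> \<le> r / 2}"

definition set_tuples :: "'a set \<Rightarrow> ('a^'m) set" where
  "set_tuples E = {y. \<forall>j. y $ j \<in> E}"

definition fun_supp :: "('a::topological_space \<Rightarrow> 'b::zero) \<Rightarrow> 'a set" where
  "fun_supp f = closure {x. f x \<noteq> 0}"

definition bounded_compact_supp :: "(real^'n \<Rightarrow> complex) set" where
  "bounded_compact_supp =
     {f \<in> borel_measurable lebesgue. bounded (range f) \<and> compact (fun_supp f)}"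


subsection \<open>Schwartz functions and tempered distributions\<close>

definition pderiv_dir :: "'n \<Rightarrow> (real^'n \<Rightarrow> complex) \<Rightarrow> real^'n \<Rightarrow> complex" where
  "pderiv_dir i f x = vector_derivative (\<lambda>t. f (x + t *\<^sub>R axis i 1)) (at 0)"

definition pderivs :: "'n list \<Rightarrow> (real^'n \<Rightarrow> complex) \<Rightarrow> real^'n \<Rightarrow> complex" where
  "pderivs js f = foldr pderiv_dir js f"

text \<open>A function all of whose iterated partial derivatives are (totally) differentiable is
  $C^\infty$, and conversely; this is the smoothness requirement used here.\<close>

definition schwartz :: "(real^'n \<Rightarrow> complex) set" where
  "schwartz = {f. \<forall>js. pderivs js f differentiable_on UNIV \<and>
     (\<forall>N::nat. bounded (range (\<lambda>x. (1 + norm x) ^ N *\<^sub>R pderivs js f x)))}"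

definition schwartz_norm :: "nat \<Rightarrow> (real^'n \<Rightarrow> complex) \<Rightarrow> real" where
  "schwartz_norm N f =
     (SUP (js, x) \<in> {js. length js \<le> N} \<times> UNIV. (1 + norm x) ^ N * cmod (pderivs js f x))"

definition tempered_distribution :: "((real^'n \<Rightarrow> complex) \<Rightarrow> complex) \<Rightarrow> bool" where
  "tempered_distribution u \<longleftrightarrow>
     (\<forall>f\<in>schwartz. \<forall>g\<in>schwartz. u (\<lambda>x. f x + g x) = u f + u g) \<and>
     (\<forall>f\<in>schwartz. \<forall>c. u (\<lambda>x. c * f x) = c * u f) \<and>
     (\<exists>C N. \<forall>f\<in>schwartz. cmod (u f) \<le> C * schwartz_norm N f)"

text \<open>The functions that belong to $\mathscr S'$: locally integrable, and the distribution they
  induce on test functions extends to a tempered one.\<close>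

definition tempered_fun :: "(real^'n \<Rightarrow> complex) \<Rightarrow> bool" where
  "tempered_fun g \<longleftrightarrow>
     (\<forall>S. compact S \<longrightarrow> set_integrable lebesgue S g) \<and>
     (\<exists>u. tempered_distribution u \<and>
        (\<forall>\<phi>\<in>schwartz. compact (fun_supp \<phi>) \<longrightarrow> u \<phi> = (LINT x|lebesgue. g x * \<phi> x)))"


subsection \<open>Lebesgue and weak Lebesgue spaces with constant exponent\<close>

definition Lp :: "real \<Rightarrow> (real^'n \<Rightarrow> complex) set" where
  "Lp s = {f \<in> borel_measurable lebesgue. integrable lebesgue (\<lambda>x. cmod (f x) powr s)}"

definition Lp_norm :: "real \<Rightarrow> (real^'n \<Rightarrow> complex) \<Rightarrow> real" where
  "Lp_norm s f = (LINT x|lebesgue. cmod (f x) powr s) powr (1 / s)"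

definition weak_Lp :: "real \<Rightarrow> (real^'n \<Rightarrow> complex) set" where
  "weak_Lp r = {f \<in> borel_measurable lebesgue.
     (\<forall>t>0. emeasure lebesgue {x. t < cmod (f x)} < \<infinity>) \<and>
     bdd_above ((\<lambda>t. t * measure lebesgue {x. t < cmod (f x)} powr (1 / r)) ` {0<..})}"

definition weak_Lp_norm :: "real \<Rightarrow> (real^'n \<Rightarrow> complex) \<Rightarrow> real" where
  "weak_Lp_norm r f = (SUP t\<in>{0<..}. t * measure lebesgue {x. t < cmod (f x)} powr (1 / r))"


subsection \<open>Multilinear operators on tuples of functions\<close>

text \<open>Functions are not identified modulo null sets, so the identities hold almost everywhere.\<close>

definition multilinear_ae ::
    "('m \<Rightarrow> (real^'n \<Rightarrow> complex) set) \<Rightarrow> (('m \<Rightarrow> real^'n \<Rightarrow> complex) \<Rightarrow> real^'n \<Rightarrow> complex) \<Rightarrow> bool" where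
  "multilinear_ae X T \<longleftrightarrow> (\<forall>f j. (\<forall>i. f i \<in> X i) \<longrightarrow>
     (\<forall>g\<in>X j. AE x in lebesgue.
        T (f(j := (\<lambda>x. f j x + g x))) x = T f x + T (f(j := g)) x) \<and>
     (\<forall>c. AE x in lebesgue. T (f(j := (\<lambda>x. c * f j x))) x = c * T f x))"


subsection \<open>Fractional integral operators with generalized kernel\<close>

definition off_diagonal :: "((real^'n) \<times> ((real^'n)^'m)) set" where
  "off_diagonal = {(x, y). \<exists>j. y $ j \<noteq> x}"

definition fractional_kernel ::
    "real \<Rightarrow> real \<Rightarrow> real \<Rightarrow> (nat \<Rightarrow> real) \<Rightarrow> (real^'n \<Rightarrow> (real^'n)^'m \<Rightarrow> complex) \<Rightarrow> bool" where
  "fractional_kernel \<alpha> p0 p0' Ck K \<longleftrightarrow>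
     (let mn = real CARD('m) * real CARD('n) in
       (\<forall>S. compact S \<and> S \<subseteq> off_diagonal \<longrightarrow> set_integrable lebesgue S (\<lambda>(x, y). K x y)) \<and>
       (\<exists>A>0. \<forall>(x, y)\<in>off_diagonal.
          cmod (K x y) \<le> A * (\<Sum>j\<in>UNIV. norm (x - y $ j)) powr (- (mn - \<alpha>))) \<and>
       (\<forall>k\<ge>1. Ck k > 0) \<and>
       (\<exists>C>0. \<forall>k\<ge>1. \<forall>x x'. x \<noteq> x' \<longrightarrow>
          (let D = set_tuples (cube x (2 ^ (k + 2) * sqrt mn * norm (x - x')))
                 - set_tuples (cube x (2 ^ (k + 1) * sqrt mn * norm (x - x')))
           in set_integrable lebesgue D (\<lambda>y. cmod (K x y - K x' y) powr p0) \<and>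
              (LINT y:D|lebesgue. cmod (K x y - K x' y) powr p0) powr (1 / p0)
                \<le> C * Ck k * 2 powr (real k * (\<alpha> - mn / p0')) * norm (x - x') powr (\<alpha> - mn / p0'))))"

definition kernel_formula ::
    "(real^'n \<Rightarrow> (real^'n)^'m \<Rightarrow> complex) \<Rightarrow> (('m \<Rightarrow> real^'n \<Rightarrow> complex) \<Rightarrow> real^'n \<Rightarrow> complex)
     \<Rightarrow> ('m \<Rightarrow> real^'n \<Rightarrow> complex) \<Rightarrow> bool" where
  "kernel_formula K T f \<longleftrightarrow> (AE x in lebesgue. x \<notin> (\<Inter>j. fun_supp (f j)) \<longrightarrow>
     T f x = (LINT y|lebesgue. K x y * (\<Prod>j\<in>UNIV. f j (y $ j))))"

text \<open>
  The operator is given by its values on $L^{s_1} \times \cdots \times L^{s_m}$. As these are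
  functions, the requirement that it map Schwartz tuples into $\mathscr S'$ means that their images
  are tempered as functions.
\<close>

definition fractional_operator ::
    "real \<Rightarrow> real \<Rightarrow> real \<Rightarrow> (nat \<Rightarrow> real) \<Rightarrow> (real^'n \<Rightarrow> (real^'n)^'m \<Rightarrow> complex)
     \<Rightarrow> (('m \<Rightarrow> real^'n \<Rightarrow> complex) \<Rightarrow> real^'n \<Rightarrow> complex) \<Rightarrow> bool" where
  "fractional_operator \<alpha> p0 p0' Ck K T \<longleftrightarrow>
     0 < \<alpha> * p0' \<and> \<alpha> * p0' < real CARD('m) * real CARD('n) \<and>
     fractional_kernel \<alpha> p0 p0' Ck K \<and>
     (\<forall>f. (\<forall>j. f j \<in> schwartz) \<longrightarrow> tempered_fun (T f) \<and> kernel_formula K T f) \<and>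
     (\<forall>f. (\<forall>j. f j \<in> bounded_compact_supp) \<longrightarrow> kernel_formula K T f) \<and>
     (\<exists>(s :: 'm \<Rightarrow> real) s'. (\<forall>j. 1 \<le> s j \<and> s j \<le> p0') \<and> 1 / s' = (\<Sum>j\<in>UNIV. 1 / s j) \<and>
        multilinear_ae (\<lambda>j. Lp (s j)) T \<and>
        (let r = s' * real CARD('n) / (real CARD('n) - s' * \<alpha>) in
          \<exists>B. \<forall>f. (\<forall>j. f j \<in> Lp (s j)) \<longrightarrow>
            T f \<in> weak_Lp r \<and> weak_Lp_norm r (T f) \<le> B * (\<Prod>j\<in>UNIV. Lp_norm (s j) (f j))))"


subsection \<open>Variable exponents\<close>

definition var_modular :: "(real^'n \<Rightarrow> real) \<Rightarrow> (real^'n \<Rightarrow> complex) \<Rightarrow> real \<Rightarrow> ennreal" where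
  "var_modular q f \<eta> = (\<integral>\<^sup>+ x. ennreal ((cmod (f x) / \<eta>) powr q x) \<partial>lebesgue)"

definition var_Lp :: "(real^'n \<Rightarrow> real) \<Rightarrow> (real^'n \<Rightarrow> complex) set" where
  "var_Lp q = {f \<in> borel_measurable lebesgue. \<exists>\<eta>>0. var_modular q f \<eta> < \<infinity>}"

definition var_Lp_norm :: "(real^'n \<Rightarrow> real) \<Rightarrow> (real^'n \<Rightarrow> complex) \<Rightarrow> real" where
  "var_Lp_norm q f = Inf {\<eta>. 0 < \<eta> \<and> var_modular q f \<eta> \<le> 1}"

definition ess_sup :: "(real^'n \<Rightarrow> real) \<Rightarrow> ereal" where
  "ess_sup q = esssup lebesgue (\<lambda>x. ereal (q x))"

definition ess_inf :: "(real^'n \<Rightarrow> real) \<Rightarrow> ereal" where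
  "ess_inf q = - esssup lebesgue (\<lambda>x. ereal (- q x))"

definition exponents :: "(real^'n \<Rightarrow> real) set" where
  "exponents = {q \<in> borel_measurable lebesgue. (\<forall>x. 1 < q x) \<and> 1 < ess_inf q \<and> ess_sup q < \<infinity>}"

definition maximal_fun :: "(real^'n \<Rightarrow> complex) \<Rightarrow> real^'n \<Rightarrow> ennreal" where
  "maximal_fun f x = (SUP (c, r) \<in> {(c, r). 0 < r \<and> x \<in> cube c r}.
     (\<integral>\<^sup>+ y\<in>cube c r. ennreal (cmod (f y)) \<partial>lebesgue) / emeasure lebesgue (cube c r))"

text \<open>The maximal function has values in $[0,\infty]$; boundedness on $L^{q(\cdot)}$ includes that it
  is finite almost everywhere, after which it is converted to a complex-valued function.\<close>

definition maximal_exponents :: "(real^'n \<Rightarrow> real) set" where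
  "maximal_exponents = {q \<in> exponents. \<exists>C. \<forall>f\<in>var_Lp q.
     (AE x in lebesgue. maximal_fun f x < \<infinity>) \<and>
     (\<lambda>x. complex_of_real (enn2real (maximal_fun f x))) \<in> var_Lp q \<and>
     var_Lp_norm q (\<lambda>x. complex_of_real (enn2real (maximal_fun f x))) \<le> C * var_Lp_norm q f}"

definition log_holder :: "(real^'n \<Rightarrow> real) set" where
  "log_holder = {q.
     (\<exists>C>0. \<forall>x y. x \<noteq> y \<and> norm (x - y) \<le> 1 / 2 \<longrightarrow> \<bar>q x - q y\<bar> \<le> - C / ln (norm (x - y))) \<and>
     (\<exists>q_inf. (q \<longlongrightarrow> q_inf) at_infinity \<and>
        (\<exists>C>0. \<forall>x. \<bar>q x - q_inf\<bar> \<le> C / ln (exp 1 + norm x)))}"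

definition log_exponents :: "(real^'n \<Rightarrow> real) set" where
  "log_exponents = log_holder \<inter> exponents"

end

theory Submission
  imports Defs
begin

text \<open>
  The operator is dominated by a product of linear Riesz potentials. Since
  \<open>mn - \<alpha> = \<Sum>\<^sub>j (n - \<alpha>\<^sub>j)\<close> and each \<open>|x - y\<^sub>j|\<close> is at most \<open>\<Sum>\<^sub>j |x - y\<^sub>j|\<close>, the size condition gives
  \<open>|K(x, y)| \<le> A \<Prod>\<^sub>j |x - y\<^sub>j|\<close> to the powers \<open>\<alpha>\<^sub>j - n\<close>, so the integral of \<open>K(x, y) \<Prod>\<^sub>j f\<^sub>j(y\<^sub>j)\<close>
  is at most \<open>A \<Prod>\<^sub>j I\<^sub>j|f\<^sub>j|(x)\<close>, where \<open>I\<^sub>j\<close> is the Riesz potential of order \<open>\<alpha>\<^sub>j\<close>. The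
  extension \<open>T'\<close> of \<open>T\<close> is this integral, \<open>kernel_integral K\<close>, which converges absolutely at almost every point.
  Two facts carry the proof.

  First, \<open>T\<close> agrees with \<open>T'\<close> on bounded functions of compact support, although the kernel
  formula says nothing at points of the common support (\<open>operator_eq_kernel_integral\<close>). The
  difference \<open>W = T - T'\<close> is local: cutting all \<open>f\<^sub>j\<close> off to an open set \<open>U\<close> does not change \<open>W f\<close>
  on \<open>U\<close>. For a small ball \<open>U\<close> the weak type bound shows that the cut-off tuple \<open>f\<^sub>U\<close> satisfies
  \<open>|T f\<^sub>U| > l\<close> only on a set of measure \<open>O(|U|\<^bsup>r/s\<^esup>)\<close>, and \<open>r/s > 1\<close> because \<open>\<alpha> > 0\<close>, while
  \<open>T' f\<^sub>U\<close> is uniformly small. A bounded set is covered by \<open>O(1/|U|)\<close> such balls, so letting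
  them shrink leaves \<open>W f = 0\<close> almost everywhere.

  Second, the Riesz potential of order \<open>a\<close> maps \<open>L\<^bsup>p(.)\<^esup>\<close> to \<open>L\<^bsup>q(.)\<^esup>\<close> for \<open>1/q = 1/p - a/n\<close> if \<open>p\<close>
  is log-Hoelder continuous, bounded away from 1 and \<open>a p\<^sub>+ < n\<close> (\<open>riesz_potential_modular_bound\<close>).
  The engine is Hedberg's inequality, which compares the potential at a point with a power of the
  maximal function, together with the maximal theorem on \<open>L\<^sup>t\<close> for constant \<open>t > 1\<close>.
  A function \<open>f\<close> of modular at most 1 is split at height 1. Where \<open>f \<le> 1\<close>, the decay condition
  allows the exponent to be replaced by its limit at infinity, at the cost of an integrable error,
  and the constant exponent argument applies. Where \<open>f > 1\<close>, \<open>f\<close> is integrable, so the part of the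
  kernel away from the singularity is harmless by Jensen's inequality; near the singularity the local
  log-Hoelder condition makes Jensen's inequality valid with the exponent frozen at the centre
  (\<open>diening_local_estimate\<close>), and Hedberg's inequality works with the maximal function of
  \<open>f\<^bsup>p(.)/t\<^esup>\<close>.

  The factors are combined by Hoelder's inequality in the pointwise form
  \<open>(\<Prod>\<^sub>j F\<^sub>j)\<^sup>q \<le> \<Sum>\<^sub>j F\<^sub>j\<close> to the powers \<open>q\<^sub>j\<close>, where \<open>1/q = \<Sum>\<^sub>j 1/q\<^sub>j\<close>.
\<close>

section \<open>Real powers of extended nonnegative reals\<close>

text \<open>
  Real powers with \<open>\<infinity>\<close> as a value. Potentials and maximal functions may be infinite, and keeping
  \<open>\<infinity>\<close> under powers lets a finite integral of a power certify finiteness almost everywhere. The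
  exponents that occur are positive.
\<close>

definition epow :: "ennreal \<Rightarrow> real \<Rightarrow> ennreal" where
  "epow u s = (if u = top then top else ennreal (enn2real u powr s))"

lemma epow_ennreal [simp]: "0 \<le> x \<Longrightarrow> epow (ennreal x) s = ennreal (x powr s)"
  by (simp add: epow_def)

lemma epow_top [simp]: "epow top s = top"
  by (simp add: epow_def)

lemma epow_0 [simp]: "epow 0 s = 0"
  by (simp add: epow_def)

lemma epow_one [simp]: "epow u 1 = u"
  by (cases u) (auto simp: epow_def top_unique)

lemma epow_eq_top_iff: "epow u s = top \<longleftrightarrow> u = top"
  by (simp add: epow_def)

lemma epow_mono:
  assumes "0 \<le> s" "u \<le> v"
  shows "epow u s \<le> epow v s"
proof (cases v)
  case (real b)
  then obtain a where "u = ennreal a" "0 \<le> a"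
    using assms(2) by (cases u) (auto simp: top_unique)
  with real assms show ?thesis
    by (simp add: powr_mono2)
qed (simp)

lemma epow_epow: "epow (epow u s) t = epow u (s * t)"
  by (cases u) (simp_all add: powr_powr)

lemma epow_cmult:
  assumes "0 < c"
  shows "epow (ennreal c * u) s = ennreal (c powr s) * epow u s"
proof (cases u)
  case (real b)
  with assms show ?thesis
    by (simp flip: ennreal_mult'' ennreal_mult add: powr_mult)
qed (use assms in \<open>simp add: ennreal_mult_top\<close>)

lemma epow_add:
  assumes "0 \<le> s"
  shows "epow (u + v) s \<le> ennreal (2 powr s) * (epow u s + epow v s)"
proof -
  have *: "epow (u + v) s \<le> ennreal (2 powr s) * epow (max u v) s"
  proof -
    have "u + v \<le> ennreal 2 * max u v"
      by (metis add_mono ennreal_numeral max.cobounded1 max.cobounded2 mult_2 mult_2_right mult.commute zero_le_numeral)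
    then have "epow (u + v) s \<le> epow (ennreal 2 * max u v) s"
      by (rule epow_mono[OF assms])
    then show ?thesis
      by (subst (asm) epow_cmult) auto
  qed
  also have "\<dots> \<le> ennreal (2 powr s) * (epow u s + epow v s)"
    by (rule mult_left_mono) (auto simp: max_def)
  finally show ?thesis .
qed

lemma measurable_epow [measurable]:
  assumes [measurable]: "f \<in> borel_measurable M" "s \<in> borel_measurable M"
  shows "(\<lambda>x. epow (f x) (s x)) \<in> borel_measurable M"
  unfolding epow_def by measurable

section \<open>The dyadic maximal function\<close>

definition ball_mean :: "real \<Rightarrow> ('a::euclidean_space \<Rightarrow> ennreal) \<Rightarrow> 'a \<Rightarrow> ennreal" where
  "ball_mean r f x = (\<integral>\<^sup>+ y. f y * indicator (ball x r) y \<partial>lborel) / emeasure lborel (ball x r)"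

text \<open>
  Radii are restricted to powers of 2. The supremum is then countable, hence measurable, and these
  radii are the only ones in the dyadic decomposition of the Riesz kernel.
\<close>

definition dyadic_maximal :: "('a::euclidean_space \<Rightarrow> ennreal) \<Rightarrow> 'a \<Rightarrow> ennreal" where
  "dyadic_maximal f x = (SUP k::int. ball_mean (2 powr real_of_int k) f x)"

lemma emeasure_ball_pos:
  assumes "0 < r"
  shows "emeasure lborel (ball (x::'a::euclidean_space) r) \<noteq> 0"
    "emeasure lborel (ball (x::'a::euclidean_space) r) \<noteq> top"
proof -
  have "0 < unit_ball_vol (DIM('a)) * r ^ DIM('a)"
    using assms by simp
  then have "ennreal (unit_ball_vol (DIM('a)) * r ^ DIM('a)) \<noteq> 0"
    by (metis ennreal_eq_0_iff not_le)
  then show "emeasure lborel (ball x r) \<noteq> 0"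
    using assms by (subst emeasure_ball) auto
  show "emeasure lborel (ball x r) \<noteq> top"
    using assms by (simp add: emeasure_ball)
qed

lemma ball_in_sets_borel [measurable]: "ball (x::'a::euclidean_space) r \<in> sets borel"
  by simp

lemma indicator_ball_measurable [measurable]:
  "(\<lambda>z. indicator (ball (fst z) r) (snd z) :: ennreal)
     \<in> borel_measurable (borel \<Otimes>\<^sub>M (borel :: 'a::euclidean_space measure))"
proof -
  have "(\<lambda>z. indicator (ball (fst z) r) (snd z) :: ennreal) =
      (\<lambda>z. if dist (fst z) (snd z :: 'a) < r then 1 else 0)"
    by (auto simp: indicator_def)
  then show ?thesis
    by simp
qed

lemma measurable_ball_mean [measurable]:
  assumes [measurable]: "f \<in> borel_measurable borel"
  shows "ball_mean r f \<in> borel_measurable (borel :: 'a::euclidean_space measure)"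
proof -
  have [measurable]: "(\<lambda>z. indicator (ball (fst z) r) (snd z) :: ennreal)
     \<in> borel_measurable (borel \<Otimes>\<^sub>M (lborel :: 'a::euclidean_space measure))"
    using indicator_ball_measurable by (simp cong: measurable_cong_sets sets_pair_measure_cong)
  have [measurable]: "(\<lambda>x. \<integral>\<^sup>+ y. f y * indicator (ball x r) y \<partial>lborel) \<in> borel_measurable borel"
    using lborel.borel_measurable_nn_integral[of "\<lambda>x y. f y * indicator (ball x r) y" borel]
    by (auto simp: split_beta')
  have "ball_mean r f = (\<lambda>x. (\<integral>\<^sup>+ y. f y * indicator (ball x r) y \<partial>lborel) / emeasure lborel (ball 0 r :: 'a set))"
  proof (cases "0 \<le> r")
    case True
    then show ?thesis by (auto simp: ball_mean_def emeasure_ball fun_eq_iff)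
  next
    case False
    then have *: "ball x r = {}" for x :: 'a
      by (intro ball_empty) simp
    show ?thesis by (simp add: ball_mean_def fun_eq_iff *)
  qed
  then show ?thesis
    by simp
qed

lemma measurable_dyadic_maximal [measurable]:
  assumes [measurable]: "f \<in> borel_measurable borel"
  shows "dyadic_maximal f \<in> borel_measurable borel"
  unfolding dyadic_maximal_def[abs_def] by measurable

lemma ball_mean_le_dyadic_maximal: "ball_mean (2 powr real_of_int k) f x \<le> dyadic_maximal f x"
  unfolding dyadic_maximal_def by (rule SUP_upper) simp

text \<open>
  Dividing by the volume loses nothing: for positive radius it is neither 0 nor \<open>\<infinity>\<close>.
\<close>

lemma ball_mean_eq_integral:
  assumes "0 < r"
  shows "(\<integral>\<^sup>+ y. f y * indicator (ball x r) y \<partial>lborel) = emeasure lborel (ball x r) * ball_mean r f x"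
  unfolding ball_mean_def using emeasure_ball_pos[OF assms, of x]
  by (simp add: ennreal_divide_times mult.commute[of "emeasure lborel (ball x r)"])
     (metis ennreal_divide_self ennreal_divide_times less_top mult.right_neutral not_gr_zero)

lemma ball_mean_add_le:
  assumes [measurable]: "f \<in> borel_measurable borel" "g \<in> borel_measurable borel"
    and "\<And>y. h y \<le> f y + g y"
  shows "ball_mean r h x \<le> ball_mean r f x + ball_mean r g x"
proof -
  have "(\<integral>\<^sup>+ y. h y * indicator (ball x r) y \<partial>lborel) \<le>
     (\<integral>\<^sup>+ y. (f y * indicator (ball x r) y) + g y * indicator (ball x r) y \<partial>lborel)"
    by (intro nn_integral_mono) (auto simp: indicator_def assms)
  also have "\<dots> = (\<integral>\<^sup>+ y. f y * indicator (ball x r) y \<partial>lborel) + (\<integral>\<^sup>+ y. g y * indicator (ball x r) y \<partial>lborel)"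
    by (intro nn_integral_add borel_measurable_times_ennreal borel_measurable_indicator) auto
  finally show ?thesis
    unfolding ball_mean_def by (metis add_divide_distrib_ennreal divide_right_mono_ennreal)
qed

lemma ball_mean_const_le:
  assumes "0 < r" "\<And>y. f y \<le> c"
  shows "ball_mean r f x \<le> c"
proof -
  have "(\<integral>\<^sup>+ y. f y * indicator (ball x r) y \<partial>lborel) \<le> (\<integral>\<^sup>+ y. c * indicator (ball x r) y \<partial>lborel)"
    by (intro nn_integral_mono mult_right_mono assms) auto
  also have "\<dots> = c * emeasure lborel (ball x r)"
    by (subst nn_integral_cmult_indicator) auto
  finally have "ball_mean r f x \<le> c * emeasure lborel (ball x r) / emeasure lborel (ball x r)"
    unfolding ball_mean_def by (rule divide_right_mono_ennreal)
  also have "\<dots> = c"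
    using emeasure_ball_pos[OF assms(1), of x]
    by (metis ennreal_divide_times ennreal_divide_self less_top mult.right_neutral mult_divide_eq_ennreal)
  finally show ?thesis .
qed

text \<open>
  Every point of the level set is the centre of a ball of volume at most \<open>1/l\<close> times the integral
  over that ball. If \<open>f\<close> is integrable, these radii are bounded, so the Vitali covering lemma
  selects countably many disjoint balls whose fivefold dilates cover the level set.
\<close>

lemma dyadic_maximal_weak_type:
  fixes f :: "'a::euclidean_space \<Rightarrow> ennreal"
  assumes [measurable]: "f \<in> borel_measurable borel" and l: "0 < (l::real)"
  shows "ennreal l * emeasure lborel {x. ennreal l < dyadic_maximal f x} \<le>
    ennreal (5 ^ DIM('a)) * (\<integral>\<^sup>+ y. f y \<partial>lborel)"
proof (cases "(\<integral>\<^sup>+ y. f y \<partial>lborel)")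
  case top
  then show ?thesis by (simp add: ennreal_mult_top)
next
  case (real F)
  define S where "S = {x. ennreal l < dyadic_maximal f x}"
  have "\<exists>k::int. ennreal l < ball_mean (2 powr real_of_int k) f x" if "x \<in> S" for x
    using that by (auto simp: S_def dyadic_maximal_def less_SUP_iff)
  then obtain \<kappa> :: "'a \<Rightarrow> int" where \<kappa>: "\<And>x. x \<in> S \<Longrightarrow> ennreal l < ball_mean (2 powr \<kappa> x) f x"
    by metis
  define r where "r x = 2 powr real_of_int (\<kappa> x)" for x
  have r0: "0 < r x" for x by (simp add: r_def)
  have vol: "ennreal l * emeasure lborel (ball x (r x)) \<le> (\<integral>\<^sup>+ y. f y * indicator (ball x (r x)) y \<partial>lborel)"
    if "x \<in> S" for x
  proof -
    have "ennreal l \<le> ball_mean (r x) f x"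
      using \<kappa>[OF that] by (simp add: r_def)
    then have "ennreal l * emeasure lborel (ball x (r x)) \<le> ball_mean (r x) f x * emeasure lborel (ball x (r x))"
      by (rule mult_right_mono) simp
    then show ?thesis
      by (simp only: ball_mean_eq_integral[OF r0] mult.commute)
  qed
  define v where "v = unit_ball_vol (real (DIM('a)))"
  have v0: "0 < v" by (simp add: v_def)
  \<comment> \<open>A radius \<open>r > 1\<close> satisfies \<open>r \<le> r\<^sup>n\<close>, and \<open>l v r\<^sup>n\<close> is at most the integral \<open>F\<close> of \<open>f\<close>.\<close>
  have rB: "r x \<le> max 1 (F / (l * v))" if "x \<in> S" for x
  proof (rule ccontr)
    assume "\<not> ?thesis"
    then have r1: "1 < r x" and r2: "F / (l * v) < r x" by auto
    have "ennreal l * ennreal (v * r x ^ DIM('a)) \<le> (\<integral>\<^sup>+ y. f y * indicator (ball x (r x)) y \<partial>lborel)"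
      using vol[OF that] r0[of x] by (simp add: emeasure_ball v_def)
    also have "\<dots> \<le> (\<integral>\<^sup>+ y. f y \<partial>lborel)"
      by (rule nn_integral_mono) (simp add: indicator_def)
    finally have "ennreal l * ennreal (v * r x ^ DIM('a)) \<le> ennreal F"
      using real by simp
    then have "l * (v * r x ^ DIM('a)) \<le> F"
      using l v0 r0[of x] real by (simp flip: ennreal_mult)
    moreover have "r x \<le> r x ^ DIM('a)"
      using r1 by (simp add: self_le_power)
    ultimately have "l * (v * r x) \<le> F"
      using l v0 by (meson mult_left_mono less_imp_le order_trans)
    with r2 show False using l v0 by (simp add: field_simps)
  qed
  obtain C where C: "countable C" "C \<subseteq> S"
     "pairwise (\<lambda>i j. disjnt (ball i (r i)) (ball j (r j))) C"
     "S \<subseteq> (\<Union>i\<in>C. ball i (5 * r i))"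
    by (rule Vitali_covering_lemma_balls[where S=S and K=S and a="\<lambda>x. x" and r=r and B="max 1 (F / (l * v))"])
       (use r0 rB in \<open>auto\<close>)
  have [measurable]: "S \<in> sets borel"
    unfolding S_def by measurable
  have "emeasure lborel S = (\<integral>\<^sup>+ y. indicator S y \<partial>lborel)"
    by simp
  also have "\<dots> \<le> (\<integral>\<^sup>+ y. (\<integral>\<^sup>+ i. indicator (ball i (5 * r i)) y \<partial>count_space C) \<partial>lborel)"
  proof (intro nn_integral_mono)
    fix y
    show "indicator S y \<le> (\<integral>\<^sup>+ i. indicator (ball i (5 * r i)) y \<partial>count_space C :: ennreal)"
    proof (cases "y \<in> S")
      case True
      then obtain i where i: "i \<in> C" "y \<in> ball i (5 * r i)" using C(4) by blast
      have "1 = (\<integral>\<^sup>+ j. indicator {i} j \<partial>count_space C)"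
        using i by simp
      also have "\<dots> \<le> (\<integral>\<^sup>+ i. indicator (ball i (5 * r i)) y \<partial>count_space C)"
        using i by (intro nn_integral_mono) (auto simp: indicator_def)
      finally show ?thesis using True by simp
    qed simp
  qed
  also have "\<dots> = (\<integral>\<^sup>+ i. (\<integral>\<^sup>+ y. indicator (ball i (5 * r i)) y \<partial>lborel) \<partial>count_space C)"
    by (rule nn_integral_count_space_nn_integral) (use C(1) in \<open>auto intro!: borel_measurable_indicator\<close>)
  also have "\<dots> = (\<integral>\<^sup>+ i. emeasure lborel (ball i (5 * r i)) \<partial>count_space C)"
    by simp
  also have "\<dots> = (\<integral>\<^sup>+ i. ennreal (5 ^ DIM('a)) * emeasure lborel (ball i (r i)) \<partial>count_space C)"
    using r0 by (intro nn_integral_cong)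
      (auto simp: emeasure_ball less_imp_le power_mult_distrib mult_ac simp flip: ennreal_mult)
  finally have "ennreal l * emeasure lborel S \<le>
      ennreal l * (\<integral>\<^sup>+ i. ennreal (5 ^ DIM('a)) * emeasure lborel (ball i (r i)) \<partial>count_space C)"
    by (rule mult_left_mono) simp
  also have "\<dots> = ennreal (5 ^ DIM('a)) * (\<integral>\<^sup>+ i. ennreal l * emeasure lborel (ball i (r i)) \<partial>count_space C)"
    using nn_integral_cmult[of "\<lambda>i. emeasure lborel (ball i (r i))" "count_space C" "ennreal l"]
      nn_integral_cmult[of "\<lambda>i. emeasure lborel (ball i (r i))" "count_space C" "ennreal (5 ^ DIM('a))"]
    by (simp add: mult_ac)
  also have "\<dots> \<le> ennreal (5 ^ DIM('a)) * (\<integral>\<^sup>+ i. (\<integral>\<^sup>+ y. f y * indicator (ball i (r i)) y \<partial>lborel) \<partial>count_space C)"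
    using vol C(2) by (intro mult_left_mono nn_integral_mono) auto
  also have "(\<integral>\<^sup>+ i. (\<integral>\<^sup>+ y. f y * indicator (ball i (r i)) y \<partial>lborel) \<partial>count_space C) =
     (\<integral>\<^sup>+ y. (\<integral>\<^sup>+ i. f y * indicator (ball i (r i)) y \<partial>count_space C) \<partial>lborel)"
    by (rule nn_integral_count_space_nn_integral[symmetric]) (use C(1) in auto)
  also have "\<dots> \<le> (\<integral>\<^sup>+ y. f y \<partial>lborel)"
  proof (intro nn_integral_mono)
    fix y
    have "(\<integral>\<^sup>+ i. indicator (ball i (r i)) y \<partial>count_space C) =
        (\<integral>\<^sup>+ i. indicator {i\<in>C. y \<in> ball i (r i)} i \<partial>count_space C)"
      by (intro nn_integral_cong) (auto simp: indicator_def)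
    also have "\<dots> = emeasure (count_space C) {i\<in>C. y \<in> ball i (r i)}"
      by (rule nn_integral_indicator) auto
    also have "\<dots> \<le> 1"
    proof (cases "\<exists>i\<in>C. y \<in> ball i (r i)")
      case True
      then obtain i where i: "i \<in> C" "y \<in> ball i (r i)" by auto
      have "{i\<in>C. y \<in> ball i (r i)} = {i}"
        using i C(3) by (auto simp: pairwise_def disjnt_def simp del: mem_ball)
      then show ?thesis using i by (simp add: emeasure_count_space del: mem_ball)
    next
      case False
      then have *: "{i\<in>C. y \<in> ball i (r i)} = {}" by auto
      show ?thesis unfolding * by simp
    qed
    finally show "(\<integral>\<^sup>+ i. f y * indicator (ball i (r i)) y \<partial>count_space C) \<le> f y"
      by (subst nn_integral_cmult) (auto dest: mult_left_mono[where c="f y"])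
  qed
  finally show ?thesis
    by (simp add: S_def mult_left_mono)
qed

lemma nn_integral_powr_Icc_0:
  assumes "0 < t" "0 \<le> b"
  shows "(\<integral>\<^sup>+ l. ennreal (l powr (t - 1)) * indicator {0..b} l \<partial>lborel) = ennreal (b powr t / t)"
proof -
  have "(\<integral>\<^sup>+ l. ennreal (indicator {0..b} l * l powr (t - 1)) \<partial>lborel) = ennreal (b powr t / t)"
    by (rule nn_integral_has_integral_lebesgue)
       (use has_integral_powr_from_0[of "t - 1" b] assms in auto)
  then show ?thesis
    by (simp add: ennreal_mult' ennreal_indicator mult.commute)
qed

text \<open>
  Also for \<open>u = \<infinity>\<close>: the integrals over the bounded intervals exhaust every real number.
\<close>

lemma epow_layer_cake:
  assumes t: "0 < t"
  shows "epow u t = (\<integral>\<^sup>+ l. ennreal (t * l powr (t - 1)) * indicator {l. 0 < l \<and> ennreal l < u} l \<partial>lborel)"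
proof -
  have fin: "(\<integral>\<^sup>+ l. ennreal (t * l powr (t - 1)) * indicator {0..b} l \<partial>lborel) = ennreal (b powr t)"
    if "0 \<le> b" for b :: real
  proof -
    have "(\<integral>\<^sup>+ l. ennreal (t * l powr (t - 1)) * indicator {0..b} l \<partial>lborel) =
        (\<integral>\<^sup>+ l. ennreal t * (ennreal (l powr (t - 1)) * indicator {0..b} l) \<partial>lborel)"
      using t by (simp add: ennreal_mult mult.assoc)
    also have "\<dots> = ennreal t * ennreal (b powr t / t)"
      by (subst nn_integral_cmult) (auto simp only: nn_integral_powr_Icc_0[OF t that], measurable)
    also have "\<dots> = ennreal (b powr t)"
      using t by (simp flip: ennreal_mult)
    finally show ?thesis .
  qed
  show ?thesis
  proof (cases u)
    case (real b)
    have "AE l in lborel. ennreal (t * l powr (t - 1)) * indicator {l. 0 < l \<and> ennreal l < u} l =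
       ennreal (t * l powr (t - 1)) * indicator {0..b} l"
      using AE_lborel_singleton[of 0] AE_lborel_singleton[of b]
      by eventually_elim (auto simp: indicator_def real ennreal_less_iff)
    then have "(\<integral>\<^sup>+ l. ennreal (t * l powr (t - 1)) * indicator {l. 0 < l \<and> ennreal l < u} l \<partial>lborel) =
       (\<integral>\<^sup>+ l. ennreal (t * l powr (t - 1)) * indicator {0..b} l \<partial>lborel)"
      by (rule nn_integral_cong_AE)
    then show ?thesis
      using real fin by simp
  next
    case top
    have "ennreal c \<le> (\<integral>\<^sup>+ l. ennreal (t * l powr (t - 1)) * indicator {l. 0 < l \<and> ennreal l < u} l \<partial>lborel)"
      if "0 \<le> c" for c
    proof -
      have "ennreal c = (\<integral>\<^sup>+ l. ennreal (t * l powr (t - 1)) * indicator {0..c powr (1/t)} l \<partial>lborel)"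
        using t that by (subst fin) (auto simp: powr_powr)
      also have "\<dots> \<le> (\<integral>\<^sup>+ l. ennreal (t * l powr (t - 1)) * indicator {l. 0 < l \<and> ennreal l < u} l \<partial>lborel)"
        using AE_lborel_singleton[of 0]
        by (intro nn_integral_mono_AE, eventually_elim) (auto simp: indicator_def top)
      finally show ?thesis .
    qed
    then have *: "(\<integral>\<^sup>+ l. ennreal (t * l powr (t - 1)) * indicator {l. 0 < l \<and> ennreal l < u} l \<partial>lborel) = top"
    proof (cases "\<integral>\<^sup>+ l. ennreal (t * l powr (t - 1)) * indicator {l. 0 < l \<and> ennreal l < u} l \<partial>lborel")
      case (real b)
      have "ennreal (b + 1) \<le> ennreal b"
        using \<open>\<And>c. 0 \<le> c \<Longrightarrow> ennreal c \<le> _\<close>[of "b + 1"] real by simp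
      then show ?thesis using real by simp
    qed
    show ?thesis
      unfolding * by (simp add: top)
  qed
qed

text \<open>
  Marcinkiewicz interpolation between the weak bound and the trivial bound on bounded functions: at
  height \<open>l\<close> only the part of \<open>f\<close> above \<open>l/2\<close> matters, since the rest contributes at most \<open>l/2\<close> to
  the maximal function. Integrating the weak bound against \<open>t l\<^bsup>t-1\<^esup> dl\<close> and exchanging the
  integrals leaves \<open>\<integral> l\<^bsup>t-2\<^esup> dl\<close> over \<open>0 < l < 2 f(x)\<close>, finite because \<open>t > 1\<close>.
\<close>

theorem dyadic_maximal_strong_type:
  fixes f :: "'a::euclidean_space \<Rightarrow> real"
  assumes [measurable]: "f \<in> borel_measurable borel" and f0: "\<And>x. 0 \<le> f x" and t: "1 < t"
  shows "(\<integral>\<^sup>+ x. epow (dyadic_maximal f x) t \<partial>lborel) \<le>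
    ennreal (2 powr t * 5 ^ DIM('a) * t / (t - 1)) * (\<integral>\<^sup>+ x. ennreal (f x powr t) \<partial>lborel)"
proof -
  define M where "M = dyadic_maximal (\<lambda>x. ennreal (f x))"
  have [measurable]: "M \<in> borel_measurable borel"
    unfolding M_def by measurable
  define g where "g l x = ennreal (f x * indicator {l/2<..} (f x))" for l x
  have [measurable]: "g l \<in> borel_measurable borel" for l
    unfolding g_def by measurable
  have weak: "ennreal (l / 2) * emeasure lborel {x. ennreal l < M x} \<le>
      ennreal (5 ^ DIM('a)) * (\<integral>\<^sup>+ x. g l x \<partial>lborel)" if "0 < l" for l
  proof -
    have "M x \<le> dyadic_maximal (g l) x + ennreal (l / 2)" for x
      unfolding M_def dyadic_maximal_def
    proof (rule SUP_least)
      fix k :: int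
      have "ball_mean (2 powr k) (\<lambda>x. ennreal (f x)) x \<le>
          ball_mean (2 powr k) (g l) x + ball_mean (2 powr k) (\<lambda>x. ennreal (l/2)) x"
        using that f0 by (intro ball_mean_add_le) (auto simp: g_def indicator_def ennreal_leI not_less)
      also have "\<dots> \<le> (SUP k::int. ball_mean (2 powr k) (g l) x) + ennreal (l / 2)"
        by (intro add_mono SUP_upper ball_mean_const_le) auto
      finally show "ball_mean (2 powr k) (\<lambda>x. ennreal (f x)) x \<le> \<dots>" .
    qed
    then have "ennreal (l/2) < dyadic_maximal (g l) x" if "ennreal l < M x" for x
    proof -
      have "ennreal (l/2) + ennreal (l/2) < dyadic_maximal (g l) x + ennreal (l/2)"
        using that \<open>0 < l\<close> order_less_le_trans[OF that \<open>M x \<le> _\<close>]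
        by (simp flip: ennreal_plus)
      then show ?thesis
        by (metis add_mono leI linorder_not_less order_refl)
    qed
    then have "emeasure lborel {x. ennreal l < M x} \<le> emeasure lborel {x. ennreal (l/2) < dyadic_maximal (g l) x}"
      by (intro emeasure_mono) auto
    then have "ennreal (l / 2) * emeasure lborel {x. ennreal l < M x} \<le>
       ennreal (l / 2) * emeasure lborel {x. ennreal (l/2) < dyadic_maximal (g l) x}"
      by (rule mult_left_mono) simp
    also have "\<dots> \<le> ennreal (5 ^ DIM('a)) * (\<integral>\<^sup>+ x. g l x \<partial>lborel)"
      by (rule dyadic_maximal_weak_type) (use that in auto)
    finally show ?thesis .
  qed
  have "(\<integral>\<^sup>+ x. epow (M x) t \<partial>lborel) =
     (\<integral>\<^sup>+ x. (\<integral>\<^sup>+ l. ennreal (t * l powr (t - 1)) * indicator {l. 0 < l \<and> ennreal l < M x} l \<partial>lborel) \<partial>lborel)"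
    using t by (subst epow_layer_cake[of t]) auto
  also have "\<dots> = (\<integral>\<^sup>+ x. (\<integral>\<^sup>+ l. ennreal (t * l powr (t - 1)) * (if 0 < l \<and> ennreal l < M x then 1 else 0) \<partial>lborel) \<partial>lborel)"
    by (intro nn_integral_cong) (auto simp: indicator_def)
  also have "\<dots> = (\<integral>\<^sup>+ l. (\<integral>\<^sup>+ x. ennreal (t * l powr (t - 1)) * (if 0 < l \<and> ennreal l < M x then 1 else 0) \<partial>lborel) \<partial>lborel)"
    by (rule lborel_pair.Fubini') measurable
  also have "\<dots> \<le> (\<integral>\<^sup>+ l. (\<integral>\<^sup>+ x. ennreal (2 * 5 ^ DIM('a) * t) *
       (ennreal (l powr (t - 2)) * (if 0 < l \<and> l < 2 * f x then ennreal (f x) else 0)) \<partial>lborel) \<partial>lborel)"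
  proof (rule nn_integral_mono)
    fix l :: real
    show "(\<integral>\<^sup>+ x. ennreal (t * l powr (t - 1)) * (if 0 < l \<and> ennreal l < M x then 1 else 0) \<partial>lborel) \<le>
      (\<integral>\<^sup>+ x. ennreal (2 * 5 ^ DIM('a) * t) *
       (ennreal (l powr (t - 2)) * (if 0 < l \<and> l < 2 * f x then ennreal (f x) else 0)) \<partial>lborel)"
    proof (cases "0 < l")
      case l: True
      have "(\<integral>\<^sup>+ x. ennreal (t * l powr (t - 1)) * (if 0 < l \<and> ennreal l < M x then 1 else 0) \<partial>lborel) =
        (\<integral>\<^sup>+ x. ennreal (t * l powr (t - 1)) * indicator {x. ennreal l < M x} x \<partial>lborel)"
        using l by (intro nn_integral_cong) (auto simp: indicator_def)
      also have "\<dots> = ennreal (t * l powr (t - 1)) * emeasure lborel {x. ennreal l < M x}"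
        by (subst nn_integral_cmult_indicator) auto
      also have "\<dots> = ennreal (2 * t * l powr (t - 2)) * (ennreal (l / 2) * emeasure lborel {x. ennreal l < M x})"
      proof -
        have "t * l powr (t - 1) = (2 * t * l powr (t - 2)) * (l / 2)"
          using l powr_add[of l "t - 2" 1] by simp
        then have "ennreal (t * l powr (t - 1)) = ennreal (2 * t * l powr (t - 2)) * ennreal (l / 2)"
          using l t by (simp only: ennreal_mult) (simp flip: ennreal_mult)
        then show ?thesis
          by (simp only: mult.assoc)
      qed
      also have "\<dots> \<le> ennreal (2 * t * l powr (t - 2)) * (ennreal (5 ^ DIM('a)) * (\<integral>\<^sup>+ x. g l x \<partial>lborel))"
        by (intro mult_left_mono weak l) auto
      also have "\<dots> = ennreal (2 * t * l powr (t - 2) * 5 ^ DIM('a)) * (\<integral>\<^sup>+ x. g l x \<partial>lborel)"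
        using t by (simp add: ennreal_mult' mult.assoc)
      also have "\<dots> = (\<integral>\<^sup>+ x. ennreal (2 * t * l powr (t - 2) * 5 ^ DIM('a)) * g l x \<partial>lborel)"
        by (subst nn_integral_cmult) auto
      also have "\<dots> = (\<integral>\<^sup>+ x. ennreal (2 * 5 ^ DIM('a) * t) *
       (ennreal (l powr (t - 2)) * (if 0 < l \<and> l < 2 * f x then ennreal (f x) else 0)) \<partial>lborel)"
        using l t by (intro nn_integral_cong) (auto simp: g_def indicator_def f0 mult_ac simp flip: ennreal_mult)
      finally show ?thesis .
    qed simp
  qed
  also have "\<dots> = (\<integral>\<^sup>+ x. (\<integral>\<^sup>+ l. ennreal (2 * 5 ^ DIM('a) * t) *
       (ennreal (l powr (t - 2)) * (if 0 < l \<and> l < 2 * f x then ennreal (f x) else 0)) \<partial>lborel) \<partial>lborel)"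
    by (rule lborel_pair.Fubini') measurable
  also have "\<dots> \<le> (\<integral>\<^sup>+ x. ennreal (2 powr t * 5 ^ DIM('a) * t / (t - 1)) * ennreal (f x powr t) \<partial>lborel)"
  proof (rule nn_integral_mono)
    fix x :: 'a
    have "(\<integral>\<^sup>+ l. ennreal (2 * 5 ^ DIM('a) * t) *
       (ennreal (l powr (t - 2)) * (if 0 < l \<and> l < 2 * f x then ennreal (f x) else 0)) \<partial>lborel) \<le>
      (\<integral>\<^sup>+ l. ennreal (2 * 5 ^ DIM('a) * t * f x) * (ennreal (l powr (t - 1 - 1)) * indicator {0..2 * f x} l) \<partial>lborel)"
      using t f0[of x] by (intro nn_integral_mono) (auto simp: indicator_def mult_ac simp flip: ennreal_mult)
    also have "\<dots> = ennreal (2 * 5 ^ DIM('a) * t * f x) * ennreal ((2 * f x) powr (t - 1) / (t - 1))"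
    proof -
      have h: "(\<integral>\<^sup>+ l. ennreal (l powr (t - 1 - 1)) * indicator {0..2 * f x} l \<partial>lborel) =
          ennreal ((2 * f x) powr (t - 1) / (t - 1))"
        using t f0[of x] by (intro nn_integral_powr_Icc_0) auto
      show ?thesis
        unfolding h[symmetric] by (rule nn_integral_cmult) measurable
    qed
    also have "\<dots> = ennreal (2 powr t * 5 ^ DIM('a) * t / (t - 1)) * ennreal (f x powr t)"
    proof -
      have "2 * 5 ^ DIM('a) * t * f x * ((2 * f x) powr (t - 1) / (t - 1)) = 2 powr t * 5 ^ DIM('a) * t / (t - 1) * f x powr t"
      proof (cases "f x = 0")
        case False
        then have "(2 * f x) powr (t - 1) = (2 powr t * f x powr t) / (2 * f x)"
          using f0[of x] by (simp add: powr_diff powr_mult)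
        then show ?thesis using False by (simp add: field_simps)
      qed simp
      then show ?thesis
        using t f0[of x] by (simp flip: ennreal_mult)
    qed
    finally show "(\<integral>\<^sup>+ l. ennreal (2 * 5 ^ DIM('a) * t) *
       (ennreal (l powr (t - 2)) * (if 0 < l \<and> l < 2 * f x then ennreal (f x) else 0)) \<partial>lborel) \<le>
       ennreal (2 powr t * 5 ^ DIM('a) * t / (t - 1)) * ennreal (f x powr t)" .
  qed
  also have "\<dots> = ennreal (2 powr t * 5 ^ DIM('a) * t / (t - 1)) * (\<integral>\<^sup>+ x. ennreal (f x powr t) \<partial>lborel)"
    by (rule nn_integral_cmult) measurable
  finally show ?thesis
    unfolding M_def .
qed

section \<open>Jensen's inequality for weights of mass at most one\<close>

text \<open>
  Young's inequality bounds \<open>g\<close> by an affine function of \<open>g\<^sup>P\<close> tangent at a height \<open>c\<close>; the best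
  choice of \<open>c\<close> is the \<open>P\<close>-th root of the right-hand side.
\<close>

lemma jensen_epow:
  fixes g :: "'a \<Rightarrow> real"
  assumes [measurable]: "g \<in> borel_measurable M" "w \<in> borel_measurable M"
    and g0: "\<And>y. 0 \<le> g y" and w: "(\<integral>\<^sup>+ y. w y \<partial>M) \<le> 1" and P: "1 \<le> P"
  shows "epow (\<integral>\<^sup>+ y. ennreal (g y) * w y \<partial>M) P \<le> (\<integral>\<^sup>+ y. ennreal (g y powr P) * w y \<partial>M)"
proof (cases "(\<integral>\<^sup>+ y. ennreal (g y powr P) * w y \<partial>M)")
  case (real J)
  show ?thesis
  proof (cases "J = 0")
    case True
    then have "AE y in M. ennreal (g y powr P) * w y = 0"
      using real by (subst nn_integral_0_iff_AE[symmetric]) auto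
    then have "AE y in M. ennreal (g y) * w y = 0"
      by eventually_elim (auto simp: ennreal_eq_0_iff)
    then have "(\<integral>\<^sup>+ y. ennreal (g y) * w y \<partial>M) = 0"
      by (subst nn_integral_0_iff_AE) auto
    then show ?thesis
      by simp
  next
    case False
    with real have J: "0 < J" by simp
    define c where "c = J powr (1 / P)"
    have c: "0 < c" using J by (simp add: c_def)
    have young: "g y \<le> (c powr (1 - P) / P) * g y powr P + (1 - 1 / P) * c" for y
    proof -
      have "u \<le> u powr P / P + (1 - 1 / P)" if "0 \<le> u" for u :: real
      proof (cases "P = 1")
        case True
        then show ?thesis using that by simp
      next
        case False
        then have "u * 1 \<le> u powr P / P + 1 powr (P / (P - 1)) / (P / (P - 1))"
          using that P by (intro Youngs_inequality) (auto simp: field_simps)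
        then show ?thesis using P False by (simp add: field_simps)
      qed
      from mult_left_mono[OF this[of "g y / c"], of c] show ?thesis
        using c g0[of y] P by (simp add: powr_divide powr_diff field_simps)
    qed
    have "(\<integral>\<^sup>+ y. ennreal (g y) * w y \<partial>M) \<le>
        (\<integral>\<^sup>+ y. ennreal (c powr (1 - P) / P) * (ennreal (g y powr P) * w y) + ennreal ((1 - 1 / P) * c) * w y \<partial>M)"
    proof (rule nn_integral_mono)
      fix y
      have "ennreal (g y) \<le> ennreal ((c powr (1 - P) / P) * g y powr P + (1 - 1 / P) * c)"
        by (rule ennreal_leI[OF young])
      also have "\<dots> = ennreal (c powr (1 - P) / P) * ennreal (g y powr P) + ennreal ((1 - 1 / P) * c)"
        using c P by (subst ennreal_plus) (auto simp flip: ennreal_mult)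
      finally have "ennreal (g y) * w y \<le> (ennreal (c powr (1 - P) / P) * ennreal (g y powr P) + ennreal ((1 - 1 / P) * c)) * w y"
        by (rule mult_right_mono) simp
      then show "ennreal (g y) * w y \<le> ennreal (c powr (1 - P) / P) * (ennreal (g y powr P) * w y) + ennreal ((1 - 1 / P) * c) * w y"
        by (simp add: distrib_right mult.assoc)
    qed
    also have "\<dots> = ennreal (c powr (1 - P) / P) * ennreal J + ennreal ((1 - 1 / P) * c) * (\<integral>\<^sup>+ y. w y \<partial>M)"
      by (simp add: nn_integral_add nn_integral_cmult real)
    also have "\<dots> \<le> ennreal (c powr (1 - P) / P) * ennreal J + ennreal ((1 - 1 / P) * c) * 1"
      by (intro add_left_mono mult_left_mono w) simp
    also have "\<dots> = ennreal (c powr (1 - P) / P * J + (1 - 1 / P) * c)"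
      using c P J by (subst ennreal_plus) (auto simp flip: ennreal_mult)
    also have "c powr (1 - P) / P * J + (1 - 1 / P) * c = c"
    proof -
      have "c powr P = J" using J P by (simp add: c_def powr_powr)
      then have "c powr (1 - P) * J = c" using c J by (simp add: powr_diff)
      then show ?thesis using P by (simp add: field_simps)
    qed
    finally have "epow (\<integral>\<^sup>+ y. ennreal (g y) * w y \<partial>M) P \<le> epow (ennreal c) P"
      using P by (intro epow_mono) auto
    also have "\<dots> = ennreal J"
      using c J P by (simp add: c_def powr_powr)
    finally show ?thesis using real by simp
  qed
qed simp

lemma ball_mean_jensen:
  fixes g :: "'a::euclidean_space \<Rightarrow> real"
  assumes [measurable]: "g \<in> borel_measurable borel" and g0: "\<And>y. 0 \<le> g y" and P: "1 \<le> P" and r: "0 < r"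
  shows "epow (ball_mean r (\<lambda>y. ennreal (g y)) x) P \<le> ball_mean r (\<lambda>y. ennreal (g y powr P)) x"
proof -
  define w where "w y = indicator (ball x r) y / emeasure lborel (ball x r)" for y
  have [measurable]: "w \<in> borel_measurable lborel"
    unfolding w_def by measurable
  have eq: "ball_mean r f x = (\<integral>\<^sup>+ y. f y * w y \<partial>lborel)" if [measurable]: "f \<in> borel_measurable borel" for f
    unfolding ball_mean_def w_def
    by (subst nn_integral_divide[symmetric]) (auto simp: ennreal_times_divide)
  have "(\<integral>\<^sup>+ y. w y \<partial>lborel) = emeasure lborel (ball x r) / emeasure lborel (ball x r)"
    unfolding w_def by (subst nn_integral_divide) auto
  also have "\<dots> = 1"
    using emeasure_ball_pos[OF r, of x] by (simp add: ennreal_divide_self less_top)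
  finally have "(\<integral>\<^sup>+ y. w y \<partial>lborel) \<le> 1" by simp
  then have "epow (\<integral>\<^sup>+ y. ennreal (g y) * w y \<partial>lborel) P \<le> (\<integral>\<^sup>+ y. ennreal (g y powr P) * w y \<partial>lborel)"
    by (intro jensen_epow g0 P) auto
  then show ?thesis
    by (simp add: eq)
qed

section \<open>Riesz potentials and Hedberg's inequality\<close>

definition riesz_potential :: "real \<Rightarrow> ('a::euclidean_space \<Rightarrow> ennreal) \<Rightarrow> 'a \<Rightarrow> ennreal" where
  "riesz_potential a f x = (\<integral>\<^sup>+ y. f y * ennreal (norm (x - y) powr (a - DIM('a))) \<partial>lborel)"

lemma measurable_riesz_potential [measurable]:
  assumes [measurable]: "f \<in> borel_measurable borel"
  shows "riesz_potential a f \<in> borel_measurable (borel :: 'a::euclidean_space measure)"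
  unfolding riesz_potential_def[abs_def] by measurable

lemma dyadic_scale:
  assumes "0 < (u::real)"
  obtains k :: int where "2 powr (real_of_int k - 1) \<le> u" "u < 2 powr real_of_int k"
proof
  have "real_of_int (\<lfloor>log 2 u\<rfloor> + 1) - 1 \<le> log 2 u" "log 2 u < real_of_int (\<lfloor>log 2 u\<rfloor> + 1)"
    by linarith+
  then show "2 powr (real_of_int (\<lfloor>log 2 u\<rfloor> + 1) - 1) \<le> u" "u < 2 powr real_of_int (\<lfloor>log 2 u\<rfloor> + 1)"
    using assms le_log_iff[of 2 u "real_of_int (\<lfloor>log 2 u\<rfloor> + 1) - 1"] log_less_iff[of 2 u "real_of_int (\<lfloor>log 2 u\<rfloor> + 1)"]
    by auto
qed

lemma powr_le_dyadic:
  assumes "0 \<le> s" "0 < u" "2 powr (real_of_int k - 1) \<le> u"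
  shows "u powr (- s) \<le> 2 powr s * 2 powr (- s * real_of_int k)"
proof -
  have "u powr (- s) \<le> (2 powr (real_of_int k - 1)) powr (- s)"
    using assms by (intro powr_mono2') auto
  also have "\<dots> = 2 powr s * 2 powr (- s * real_of_int k)"
    by (simp add: powr_powr algebra_simps flip: powr_add)
  finally show ?thesis .
qed

text \<open>
  A nonzero \<open>z\<close> has norm in exactly one dyadic interval, and the corresponding term alone dominates
  the left-hand side. The sum over all integers is cut at \<open>k0\<close> into two sums over the natural
  numbers because the two halves are later summed by different estimates.
\<close>

lemma powr_le_dyadic_sum:
  fixes z :: "'a::real_normed_vector" and k0 :: int
  assumes s: "0 \<le> s"
  shows "ennreal (norm z powr (- s)) \<le> ennreal (2 powr s) *
     ((\<Sum>j. ennreal (2 powr (- s * real_of_int (k0 - int j))) * indicator (ball 0 (2 powr real_of_int (k0 - int j))) z) +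
      (\<Sum>j. ennreal (2 powr (- s * real_of_int (k0 + 1 + int j))) * indicator (ball 0 (2 powr real_of_int (k0 + 1 + int j))) z))"
proof (cases "z = 0")
  case False
  then obtain k :: int where k: "2 powr (real_of_int k - 1) \<le> norm z" "norm z < 2 powr real_of_int k"
    using dyadic_scale[of "norm z"] by auto
  define t where "t = (\<lambda>k::int. ennreal (2 powr (- s * real_of_int k)) * indicator (ball 0 (2 powr real_of_int k)) z)"
  have "ennreal (norm z powr (- s)) \<le> ennreal (2 powr s * 2 powr (- s * real_of_int k))"
    using False s k by (intro ennreal_leI powr_le_dyadic) auto
  also have "\<dots> = ennreal (2 powr s) * t k"
    using k by (simp add: t_def ennreal_mult)
  also have "\<dots> \<le> ennreal (2 powr s) * ((\<Sum>j. t (k0 - int j)) + (\<Sum>j. t (k0 + 1 + int j)))"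
  proof (rule mult_left_mono)
    have le: "h i \<le> (\<Sum>j. h j)" for h :: "nat \<Rightarrow> ennreal" and i
      using sum_le_suminf[of h "{i}"] by auto
    show "t k \<le> (\<Sum>j. t (k0 - int j)) + (\<Sum>j. t (k0 + 1 + int j))"
    proof (cases "k \<le> k0")
      case True
      then show ?thesis
        using le[of "\<lambda>j. t (k0 - int j)" "nat (k0 - k)"] by (simp add: add_increasing2)
    next
      case False
      then show ?thesis
        using le[of "\<lambda>j. t (k0 + 1 + int j)" "nat (k - k0 - 1)"] by (simp add: add_increasing)
    qed
  qed simp
  finally show ?thesis
    unfolding t_def .
qed simp

lemma riesz_potential_le_dyadic_sum:
  fixes x :: "'a::euclidean_space" and a :: real
  assumes [measurable]: "f \<in> borel_measurable borel" and a: "a \<le> DIM('a)"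
  defines "I \<equiv> \<lambda>k::int. ennreal (2 powr ((a - DIM('a)) * real_of_int k)) *
      (\<integral>\<^sup>+ y. f y * indicator (ball x (2 powr real_of_int k)) y \<partial>lborel)"
  shows "riesz_potential a f x \<le> ennreal (2 powr (DIM('a) - a)) *
     ((\<Sum>j. I (k0 - int j)) + (\<Sum>j. I (k0 + 1 + int j)))"
proof -
  define s where "s = DIM('a) - a"
  define t where "t k y = f y * (ennreal (2 powr (- s * real_of_int k)) * indicator (ball x (2 powr real_of_int k)) y)" for k y
  have [measurable]: "t k \<in> borel_measurable lborel" for k
    unfolding t_def by measurable
  have I: "(\<integral>\<^sup>+ y. t k y \<partial>lborel) = I k" for k
  proof -
    have "(\<integral>\<^sup>+ y. t k y \<partial>lborel) = (\<integral>\<^sup>+ y. ennreal (2 powr (- s * real_of_int k)) * (f y * indicator (ball x (2 powr real_of_int k)) y) \<partial>lborel)"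
      by (simp add: t_def mult_ac)
    also have "\<dots> = I k"
      unfolding I_def by (subst nn_integral_cmult) (auto simp: s_def)
    finally show ?thesis .
  qed
  have "riesz_potential a f x \<le> (\<integral>\<^sup>+ y. ennreal (2 powr s) *
     ((\<Sum>j. t (k0 - int j) y) + (\<Sum>j. t (k0 + 1 + int j) y)) \<partial>lborel)"
    unfolding riesz_potential_def
  proof (rule nn_integral_mono)
    fix y
    have ind: "indicator (ball 0 r) (x - y) = (indicator (ball x r) y :: ennreal)" for r
      by (simp add: indicator_def dist_norm norm_minus_commute)
    have "ennreal (norm (x - y) powr (a - DIM('a))) \<le> ennreal (2 powr s) *
     ((\<Sum>j. ennreal (2 powr (- s * real_of_int (k0 - int j))) * indicator (ball x (2 powr real_of_int (k0 - int j))) y) +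
      (\<Sum>j. ennreal (2 powr (- s * real_of_int (k0 + 1 + int j))) * indicator (ball x (2 powr real_of_int (k0 + 1 + int j))) y))"
      using powr_le_dyadic_sum[of s "x - y" k0] a by (simp add: s_def ind)
    then have "f y * ennreal (norm (x - y) powr (a - DIM('a))) \<le> f y * (ennreal (2 powr s) *
     ((\<Sum>j. ennreal (2 powr (- s * real_of_int (k0 - int j))) * indicator (ball x (2 powr real_of_int (k0 - int j))) y) +
      (\<Sum>j. ennreal (2 powr (- s * real_of_int (k0 + 1 + int j))) * indicator (ball x (2 powr real_of_int (k0 + 1 + int j))) y)))"
      by (rule mult_left_mono) simp
    also have "\<dots> = ennreal (2 powr s) * ((\<Sum>j. t (k0 - int j) y) + (\<Sum>j. t (k0 + 1 + int j) y))"
      by (simp add: t_def distrib_left mult.left_commute[of "f y"] flip: ennreal_suminf_cmult)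
    finally show "f y * ennreal (norm (x - y) powr (a - DIM('a))) \<le> \<dots>" .
  qed
  also have "\<dots> = ennreal (2 powr s) * ((\<Sum>j. \<integral>\<^sup>+ y. t (k0 - int j) y \<partial>lborel) + (\<Sum>j. \<integral>\<^sup>+ y. t (k0 + 1 + int j) y \<partial>lborel))"
    by (simp add: nn_integral_cmult nn_integral_add nn_integral_suminf)
  finally show ?thesis
    unfolding I s_def .
qed

lemma suminf_geometric_powr:
  assumes "0 \<le> c" "e < 0"
  shows "(\<Sum>j. ennreal (c * 2 powr (e * real j))) = ennreal (c / (1 - 2 powr e))"
proof -
  have r: "\<bar>2 powr e\<bar> < (1::real)"
    using assms powr_less_cancel_iff[of 2 e 0] by simp
  have "(\<lambda>j. c * (2 powr e) ^ j) sums (c * (1 / (1 - 2 powr e)))"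
    using r by (intro sums_mult geometric_sums) auto
  then have "(\<lambda>j. c * 2 powr (e * real j)) sums (c / (1 - 2 powr e))"
    by (simp add: powr_powr[symmetric] powr_realpow)
  then show ?thesis
    using assms by (intro suminf_ennreal_eq) auto
qed

text \<open>
  Hedberg's inequality with two abstract bounds for the means over dyadic balls: a uniform one, \<open>D G\<close>,
  which makes the small scales summable because \<open>a > 0\<close>, and a decaying one, which makes the large
  scales summable because \<open>a < b\<close>. The two geometric sums balance at the scale \<open>2\<^sup>k\<close> for which
  \<open>2\<^bsup>-bk\<^esup>\<close> is comparable to \<open>G\<close>. With \<open>G\<close> the maximal function and \<open>b = n/p\<close> this is the classical
  inequality; keeping \<open>G\<close>, \<open>b\<close> and \<open>D\<close> free allows the exponent to depend on the point \<open>x\<close>.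
\<close>

theorem hedberg_estimate:
  fixes x :: "'a::euclidean_space" and a b D :: real
  assumes [measurable]: "f \<in> borel_measurable borel" and a: "0 < a" "a \<le> DIM('a)" and b: "a < b" and D: "0 \<le> D"
    and G: "\<And>k::int. ball_mean (2 powr real_of_int k) f x \<le> ennreal D * G"
    and decay: "\<And>k::int. ball_mean (2 powr real_of_int k) f x \<le> ennreal (D * 2 powr (- b * real_of_int k))"
  shows "riesz_potential a f x \<le>
    ennreal (2 powr (DIM('a) - a) * unit_ball_vol (DIM('a)) * (1 / (1 - 2 powr - a) + 1 / (1 - 2 powr (a - b))) * D)
      * epow G (1 - a / b)"
proof -
  define v where "v = unit_ball_vol (real (DIM('a)))"
  have v: "0 < v" by (simp add: v_def)
  define I where "I = (\<lambda>k::int. ennreal (2 powr ((a - DIM('a)) * real_of_int k)) *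
      (\<integral>\<^sup>+ y. f y * indicator (ball x (2 powr real_of_int k)) y \<partial>lborel))"
  have I: "I k = ennreal (v * 2 powr (a * real_of_int k)) * ball_mean (2 powr real_of_int k) f x" for k
  proof -
    have "I k = ennreal (2 powr ((a - DIM('a)) * real_of_int k)) * ennreal (v * (2 powr real_of_int k) ^ DIM('a)) * ball_mean (2 powr real_of_int k) f x"
      unfolding I_def by (subst ball_mean_eq_integral) (auto simp: emeasure_ball v_def mult.assoc)
    also have "ennreal (2 powr ((a - DIM('a)) * real_of_int k)) * ennreal (v * (2 powr real_of_int k) ^ DIM('a)) =
       ennreal (v * 2 powr (a * real_of_int k))"
      using v by (simp add: powr_power algebra_simps flip: ennreal_mult powr_add)
    finally show ?thesis .
  qed
  have a_lt: "2 powr - a < (1::real)" "2 powr (a - b) < (1::real)"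
    using a b powr_less_cancel_iff[of 2 "- a" 0] powr_less_cancel_iff[of 2 "a - b" 0] by auto
  have pow: "0 < 1 - a / b" "1 / b * (b - a) = 1 - a / b" using a b by (auto simp: field_simps)
  consider "G = top" "D = 0" | "G = top" "D > 0" | "G = 0" | L where "0 < L" "G = ennreal L"
    using D by (cases G) (auto simp: less_le)
  then show ?thesis
  proof cases
    case 1
    have "ball_mean (2 powr real_of_int k) f x = 0" for k :: int
      using decay[of k] 1 by simp
    then have I0: "I k = 0" for k by (simp add: I)
    have "riesz_potential a f x \<le> ennreal (2 powr (DIM('a) - a)) * ((\<Sum>j. I (0 - int j)) + (\<Sum>j. I (0 + 1 + int j)))"
      unfolding I_def using a by (intro riesz_potential_le_dyadic_sum) auto
    then show ?thesis
      by (simp add: I0)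
  next
    case 2
    have "0 < 2 powr (DIM('a) - a) * v * (1 / (1 - 2 powr - a) + 1 / (1 - 2 powr (a - b))) * D"
      using 2 v a_lt by (intro mult_pos_pos add_pos_pos) auto
    then have "ennreal (2 powr (DIM('a) - a) * v * (1 / (1 - 2 powr - a) + 1 / (1 - 2 powr (a - b))) * D) \<noteq> 0"
      by (metis ennreal_eq_0_iff not_le)
    then show ?thesis
      using 2 unfolding v_def[symmetric] by (simp add: ennreal_mult_top)
  next
    case 3
    have "ball_mean (2 powr real_of_int k) f x = 0" for k :: int
      using G[of k] 3 by simp
    then have I0: "I k = 0" for k by (simp add: I)
    have "riesz_potential a f x \<le> ennreal (2 powr (DIM('a) - a)) * ((\<Sum>j. I (0 - int j)) + (\<Sum>j. I (0 + 1 + int j)))"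
      unfolding I_def using a by (intro riesz_potential_le_dyadic_sum) auto
    then show ?thesis
      by (simp add: I0)
  next
    case (4 L)
    \<comment> \<open>The critical scale: \<open>2\<^bsup>-b(k0+1)\<^esup> \<le> L < 2\<^bsup>-b k0\<^esup>\<close>.\<close>
    define k0 :: int where "k0 = \<lceil>- log 2 L / b\<rceil> - 1"
    have "real_of_int k0 < - log 2 L / b" "- log 2 L / b \<le> real_of_int k0 + 1"
      unfolding k0_def by linarith+
    then have k0: "real_of_int k0 * b < - log 2 L" "- log 2 L \<le> (real_of_int k0 + 1) * b"
      using a b by (auto simp: field_simps)
    have near: "L * 2 powr (a * real_of_int k0) \<le> L powr (1 - a / b)"
    proof -
      have "2 powr (a * real_of_int k0) \<le> 2 powr (log 2 L * (- a / b))"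
        using mult_left_mono[OF less_imp_le[OF k0(1)], of "a / b"] a b by (intro powr_mono) (auto simp: field_simps)
      also have "\<dots> = L powr (- a / b)"
        using 4 by (subst powr_powr[symmetric]) auto
      finally have "L * 2 powr (a * real_of_int k0) \<le> L * L powr (- a / b)"
        using 4 by simp
      also have "\<dots> = L powr (1 - a / b)"
        using 4 by (simp add: powr_diff powr_minus field_simps)
      finally show ?thesis .
    qed
    have far: "2 powr ((a - b) * (real_of_int k0 + 1)) \<le> L powr (1 - a / b)"
    proof -
      have "(a - b) * (real_of_int k0 + 1) \<le> log 2 L * (1 - a / b)"
      proof -
        have "(1 - a / b) * (- log 2 L) \<le> (1 - a / b) * ((real_of_int k0 + 1) * b)"
          using k0(2) pow(1) by (intro mult_left_mono) auto
        also have "\<dots> = (b - a) * (real_of_int k0 + 1)"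
          using a b by (simp add: field_simps)
        finally show ?thesis by (simp add: algebra_simps)
      qed
      then have "2 powr ((a - b) * (real_of_int k0 + 1)) \<le> 2 powr (log 2 L * (1 - a / b))"
        by (intro powr_mono) auto
      also have "\<dots> = L powr (1 - a / b)"
        using 4 by (subst powr_powr[symmetric]) auto
      finally show ?thesis .
    qed
    have "(\<Sum>j. I (k0 - int j)) \<le> (\<Sum>j. ennreal ((v * D * (L * 2 powr (a * real_of_int k0))) * 2 powr (- a * real j)))"
    proof (intro suminf_le)
      fix j
      have "I (k0 - int j) \<le> ennreal (v * 2 powr (a * real_of_int (k0 - int j))) * (ennreal D * ennreal L)"
        unfolding I using G[of "k0 - int j"] 4 by (intro mult_left_mono) auto
      also have "\<dots> = ennreal ((v * D * (L * 2 powr (a * real_of_int k0))) * 2 powr (- a * real j))"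
        using v D 4 by (simp add: algebra_simps powr_diff powr_minus divide_simps flip: ennreal_mult)
      finally show "I (k0 - int j) \<le> \<dots>" .
    qed auto
    also have "\<dots> = ennreal (v * D * (L * 2 powr (a * real_of_int k0)) / (1 - 2 powr (- a)))"
      using v D 4 a by (intro suminf_geometric_powr) auto
    also have "\<dots> \<le> ennreal (v * D * L powr (1 - a / b) * (1 / (1 - 2 powr - a)))"
      using v D near a_lt by (intro ennreal_leI) (auto intro!: divide_right_mono mult_left_mono)
    finally have A: "(\<Sum>j. I (k0 - int j)) \<le> \<dots>" .
    have "(\<Sum>j. I (k0 + 1 + int j)) \<le> (\<Sum>j. ennreal ((v * D * 2 powr ((a - b) * (real_of_int k0 + 1))) * 2 powr ((a - b) * real j)))"
    proof (intro suminf_le)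
      fix j
      have "I (k0 + 1 + int j) \<le> ennreal (v * 2 powr (a * real_of_int (k0 + 1 + int j))) * ennreal (D * 2 powr (- b * real_of_int (k0 + 1 + int j)))"
        unfolding I using decay[of "k0 + 1 + int j"] by (intro mult_left_mono) auto
      also have "\<dots> = ennreal (v * D * (2 powr (a * real_of_int (k0 + 1 + int j)) * 2 powr (- b * real_of_int (k0 + 1 + int j))))"
        using v D by (simp add: mult_ac flip: ennreal_mult)
      also have "2 powr (a * real_of_int (k0 + 1 + int j)) * 2 powr (- b * real_of_int (k0 + 1 + int j)) =
         2 powr ((a - b) * (real_of_int k0 + 1)) * 2 powr ((a - b) * real j)"
        by (simp add: algebra_simps flip: powr_add)
      finally show "I (k0 + 1 + int j) \<le> ennreal ((v * D * 2 powr ((a - b) * (real_of_int k0 + 1))) * 2 powr ((a - b) * real j))"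
        by (simp add: mult.assoc)
    qed auto
    also have "\<dots> = ennreal (v * D * 2 powr ((a - b) * (real_of_int k0 + 1)) / (1 - 2 powr (a - b)))"
      using v D b by (intro suminf_geometric_powr) auto
    also have "\<dots> \<le> ennreal (v * D * L powr (1 - a / b) * (1 / (1 - 2 powr (a - b))))"
      using v D far a_lt by (intro ennreal_leI) (auto intro!: divide_right_mono mult_left_mono)
    finally have B: "(\<Sum>j. I (k0 + 1 + int j)) \<le> \<dots>" .
    have "riesz_potential a f x \<le> ennreal (2 powr (DIM('a) - a)) * ((\<Sum>j. I (k0 - int j)) + (\<Sum>j. I (k0 + 1 + int j)))"
      unfolding I_def using a by (intro riesz_potential_le_dyadic_sum) auto
    also have "\<dots> \<le> ennreal (2 powr (DIM('a) - a)) * (ennreal (v * D * L powr (1 - a / b) * (1 / (1 - 2 powr - a))) +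
         ennreal (v * D * L powr (1 - a / b) * (1 / (1 - 2 powr (a - b)))))"
      by (intro mult_left_mono add_mono A B) auto
    also have "\<dots> = ennreal (2 powr (DIM('a) - a) * v * (1 / (1 - 2 powr - a) + 1 / (1 - 2 powr (a - b))) * D * L powr (1 - a / b))"
      using v D a_lt by (simp add: algebra_simps flip: ennreal_mult ennreal_plus)
    also have "\<dots> = ennreal (2 powr (DIM('a) - a) * v * (1 / (1 - 2 powr - a) + 1 / (1 - 2 powr (a - b))) * D) * epow G (1 - a / b)"
      using v D a_lt 4 by (simp add: ennreal_mult'')
    finally show ?thesis
      unfolding v_def .
  qed
qed

text \<open>
  The dyadic shells of radius \<open>2\<^sup>j\<close> contribute a multiple of \<open>2\<^bsup>(n-s)j\<^esup>\<close>.
\<close>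

lemma tail_integral_finite:
  assumes s: "real (DIM('a)) < s"
  shows "(\<integral>\<^sup>+ z. ennreal (norm z powr (- s)) * indicator {z. 1/2 \<le> norm z} z \<partial>(lborel :: 'a::euclidean_space measure)) < top"
proof -
  let ?v = "unit_ball_vol (real (DIM('a)))"
  define t where "t j z = ennreal (2 powr s * 2 powr (- s * real j)) * indicator (ball 0 (2 powr real j)) z" for j and z :: 'a
  have [measurable]: "t j \<in> borel_measurable lborel" for j
    unfolding t_def by measurable
  have "(\<integral>\<^sup>+ z. ennreal (norm z powr (- s)) * indicator {z. 1/2 \<le> norm z} z \<partial>(lborel :: 'a measure)) \<le>
     (\<integral>\<^sup>+ z. (\<Sum>j. t j z) \<partial>lborel)"
  proof (rule nn_integral_mono)
    fix z :: 'a
    show "ennreal (norm z powr (- s)) * indicator {z. 1/2 \<le> norm z} z \<le> (\<Sum>j. t j z)"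
    proof (cases "1/2 \<le> norm z")
      case True
      then have "0 < norm z" by linarith
      then obtain k :: int where k: "2 powr (real_of_int k - 1) \<le> norm z" "norm z < 2 powr real_of_int k"
        by (rule dyadic_scale)
      have "2 powr (- 1) < 2 powr real_of_int k"
        using True k(2) by (simp add: powr_minus)
      then have "- 1 < real_of_int k" by (subst (asm) powr_less_cancel_iff) auto
      then have "0 \<le> k" by linarith
      then obtain j where j: "k = int j" using nonneg_int_cases by blast
      have "z \<noteq> 0" using True by auto
      then have "ennreal (norm z powr (- s)) \<le> t j z"
        using True s k powr_le_dyadic[of s "norm z" k] by (auto simp: t_def j intro!: ennreal_leI)
      also have "\<dots> \<le> (\<Sum>j. t j z)"
        using sum_le_suminf[of "\<lambda>j. t j z" "{j}"] by auto
      finally show ?thesis using True by simp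
    qed simp
  qed
  also have "\<dots> = (\<Sum>j. \<integral>\<^sup>+ z. t j z \<partial>lborel)"
    by (rule nn_integral_suminf) measurable
  also have "\<dots> = (\<Sum>j. ennreal (2 powr s * ?v * 2 powr ((DIM('a) - s) * real j)))"
  proof (rule suminf_cong)
    fix j
    have "(\<integral>\<^sup>+ z. t j z \<partial>lborel) = ennreal (2 powr s * 2 powr (- s * real j)) * ennreal (?v * (2 powr real j) ^ DIM('a))"
      unfolding t_def by (subst nn_integral_cmult_indicator) (auto simp: emeasure_ball)
    also have "\<dots> = ennreal (2 powr s * ?v * 2 powr ((DIM('a) - s) * real j))"
    proof -
      have "2 powr (- s * real j) * (2 powr real j) ^ DIM('a) = 2 powr ((DIM('a) - s) * real j)"
        by (simp add: powr_power algebra_simps flip: powr_add)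
      then show ?thesis by (simp add: mult_ac flip: ennreal_mult)
    qed
    finally show "(\<integral>\<^sup>+ z. t j z \<partial>lborel) = \<dots>" .
  qed
  also have "\<dots> = ennreal (2 powr s * ?v / (1 - 2 powr (DIM('a) - s)))"
    using s by (intro suminf_geometric_powr) auto
  finally show ?thesis
    using ennreal_less_top order_le_less_trans by blast
qed

text \<open>
  The power \<open>n + 1\<close> is a convenient integrable choice; this weight is the error term in every change
  of exponent below.
\<close>

lemma weight_integral_finite:
  "(\<integral>\<^sup>+ x. ennreal ((exp 1 + norm x) powr (- (real (DIM('a)) + 1))) \<partial>(lborel :: 'a::euclidean_space measure)) < top"
proof -
  let ?s = "real (DIM('a)) + 1"
  have "(\<integral>\<^sup>+ x. ennreal ((exp 1 + norm x) powr (- ?s)) \<partial>(lborel :: 'a measure)) \<le>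
     (\<integral>\<^sup>+ x. indicator (ball 0 1) x + ennreal (norm x powr (- ?s)) * indicator {z. 1/2 \<le> norm z} x \<partial>(lborel :: 'a measure))"
  proof (rule nn_integral_mono)
    fix x :: 'a
    have e: "1 \<le> exp 1 + norm x" using exp_ge_add_one_self[of 1] norm_ge_zero[of x] by linarith
    show "ennreal ((exp 1 + norm x) powr (- ?s)) \<le> indicator (ball 0 1) x + ennreal (norm x powr (- ?s)) * indicator {z. 1/2 \<le> norm z} x"
    proof (cases "norm x < 1")
      case True
      have "(exp 1 + norm x) powr (- ?s) \<le> 1 powr (- ?s)"
        using e by (intro powr_mono2') auto
      then show ?thesis using True by (simp add: add_increasing2)
    next
      case False
      then have "(exp 1 + norm x) powr (- ?s) \<le> norm x powr (- ?s)"
        by (intro powr_mono2') auto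
      then show ?thesis using False by (simp add: add_increasing ennreal_leI)
    qed
  qed
  also have "\<dots> = emeasure lborel (ball 0 1 :: 'a set) + (\<integral>\<^sup>+ x. ennreal (norm x powr (- ?s)) * indicator {z. 1/2 \<le> norm z} x \<partial>(lborel :: 'a measure))"
    by (subst nn_integral_add) auto
  also have "\<dots> < top"
    using tail_integral_finite[of ?s, where 'a='a] emeasure_ball_pos(2)[of 1 "0::'a"] by (simp add: less_top)
  finally show ?thesis .
qed

section \<open>Riesz potentials on spaces with log-Hoelder exponents\<close>

lemma ball_mean_mono:
  assumes "\<And>y. y \<in> ball x r \<Longrightarrow> f y \<le> g y"
  shows "ball_mean r f x \<le> ball_mean r g x"
  unfolding ball_mean_def using assms
  by (intro divide_right_mono_ennreal nn_integral_mono) (auto simp: indicator_def)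

lemma ball_mean_le_integral:
  fixes x :: "'a::euclidean_space" and k :: int
  assumes "(\<integral>\<^sup>+ y. f y \<partial>lborel) \<le> ennreal K"
  shows "ball_mean (2 powr real_of_int k) f x \<le>
    ennreal (K / unit_ball_vol (DIM('a)) * 2 powr (- (real (DIM('a)) * real_of_int k)))"
proof -
  let ?v = "unit_ball_vol (real (DIM('a)))"
  have "(\<integral>\<^sup>+ y. f y * indicator (ball x (2 powr real_of_int k)) y \<partial>lborel) \<le> (\<integral>\<^sup>+ y. f y \<partial>lborel)"
    by (intro nn_integral_mono) (auto simp: indicator_def)
  then have "ball_mean (2 powr real_of_int k) f x \<le> ennreal K / ennreal (?v * (2 powr real_of_int k) ^ DIM('a))"
    unfolding ball_mean_def using assms
    by (auto simp: emeasure_ball intro: divide_right_mono_ennreal)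
  also have "\<dots> = ennreal (K / ?v * 2 powr (- (real (DIM('a)) * real_of_int k)))"
    by (cases "0 \<le> K")
       (auto simp: divide_ennreal powr_power powr_minus field_simps ennreal_neg divide_nonpos_nonneg)
  finally show ?thesis .
qed

lemma le_epow_root:
  assumes "0 < P" "epow u P \<le> w"
  shows "u \<le> epow w (1 / P)"
proof -
  have "epow (epow u P) (1 / P) \<le> epow w (1 / P)"
    using assms by (intro epow_mono) auto
  then show ?thesis
    using assms by (simp add: epow_epow)
qed

text \<open>
  Jensen's inequality turns a bound on the \<open>P\<close>-th power into decay of the means; it supplies the second
  hypothesis of \<open>hedberg_estimate\<close> with \<open>b = n/P\<close>.
\<close>

lemma ball_mean_decay:
  fixes x :: "'a::euclidean_space" and k :: int and g :: "'a \<Rightarrow> real"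
  assumes [measurable]: "g \<in> borel_measurable borel" and g0: "\<And>y. 0 \<le> g y" and P: "1 \<le> P" and K: "0 \<le> K"
    and le: "(\<integral>\<^sup>+ y. ennreal (g y powr P) \<partial>lborel) \<le> ennreal K"
  shows "ball_mean (2 powr real_of_int k) (\<lambda>y. ennreal (g y)) x \<le>
    ennreal ((K / unit_ball_vol (DIM('a))) powr (1 / P) * 2 powr (- (real (DIM('a)) / P) * real_of_int k))"
proof -
  let ?v = "unit_ball_vol (real (DIM('a)))"
  have "epow (ball_mean (2 powr real_of_int k) (\<lambda>y. ennreal (g y)) x) P \<le>
      ball_mean (2 powr real_of_int k) (\<lambda>y. ennreal (g y powr P)) x"
    using g0 P by (intro ball_mean_jensen) auto
  also have "\<dots> \<le> ennreal (K / ?v * 2 powr (- (real (DIM('a)) * real_of_int k)))"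
    by (rule ball_mean_le_integral[OF le])
  finally have "ball_mean (2 powr real_of_int k) (\<lambda>y. ennreal (g y)) x \<le>
      epow (ennreal (K / ?v * 2 powr (- (real (DIM('a)) * real_of_int k)))) (1 / P)"
    using P by (intro le_epow_root) auto
  also have "\<dots> = ennreal ((K / ?v) powr (1 / P) * 2 powr (- (real (DIM('a)) / P) * real_of_int k))"
    using K by (subst epow_ennreal, simp, subst powr_mult) (auto simp: powr_powr)
  finally show ?thesis .
qed

text \<open>
  Exponents that differ by \<open>O(1 / ln(e + |x|))\<close> are interchangeable for functions with values in
  \<open>[0, 1]\<close>. Where \<open>G\<close> exceeds the weight \<open>(e + |x|)\<^bsup>-(n+1)\<^esup>\<close>, the factor \<open>G\<^bsup>v-u\<^esup>\<close> is bounded, the two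
  logarithms cancelling; elsewhere \<open>G\<^sup>v \<le> G\<close> is below the weight, which is integrable.
\<close>

lemma change_exponent_at_infinity:
  fixes G :: "'a::euclidean_space \<Rightarrow> ennreal" and u v :: "'a \<Rightarrow> real"
  assumes [measurable]: "G \<in> borel_measurable borel" "u \<in> borel_measurable borel" "v \<in> borel_measurable borel"
    and G: "\<And>x. G x \<le> 1" and v: "\<And>x. 1 \<le> v x"
    and uv: "\<And>x. \<bar>u x - v x\<bar> \<le> c / ln (exp 1 + norm x)"
  shows "(\<integral>\<^sup>+ x. epow (G x) (v x) \<partial>lborel) \<le> ennreal (exp ((real (DIM('a)) + 1) * c)) * (\<integral>\<^sup>+ x. epow (G x) (u x) \<partial>lborel)
     + (\<integral>\<^sup>+ x. ennreal ((exp 1 + norm x) powr (- (real (DIM('a)) + 1))) \<partial>(lborel :: 'a measure))"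
proof -
  let ?N = "real (DIM('a)) + 1"
  have "(\<integral>\<^sup>+ x. epow (G x) (v x) \<partial>lborel) \<le>
     (\<integral>\<^sup>+ x. ennreal (exp (?N * c)) * epow (G x) (u x) + ennreal ((exp 1 + norm x) powr (- ?N)) \<partial>lborel)"
  proof (rule nn_integral_mono)
    fix x
    obtain g where g: "G x = ennreal g" "0 \<le> g" "g \<le> 1"
      using G[of x] by (cases "G x") (auto simp: top_unique)
    define e where "e = exp 1 + norm x"
    have e1: "exp 1 \<le> e" by (simp add: e_def)
    then have e: "1 < e" "1 \<le> ln e"
      using exp_ge_add_one_self[of 1] ln_le_cancel_iff[of "exp 1" e] by (auto simp del: ln_le_cancel_iff)
    show "epow (G x) (v x) \<le> ennreal (exp (?N * c)) * epow (G x) (u x) + ennreal ((exp 1 + norm x) powr (- ?N))"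
    proof (cases "e powr (- ?N) \<le> g")
      case True
      have g1: "0 < g" using True e by (smt (verit) powr_gt_zero)
      have "g powr v x = g powr (v x - u x) * g powr u x"
        by (simp flip: powr_add)
      also have "g powr (v x - u x) \<le> exp (?N * c)"
      proof -
        have "- ln g \<le> ?N * ln e"
        proof -
          have "ln (e powr (- ?N)) \<le> ln g" using True e by (subst ln_le_cancel_iff) (auto simp: g1)
          then show ?thesis using e by (simp add: ln_powr algebra_simps)
        qed
        moreover have "\<bar>v x - u x\<bar> * ln e \<le> c"
          using uv[of x] e by (simp add: e_def field_simps abs_minus_commute)
        moreover have "(v x - u x) * ln g \<le> \<bar>v x - u x\<bar> * (- ln g)"
          using g1 g(3) by (smt (verit) ln_le_zero_iff mult_minus_right mult_right_mono_neg mult_minus_left)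
        ultimately have "(v x - u x) * ln g \<le> \<bar>v x - u x\<bar> * (?N * ln e)"
          by (meson abs_ge_zero mult_left_mono order_trans)
        also have "\<dots> = ?N * (\<bar>v x - u x\<bar> * ln e)" by simp
        also have "\<dots> \<le> ?N * c"
          using \<open>\<bar>v x - u x\<bar> * ln e \<le> c\<close> by (intro mult_left_mono) auto
        finally show ?thesis
          using g1 by (simp add: powr_def)
      qed
      finally have "g powr v x \<le> exp (?N * c) * g powr u x"
        by (simp add: mult_right_mono)
      then show ?thesis
        using g by (intro order_trans[OF _ add_increasing2]) (auto simp: ennreal_leI simp flip: ennreal_mult)
    next
      case False
      have "g powr v x \<le> g powr 1"
        using g v[of x] by (intro powr_mono') auto
      then have "g powr v x \<le> e powr (- ?N)"
        using False g by simp
      then show ?thesis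
        using g by (intro order_trans[OF _ add_increasing]) (auto simp: ennreal_leI e_def)
    qed
  qed
  also have "\<dots> = ennreal (exp (?N * c)) * (\<integral>\<^sup>+ x. epow (G x) (u x) \<partial>lborel)
     + (\<integral>\<^sup>+ x. ennreal ((exp 1 + norm x) powr (- ?N)) \<partial>(lborel :: 'a measure))"
    by (simp add: nn_integral_add nn_integral_cmult)
  finally show ?thesis .
qed

text \<open>
  Here \<open>t > 1\<close> is a lower and \<open>P\<close> an upper bound for the exponent \<open>p\<close>, and \<open>pinf\<close> is its limit at
  infinity. The parameters \<open>n\<close>, \<open>v\<close> and \<open>W\<close> only abbreviate the dimension, the volume of the unit
  ball and the integral of the weight; as definitions inside the locale these numbers would carry the
  type of the space as an extra argument.
\<close>

locale riesz_exponent =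
  fixes p :: "'a::euclidean_space \<Rightarrow> real" and t P a c1 c2 pinf n v W :: real
  assumes t: "1 < t" and p_ge: "\<And>x. t \<le> p x" and p_le: "\<And>x. p x \<le> P"
    and pinf_ge: "t \<le> pinf" and pinf_le: "pinf \<le> P"
    and a_pos: "0 < a" and aP: "a * P < n"
    and n_eq [simp]: "real (DIM('a)) = n" and v_eq [simp]: "unit_ball_vol n = v"
    and W_eq: "(\<integral>\<^sup>+ x. ennreal ((exp 1 + norm x) powr (- (real (DIM('a)) + 1))) \<partial>(lborel :: 'a measure)) = ennreal W"
    and W_nonneg: "0 \<le> W"
    and p_measurable [measurable]: "p \<in> borel_measurable borel"
    and c1: "0 \<le> c1" and c2: "0 \<le> c2"
    and log_local: "\<And>x y. x \<noteq> y \<Longrightarrow> norm (x - y) \<le> 1 / 2 \<Longrightarrow> \<bar>p x - p y\<bar> \<le> c1 / (- ln (norm (x - y)))"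
    and log_decay: "\<And>x. \<bar>p x - pinf\<bar> \<le> c2 / ln (exp 1 + norm x)"
begin

text \<open>
  The Sobolev exponent: \<open>1 / sobolev s = 1/s - a/n\<close>.
\<close>

definition sobolev :: "real \<Rightarrow> real" where
  "sobolev s = 1 / (1 / s - a / n)"

definition Q :: real where "Q = sobolev P"

lemma n_pos: "0 < n"
  by (metis DIM_positive n_eq of_nat_0_less_iff)

lemma v_pos: "0 < v"
  using unit_ball_vol_pos[of n] n_pos v_eq by simp

lemma a_lt_n: "a < n"
proof -
  have "1 \<le> P" using t p_ge p_le by (meson less_imp_le order_trans)
  then have "a * 1 \<le> a * P" using a_pos by (intro mult_left_mono) auto
  then show ?thesis using aP by simp
qed

lemma sobolev_facts:
  assumes "t \<le> s" "s \<le> P"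
  shows "0 < 1 / P - a / n" "1 / P - a / n \<le> 1 / s - a / n" "sobolev s \<le> Q" "s \<le> sobolev s" "1 \<le> sobolev s"
    "a < n / s" "0 < 1 - a / (n / s)" "(1 - a / (n / s)) * sobolev s = s"
proof -
  have s: "1 < s" "0 < P" using assms t by auto
  show 1: "0 < 1 / P - a / n" using s aP n_pos by (simp add: field_simps)
  show 2: "1 / P - a / n \<le> 1 / s - a / n" using s assms by (simp add: frac_le)
  show "sobolev s \<le> Q"
    unfolding Q_def sobolev_def using 1 2 by (intro frac_le) auto
  have "1 / s - a / n \<le> 1 / s" using a_pos n_pos by simp
  then have "1 / (1 / s) \<le> sobolev s"
    unfolding sobolev_def using 1 2 by (intro frac_le) auto
  then show 3: "s \<le> sobolev s" by simp
  then show "1 \<le> sobolev s" using s by simp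
  have 4: "0 < 1 / s - a / n" using 1 2 by linarith
  have 5: "1 - a / (n / s) = s * (1 / s - a / n)" using s n_pos by (simp add: field_simps)
  show "0 < 1 - a / (n / s)" unfolding 5 using 4 s by simp
  then show "a < n / s" using s n_pos by (simp add: field_simps)
  show "(1 - a / (n / s)) * sobolev s = s"
    unfolding 5 sobolev_def using 4 by simp
qed

lemma measurable_sobolev [measurable]: "(\<lambda>x. sobolev (p x)) \<in> borel_measurable borel"
  unfolding sobolev_def by measurable

text \<open>
  The Sobolev exponent inherits the decay condition, because reciprocals of exponents between 1 and
  \<open>Q\<close> are comparable with the exponents.
\<close>

lemma sobolev_decay: "\<bar>sobolev pinf - sobolev (p x)\<bar> \<le> Q\<^sup>2 * c2 / ln (exp 1 + norm x)"
proof -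
  note fp = sobolev_facts[OF p_ge[of x] p_le[of x]]
  note fi = sobolev_facts[OF pinf_ge pinf_le]
  have pos: "0 < p x" "0 < pinf" "1 \<le> p x * pinf"
    using t p_ge[of x] pinf_ge mult_mono[of 1 "p x" 1 pinf] by auto
  have ne: "1 / p x - a / n \<noteq> 0" "1 / pinf - a / n \<noteq> 0"
    using fp(1,2) fi(2) by auto
  have "sobolev pinf - sobolev (p x) = sobolev pinf * sobolev (p x) * ((1 / p x - a / n) - (1 / pinf - a / n))"
  proof -
    have "1 / A - 1 / B = 1 / A * (1 / B) * (B - A)" if "A \<noteq> 0" "B \<noteq> 0" for A B :: real
      using that by (simp add: field_simps)
    from this[OF ne(2,1)] show ?thesis unfolding sobolev_def .
  qed
  also have "\<dots> = sobolev pinf * sobolev (p x) * ((pinf - p x) / (p x * pinf))"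
    using pos by (simp add: field_simps)
  finally have "\<bar>sobolev pinf - sobolev (p x)\<bar> = sobolev pinf * sobolev (p x) * (\<bar>p x - pinf\<bar> / (p x * pinf))"
    using fp(5) fi(5) pos by (simp add: abs_mult abs_minus_commute)
  also have "\<dots> \<le> (Q * Q) * (\<bar>p x - pinf\<bar> / 1)"
    using fp(3,5) fi(3,5) pos by (intro mult_mono divide_left_mono) auto
  also have "\<dots> \<le> Q * Q * (c2 / ln (exp 1 + norm x))"
    using log_decay[of x] by (intro mult_left_mono) auto
  finally show ?thesis by (simp add: power2_eq_square)
qed

lemmas W = W_eq W_nonneg

lemma to_sobolev_exponent:
  assumes [measurable]: "G \<in> borel_measurable borel" and "\<And>x. G x \<le> 1" and K: "0 \<le> K"
    and "(\<integral>\<^sup>+ x. epow (G x) (sobolev pinf) \<partial>lborel) \<le> ennreal K"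
  shows "(\<integral>\<^sup>+ x. epow (G x) (sobolev (p x)) \<partial>lborel) \<le> ennreal (exp ((n + 1) * (Q\<^sup>2 * c2)) * K + W)"
proof -
  have "(\<integral>\<^sup>+ x. epow (G x) (sobolev (p x)) \<partial>lborel) \<le> ennreal (exp ((n + 1) * (Q\<^sup>2 * c2))) * (\<integral>\<^sup>+ x. epow (G x) (sobolev pinf) \<partial>lborel) + ennreal W"
    unfolding W(1)[symmetric] n_eq[symmetric]
    using assms(1,2) sobolev_facts(5)[OF p_ge p_le] sobolev_decay by (intro change_exponent_at_infinity) auto
  also have "\<dots> \<le> ennreal (exp ((n + 1) * (Q\<^sup>2 * c2))) * ennreal K + ennreal W"
    using assms(4) by (intro add_right_mono mult_left_mono) (auto simp: algebra_simps)
  also have "\<dots> = ennreal (exp ((n + 1) * (Q\<^sup>2 * c2)) * K + W)"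
    using K W(2) by (simp add: ennreal_mult)
  finally show ?thesis .
qed

lemma epow_scaled_le:
  assumes "X \<le> ennreal E * Y" "1 \<le> E" "1 \<le> s" "s \<le> Q"
  shows "epow X s \<le> ennreal (E powr Q) * epow Y s"
proof -
  have "epow X s \<le> epow (ennreal E * Y) s"
    using assms by (intro epow_mono) auto
  also have "\<dots> = ennreal (E powr s) * epow Y s"
    using assms by (subst epow_cmult) auto
  also have "\<dots> \<le> ennreal (E powr Q) * epow Y s"
    using assms by (intro mult_right_mono ennreal_leI powr_mono) auto
  finally show ?thesis .
qed

text \<open>
  The constant of \<open>hedberg_estimate\<close> for the least admissible decay \<open>b = n/P\<close>, which serves all
  exponents between \<open>t\<close> and \<open>P\<close>, hence all points \<open>x\<close>. The maximum with 1 lets it be raised to the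
  varying power \<open>sobolev (p x)\<close>.
\<close>

definition hedberg_const :: real where
  "hedberg_const = max 1 (2 powr (n - a) * v * (1 / (1 - 2 powr - a) + 1 / (1 - 2 powr (a - n / P))))"

lemma hedberg_uniform:
  fixes f :: "'a \<Rightarrow> ennreal" and D s :: real
  assumes [measurable]: "f \<in> borel_measurable borel" and s: "t \<le> s" "s \<le> P" and D: "0 \<le> D"
    and G: "\<And>k::int. ball_mean (2 powr real_of_int k) f x \<le> ennreal D * G"
    and decay: "\<And>k::int. ball_mean (2 powr real_of_int k) f x \<le> ennreal (D * 2 powr (- (n / s) * real_of_int k))"
  shows "riesz_potential a f x \<le> ennreal (hedberg_const * D) * epow G (1 - a / (n / s))"
proof -
  have "riesz_potential a f x \<le>
    ennreal (2 powr (n - a) * v * (1 / (1 - 2 powr - a) + 1 / (1 - 2 powr (a - n / s))) * D) * epow G (1 - a / (n / s))"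
    using assms(1) a_pos a_lt_n sobolev_facts[OF s] D G decay unfolding v_eq[symmetric] n_eq[symmetric]
    by (intro hedberg_estimate) (auto simp only: n_eq)
  also have "\<dots> \<le> ennreal (hedberg_const * D) * epow G (1 - a / (n / s))"
  proof (intro mult_right_mono ennreal_leI D)
    have sP: "0 < s" "0 < P" using s t by auto
    have nP: "a - n / s \<le> a - n / P" using s sP n_pos by (auto intro!: divide_left_mono)
    have "2 powr (a - n / P) < (1::real)"
      using sobolev_facts(6)[of P] s order_trans[OF s] powr_less_cancel_iff[of 2 "a - n / P" 0] by auto
    then have "1 / (1 - 2 powr (a - n / s)) \<le> 1 / (1 - 2 powr (a - n / P))"
      using nP by (intro divide_left_mono) (auto intro!: mult_pos_pos simp: powr_mono order_le_less_trans[OF powr_mono[OF nP]])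
    then have "2 powr (n - a) * v * (1 / (1 - 2 powr - a) + 1 / (1 - 2 powr (a - n / s))) \<le>
      2 powr (n - a) * v * (1 / (1 - 2 powr - a) + 1 / (1 - 2 powr (a - n / P)))"
      using v_pos by (intro mult_left_mono) auto
    then show "2 powr (n - a) * v * (1 / (1 - 2 powr - a) + 1 / (1 - 2 powr (a - n / s))) \<le> hedberg_const"
      unfolding hedberg_const_def by (rule max.coboundedI2)
  qed auto
  finally show ?thesis .
qed

text \<open>
  The exponent is moved to its limit \<open>pinf\<close>, where Hedberg's inequality and the maximal theorem have
  constant exponents. As \<open>f \<le> 1\<close>, the maximal function is also at most 1, so the resulting bound
  for the potential can be moved back to the variable Sobolev exponent.
\<close>

lemma modular_bound_small_values:
  "\<exists>C\<ge>0. \<forall>f. f \<in> borel_measurable borel \<longrightarrow> (\<forall>x. 0 \<le> f x \<and> f x \<le> (1::real)) \<longrightarrow>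
     (\<integral>\<^sup>+ x. ennreal (f x powr p x) \<partial>lborel) \<le> 1 \<longrightarrow>
     (\<integral>\<^sup>+ x. epow (riesz_potential a (\<lambda>y. ennreal (f y)) x) (sobolev (p x)) \<partial>lborel) \<le> ennreal C"
proof -
  define K1 where "K1 = exp ((n + 1) * c2) + W"
  define D where "D = max 1 ((K1 / v) powr (1 / pinf))"
  define E where "E = hedberg_const * D"
  define Cm where "Cm = 2 powr pinf * 5 ^ DIM('a) * pinf / (pinf - 1)"
  define C where "C = E powr Q * (exp ((n + 1) * (Q\<^sup>2 * c2)) * (Cm * K1) + W)"
  have K1: "0 \<le> K1" using W(2) by (simp add: K1_def)
  have D: "1 \<le> D" by (simp add: D_def)
  have E: "1 \<le> E" unfolding E_def using D mult_mono[of 1 hedberg_const 1 D] by (simp add: hedberg_const_def)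
  have pinf: "1 < pinf" using t pinf_ge by simp
  have Cm: "0 \<le> Cm" using pinf by (simp add: Cm_def)
  have C: "0 \<le> C" using K1 Cm W(2) by (simp add: C_def)
  have "(\<integral>\<^sup>+ x. epow (riesz_potential a (\<lambda>y. ennreal (f y)) x) (sobolev (p x)) \<partial>lborel) \<le> ennreal C"
    if [measurable]: "f \<in> borel_measurable borel" and f01: "\<And>x. 0 \<le> f x \<and> f x \<le> (1::real)"
     and fp: "(\<integral>\<^sup>+ x. ennreal (f x powr p x) \<partial>lborel) \<le> 1" for f
  proof -
    have "(\<integral>\<^sup>+ x. epow (ennreal (f x)) pinf \<partial>lborel) \<le> ennreal (exp ((real (DIM('a)) + 1) * c2)) * (\<integral>\<^sup>+ x. epow (ennreal (f x)) (p x) \<partial>lborel) + ennreal W"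
      unfolding W(1)[symmetric] n_eq[symmetric]
      using f01 pinf log_decay by (intro change_exponent_at_infinity) auto
    also have "\<dots> \<le> ennreal (exp ((real (DIM('a)) + 1) * c2)) * 1 + ennreal W"
      using fp f01 by (intro add_right_mono mult_left_mono) auto
    also have "\<dots> = ennreal K1"
      using W(2) by (simp add: K1_def algebra_simps)
    finally have fpinf: "(\<integral>\<^sup>+ x. ennreal (f x powr pinf) \<partial>lborel) \<le> ennreal K1"
      using f01 by simp
    define M where "M = dyadic_maximal (\<lambda>x. ennreal (f x))"
    have [measurable]: "M \<in> borel_measurable borel" unfolding M_def by measurable
    have M1: "M x \<le> 1" for x
      unfolding M_def dyadic_maximal_def using f01 by (intro SUP_least ball_mean_const_le) auto
    have IM: "(\<integral>\<^sup>+ x. epow (M x) pinf \<partial>lborel) \<le> ennreal (Cm * K1)"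
    proof -
      have "(\<integral>\<^sup>+ x. epow (M x) pinf \<partial>lborel) \<le> ennreal Cm * (\<integral>\<^sup>+ x. ennreal (f x powr pinf) \<partial>lborel)"
        unfolding M_def Cm_def using f01 pinf by (intro dyadic_maximal_strong_type) auto
      also have "\<dots> \<le> ennreal Cm * ennreal K1"
        using fpinf by (rule mult_left_mono) simp
      finally show ?thesis using Cm K1 by (simp add: ennreal_mult)
    qed
    define G where "G x = epow (M x) (1 - a / (n / pinf))" for x
    note fi = sobolev_facts[OF pinf_ge pinf_le]
    have [measurable]: "G \<in> borel_measurable borel" unfolding G_def by measurable
    have G1: "G x \<le> 1" for x
      using epow_mono[OF _ M1, of "1 - a / (n / pinf)" x] fi(7) epow_ennreal[of 1 "1 - a / (n / pinf)"]
      by (simp add: G_def less_imp_le)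
    have I: "riesz_potential a (\<lambda>y. ennreal (f y)) x \<le> ennreal E * G x" for x
      unfolding G_def E_def
    proof (rule hedberg_uniform[OF _ pinf_ge pinf_le])
      fix k :: int
      have "ball_mean (2 powr real_of_int k) (\<lambda>y. ennreal (f y)) x \<le> 1 * M x"
        unfolding M_def using ball_mean_le_dyadic_maximal by simp
      also have "\<dots> \<le> ennreal D * M x"
        using D by (intro mult_right_mono) auto
      finally show "ball_mean (2 powr real_of_int k) (\<lambda>y. ennreal (f y)) x \<le> ennreal D * M x" .
      have "ball_mean (2 powr real_of_int k) (\<lambda>y. ennreal (f y)) x \<le>
         ennreal ((K1 / v) powr (1 / pinf) * 2 powr (- (n / pinf) * real_of_int k))"
        unfolding v_eq[symmetric] n_eq[symmetric]
        using f01 pinf K1 fpinf by (intro ball_mean_decay) auto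
      also have "\<dots> \<le> ennreal (D * 2 powr (- (n / pinf) * real_of_int k))"
        by (intro ennreal_leI mult_right_mono) (auto simp: D_def)
      finally show "ball_mean (2 powr real_of_int k) (\<lambda>y. ennreal (f y)) x \<le> \<dots>" .
    qed (use D in auto)
    have "(\<integral>\<^sup>+ x. epow (riesz_potential a (\<lambda>y. ennreal (f y)) x) (sobolev (p x)) \<partial>lborel) \<le>
       (\<integral>\<^sup>+ x. ennreal (E powr Q) * epow (G x) (sobolev (p x)) \<partial>lborel)"
      using I E sobolev_facts[OF p_ge p_le] by (intro nn_integral_mono epow_scaled_le) auto
    also have "\<dots> = ennreal (E powr Q) * (\<integral>\<^sup>+ x. epow (G x) (sobolev (p x)) \<partial>lborel)"
      by (rule nn_integral_cmult) measurable
    also have "\<dots> \<le> ennreal (E powr Q) * ennreal (exp ((n + 1) * (Q\<^sup>2 * c2)) * (Cm * K1) + W)"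
    proof (intro mult_left_mono to_sobolev_exponent G1)
      show "(\<integral>\<^sup>+ x. epow (G x) (sobolev pinf) \<partial>lborel) \<le> ennreal (Cm * K1)"
        unfolding G_def epow_epow fi(8) by (rule IM)
    qed (use Cm K1 in auto)
    also have "\<dots> = ennreal C"
      unfolding C_def by (subst ennreal_mult) (use Cm K1 W(2) in auto)
    finally show ?thesis .
  qed
  then show ?thesis using C by blast
qed

end

lemma nn_integral_lborel_translate:
  fixes f :: "'a::euclidean_space \<Rightarrow> ennreal"
  assumes [measurable]: "f \<in> borel_measurable borel"
  shows "(\<integral>\<^sup>+ x. f (x - y) \<partial>lborel) = (\<integral>\<^sup>+ x. f x \<partial>lborel)"
proof -
  have "(\<integral>\<^sup>+ x. f x \<partial>lborel) = (\<integral>\<^sup>+ x. f x \<partial>distr lborel borel ((+) (- y)))"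
    by (simp only: lborel_distr_plus)
  also have "\<dots> = (\<integral>\<^sup>+ x. f (- y + x) \<partial>lborel)"
    by (rule nn_integral_distr) measurable
  finally show ?thesis by simp
qed

context riesz_exponent
begin

text \<open>
  The truncated kernel is bounded and its power \<open>sobolev pinf\<close> is integrable, since
  \<open>sobolev pinf * (n - a) > n\<close> amounts to \<open>pinf > 1\<close>. Jensen's inequality with the weight \<open>f\<close> of mass at
  most 1 and the translation invariance of Lebesgue measure give the bound for the constant exponent;
  as the normalised kernel is at most 1, the variable exponent follows.
\<close>

lemma modular_bound_far:
  "\<exists>C\<ge>0. \<forall>f. f \<in> borel_measurable borel \<longrightarrow> (\<forall>x. 0 \<le> f x) \<longrightarrow>
     (\<integral>\<^sup>+ x. ennreal (f x) \<partial>lborel) \<le> 1 \<longrightarrow>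
     (\<integral>\<^sup>+ x. epow (\<integral>\<^sup>+ y. ennreal (f y) * ennreal (norm (x - y) powr (a - n) * indicator {z. 1/2 \<le> norm z} (x - y)) \<partial>lborel)
        (sobolev (p x)) \<partial>lborel) \<le> ennreal C"
proof -
  define E where "E = 2 powr (n - a)"
  define s where "s = sobolev pinf * (n - a)"
  define \<kappa> where "\<kappa> z = (norm z powr (a - n) * indicator {z. 1/2 \<le> norm z} z) / E" for z :: 'a
  have [measurable]: "\<kappa> \<in> borel_measurable borel" unfolding \<kappa>_def by measurable
  note fi = sobolev_facts[OF pinf_ge pinf_le]
  have E: "1 \<le> E" using a_lt_n by (simp add: E_def ge_one_powr_ge_zero)
  have \<kappa>: "0 \<le> \<kappa> z" "\<kappa> z \<le> 1" for z
  proof -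
    show "0 \<le> \<kappa> z" using E by (simp add: \<kappa>_def)
    have "norm z powr (a - n) \<le> E" if "1/2 \<le> norm z"
    proof -
      have "norm z powr (a - n) \<le> (1/2) powr (a - n)"
        using that a_lt_n by (intro powr_mono2') auto
      also have "\<dots> = E" by (simp add: E_def powr_divide powr_diff)
      finally show ?thesis .
    qed
    then show "\<kappa> z \<le> 1" using E by (auto simp: \<kappa>_def indicator_def)
  qed
  \<comment> \<open>The power of the kernel decays like \<open>|z|\<^bsup>-s\<^esup>\<close>.\<close>
  have s_gt: "n < s"
  proof -
    have pos: "0 < pinf" "0 < 1 / pinf - a / n" using t pinf_ge fi(1,2) by auto
    have "n * (1 / pinf - a / n) < n - a"
      using pos n_pos t pinf_ge by (simp add: field_simps)
    then show ?thesis using pos by (simp add: s_def sobolev_def field_simps)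
  qed
  define Kt where "Kt = enn2real (\<integral>\<^sup>+ z. ennreal (\<kappa> z powr sobolev pinf) \<partial>lborel)"
  have Kt: "(\<integral>\<^sup>+ z. ennreal (\<kappa> z powr sobolev pinf) \<partial>lborel) = ennreal Kt" "0 \<le> Kt"
  proof -
    have "(\<integral>\<^sup>+ z. ennreal (\<kappa> z powr sobolev pinf) \<partial>lborel) \<le>
       (\<integral>\<^sup>+ z. ennreal (norm z powr (- s)) * indicator {z. 1/2 \<le> norm z} z \<partial>(lborel :: 'a measure))"
    proof (rule nn_integral_mono)
      fix z :: 'a
      have "\<kappa> z powr sobolev pinf \<le> norm z powr (- s)" if "1/2 \<le> norm z"
      proof -
        have "\<kappa> z \<le> norm z powr (a - n)"
          using that E mult_left_mono[of 1 E "norm z powr (a - n)"] by (simp add: \<kappa>_def divide_le_eq)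
        then have "\<kappa> z powr sobolev pinf \<le> (norm z powr (a - n)) powr sobolev pinf"
          using \<kappa> fi(5) by (intro powr_mono2) auto
        also have "\<dots> = norm z powr (- s)" by (simp add: powr_powr s_def algebra_simps)
        finally show ?thesis .
      qed
      then show "ennreal (\<kappa> z powr sobolev pinf) \<le> ennreal (norm z powr (- s)) * indicator {z. 1/2 \<le> norm z} z"
        by (auto simp: indicator_def ennreal_leI \<kappa>_def)
    qed
    also have "\<dots> < top"
      using s_gt by (intro tail_integral_finite) simp
    finally show "(\<integral>\<^sup>+ z. ennreal (\<kappa> z powr sobolev pinf) \<partial>lborel) = ennreal Kt" "0 \<le> Kt"
      unfolding Kt_def by auto
  qed
  define C where "C = E powr Q * (exp ((n + 1) * (Q\<^sup>2 * c2)) * Kt + W)"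
  have C: "0 \<le> C" using Kt W by (simp add: C_def)
  have "(\<integral>\<^sup>+ x. epow (\<integral>\<^sup>+ y. ennreal (f y) * ennreal (norm (x - y) powr (a - n) * indicator {z. 1/2 \<le> norm z} (x - y)) \<partial>lborel)
        (sobolev (p x)) \<partial>lborel) \<le> ennreal C"
    if [measurable]: "f \<in> borel_measurable borel" and f0: "\<And>x. 0 \<le> f x" and f1: "(\<integral>\<^sup>+ x. ennreal (f x) \<partial>lborel) \<le> 1" for f :: "'a \<Rightarrow> real"
  proof -
    define G where "G x = (\<integral>\<^sup>+ y. ennreal (\<kappa> (x - y)) * ennreal (f y) \<partial>lborel)" for x
    have [measurable]: "G \<in> borel_measurable borel" unfolding G_def by measurable
    have G1: "G x \<le> 1" for x
    proof -
      have "G x \<le> (\<integral>\<^sup>+ y. 1 * ennreal (f y) \<partial>lborel)"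
        unfolding G_def using \<kappa> by (intro nn_integral_mono mult_right_mono) (auto simp: ennreal_le_1)
      then show ?thesis using f1 by simp
    qed
    have I: "(\<integral>\<^sup>+ y. ennreal (f y) * ennreal (norm (x - y) powr (a - n) * indicator {z. 1/2 \<le> norm z} (x - y)) \<partial>lborel) = ennreal E * G x" for x
    proof -
      have "(\<integral>\<^sup>+ y. ennreal (f y) * ennreal (norm (x - y) powr (a - n) * indicator {z. 1/2 \<le> norm z} (x - y)) \<partial>lborel) =
         (\<integral>\<^sup>+ y. ennreal E * (ennreal (\<kappa> (x - y)) * ennreal (f y)) \<partial>lborel)"
        using E f0 \<kappa> by (intro nn_integral_cong) (simp add: \<kappa>_def mult_ac flip: ennreal_mult)
      also have "\<dots> = ennreal E * G x"
        unfolding G_def by (rule nn_integral_cmult) measurable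
      finally show ?thesis .
    qed
    have "(\<integral>\<^sup>+ x. epow (G x) (sobolev pinf) \<partial>lborel) \<le>
        (\<integral>\<^sup>+ x. (\<integral>\<^sup>+ y. ennreal (\<kappa> (x - y) powr sobolev pinf) * ennreal (f y) \<partial>lborel) \<partial>lborel)"
      unfolding G_def using f1 fi(5) \<kappa> by (intro nn_integral_mono jensen_epow) auto
    also have "\<dots> = (\<integral>\<^sup>+ y. (\<integral>\<^sup>+ x. ennreal (\<kappa> (x - y) powr sobolev pinf) * ennreal (f y) \<partial>lborel) \<partial>lborel)"
      by (rule lborel_pair.Fubini') measurable
    also have "\<dots> = (\<integral>\<^sup>+ y. ennreal Kt * ennreal (f y) \<partial>lborel)"
    proof (rule nn_integral_cong)
      fix y
      have "(\<integral>\<^sup>+ x. ennreal (\<kappa> (x - y) powr sobolev pinf) * ennreal (f y) \<partial>lborel) =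
         (\<integral>\<^sup>+ x. ennreal (\<kappa> (x - y) powr sobolev pinf) \<partial>lborel) * ennreal (f y)"
        by (rule nn_integral_multc) measurable
      also have "(\<integral>\<^sup>+ x. ennreal (\<kappa> (x - y) powr sobolev pinf) \<partial>lborel) = ennreal Kt"
        unfolding Kt(1)[symmetric]
        by (rule nn_integral_lborel_translate[where f="\<lambda>z. ennreal (\<kappa> z powr sobolev pinf)"]) measurable
      finally show "(\<integral>\<^sup>+ x. ennreal (\<kappa> (x - y) powr sobolev pinf) * ennreal (f y) \<partial>lborel) = ennreal Kt * ennreal (f y)" .
    qed
    also have "\<dots> = ennreal Kt * (\<integral>\<^sup>+ y. ennreal (f y) \<partial>lborel)"
      by (rule nn_integral_cmult) measurable
    also have "\<dots> \<le> ennreal Kt * 1"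
      by (rule mult_left_mono[OF f1]) simp
    finally have GI: "(\<integral>\<^sup>+ x. epow (G x) (sobolev pinf) \<partial>lborel) \<le> ennreal Kt" by simp
    have "(\<integral>\<^sup>+ x. epow (ennreal E * G x) (sobolev (p x)) \<partial>lborel) \<le>
       (\<integral>\<^sup>+ x. ennreal (E powr Q) * epow (G x) (sobolev (p x)) \<partial>lborel)"
      using E sobolev_facts[OF p_ge p_le] by (intro nn_integral_mono epow_scaled_le) auto
    also have "\<dots> = ennreal (E powr Q) * (\<integral>\<^sup>+ x. epow (G x) (sobolev (p x)) \<partial>lborel)"
      by (rule nn_integral_cmult) measurable
    also have "\<dots> \<le> ennreal (E powr Q) * ennreal (exp ((n + 1) * (Q\<^sup>2 * c2)) * Kt + W)"
      using GI Kt(2) by (intro mult_left_mono to_sobolev_exponent G1) auto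
    also have "\<dots> = ennreal C"
      unfolding C_def by (subst ennreal_mult) (use Kt(2) W(2) in auto)
    finally show ?thesis unfolding I .
  qed
  then show ?thesis using C by blast
qed

text \<open>
  The first factor accounts for small unit balls, the second one is \<open>2\<^bsup>-kn\<delta>\<^esup>\<close> for the oscillation
  \<open>\<delta> = c1 / (-k ln 2)\<close> of \<open>p\<close> on a ball of radius \<open>2\<^sup>k\<close>; it does not depend on \<open>k\<close>.
\<close>

definition diening_const :: real where
  "diening_const = max 1 (1 / v) powr (c1 / ln 2) * exp (n * c1)"

lemma diening_const_ge: "1 \<le> diening_const"
proof -
  have "1 \<le> max 1 (1 / v) powr (c1 / ln 2)" using c1 by (intro ge_one_powr_ge_zero) auto
  moreover have "1 \<le> exp (n * c1)" using c1 n_pos by simp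
  ultimately show ?thesis
    unfolding diening_const_def using mult_mono[of 1 _ 1 "exp (n * c1)"] by simp
qed

text \<open>
  Jensen's inequality with an exponent that varies over a small ball. It is applied with a lower bound
  \<open>\<rho>\<close> for \<open>p/t\<close> on the ball, which is legitimate as \<open>f\<close> vanishes or exceeds 1. The passage from
  \<open>1/\<rho>\<close> to the exponent \<open>t / p x\<close> at the centre costs a power of the mean with an exponent of order
  \<open>1/|k|\<close>. As the modular of \<open>f\<close> is at most 1, the mean is at most a multiple of \<open>2\<^bsup>-kn\<^esup>\<close>, and
  the log-Hoelder condition makes that power bounded.
\<close>

lemma diening_local_estimate:
  fixes f :: "'a \<Rightarrow> real" and k :: int
  assumes [measurable]: "f \<in> borel_measurable borel" and f: "\<And>x. f x = 0 \<or> 1 < f x"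
    and fp: "(\<integral>\<^sup>+ x. ennreal (f x powr p x) \<partial>lborel) \<le> 1" and k: "k \<le> -1"
  shows "ball_mean (2 powr real_of_int k) (\<lambda>y. ennreal (f y)) x \<le>
     ennreal diening_const * epow (ball_mean (2 powr real_of_int k) (\<lambda>y. ennreal (f y powr (p y / t))) x) (t / p x)"
proof -
  let ?r = "2 powr real_of_int k"
  have f0: "0 \<le> f y" for y using f[of y] by auto
  have f1: "f y powr u \<le> f y powr w" if "u \<le> w" for u w y
    using f[of y] that by (auto intro: powr_mono)
  define r where "r = p x / t"
  have r: "1 \<le> r" using t p_ge[of x] by (simp add: r_def)
  define \<delta> where "\<delta> = c1 / (- real_of_int k * ln 2)"
  have kl: "0 < - real_of_int k * ln 2" using k by (intro mult_pos_pos) auto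
  have \<delta>0: "0 \<le> \<delta>" unfolding \<delta>_def using c1 kl by (intro divide_nonneg_pos)
  \<comment> \<open>Jensen's inequality needs an exponent of at least 1.\<close>
  define \<rho> where "\<rho> = max 1 (r - \<delta>)"
  have \<rho>: "1 \<le> \<rho>" "\<rho> \<le> r" "r - \<rho> \<le> \<delta>" using r \<delta>0 by (auto simp: \<rho>_def)
  have rho_le: "\<rho> \<le> p y / t" if "y \<in> ball x ?r" for y
  proof (cases "y = x")
    case True
    then show ?thesis using \<rho> by (simp add: r_def)
  next
    case False
    have "?r \<le> 2 powr (- 1)" using k by (intro powr_mono) auto
    then have d: "norm (x - y) < ?r" "norm (x - y) \<le> 1/2" "0 < norm (x - y)"
      using that False by (auto simp: dist_norm powr_minus)
    have "ln (norm (x - y)) < ln ?r" using d by (subst ln_less_cancel_iff) auto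
    then have L: "- real_of_int k * ln 2 \<le> - ln (norm (x - y))" by (simp add: ln_powr)
    then have "0 < - ln (norm (x - y))" using kl by linarith
    then have "c1 / (- ln (norm (x - y))) \<le> \<delta>"
      unfolding \<delta>_def by (intro divide_left_mono L c1 mult_pos_pos kl)
    then have "\<bar>p x - p y\<bar> \<le> \<delta>" using log_local[of x y] False d by simp
    then have "p x - \<delta> \<le> p y" by linarith
    then have "(p x - \<delta>) / t \<le> p y / t" using t by (intro divide_right_mono) auto
    moreover have "r - \<delta> \<le> (p x - \<delta>) / t"
    proof -
      have "\<delta> / t \<le> \<delta>" using t \<delta>0 mult_left_mono[of 1 t \<delta>] by (simp add: divide_le_eq)
      then show ?thesis unfolding r_def by (simp add: diff_divide_distrib)
    qed
    moreover have "1 \<le> p y / t" using t p_ge[of y] by simp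
    ultimately show ?thesis unfolding \<rho>_def by simp
  qed
  define V where "V = ball_mean ?r (\<lambda>y. ennreal (f y powr (p y / t))) x"
  have "epow (ball_mean ?r (\<lambda>y. ennreal (f y)) x) \<rho> \<le> ball_mean ?r (\<lambda>y. ennreal (f y powr \<rho>)) x"
    using f0 \<rho> by (intro ball_mean_jensen) auto
  also have "\<dots> \<le> V"
    unfolding V_def by (intro ball_mean_mono ennreal_leI f1 rho_le)
  finally have A: "ball_mean ?r (\<lambda>y. ennreal (f y)) x \<le> epow V (1 / \<rho>)"
    using \<rho> by (intro le_epow_root) auto
  have "(\<integral>\<^sup>+ y. ennreal (f y powr (p y / t)) \<partial>lborel) \<le> (\<integral>\<^sup>+ y. ennreal (f y powr p y) \<partial>lborel)"
  proof (intro nn_integral_mono ennreal_leI f1)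
    fix y
    have "0 \<le> p y" using t p_ge[of y] by linarith
    then show "p y / t \<le> p y" using t mult_left_mono[of 1 t "p y"] by (simp add: divide_le_eq)
  qed
  also have "\<dots> \<le> ennreal 1" using fp by simp
  finally have "V \<le> ennreal (1 / unit_ball_vol (DIM('a)) * 2 powr (- (real (DIM('a)) * real_of_int k)))"
    unfolding V_def by (rule ball_mean_le_integral)
  then have Vle: "V \<le> ennreal (1 / v * 2 powr (- (n * real_of_int k)))" by simp
  then obtain V' where V': "V = ennreal V'" "0 \<le> V'"
    by (cases V) (auto simp: top_unique)
  then have V'le: "V' \<le> 1 / v * 2 powr (- (n * real_of_int k))"
    using Vle v_pos by simp
  have B: "V' powr (1 / \<rho>) \<le> diening_const * V' powr (1 / r)"
  proof (cases "V' \<le> 1")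
    case True
    have "V' powr (1 / \<rho>) \<le> V' powr (1 / r)"
      using True V' \<rho> by (intro powr_mono') (auto intro!: divide_left_mono)
    also have "\<dots> \<le> diening_const * V' powr (1 / r)"
      using mult_right_mono[OF diening_const_ge, of "V' powr (1 / r)"] by simp
    finally show ?thesis .
  next
    case False
    have "1 / \<rho> - 1 / r = (r - \<rho>) / (\<rho> * r)" using \<rho> r by (simp add: field_simps)
    also have "\<dots> \<le> (r - \<rho>) / 1"
      using \<rho> r mult_mono[of 1 \<rho> 1 r] by (intro divide_left_mono) auto
    finally have e: "1 / \<rho> - 1 / r \<le> \<delta>" using \<rho> by simp
    have "V' powr (1 / \<rho>) = V' powr (1 / \<rho> - 1 / r) * V' powr (1 / r)"
      by (simp flip: powr_add)
    also have "V' powr (1 / \<rho> - 1 / r) \<le> V' powr \<delta>"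
      using False e by (intro powr_mono) auto
    also have "V' powr \<delta> \<le> (max 1 (1 / v) * 2 powr (- (n * real_of_int k))) powr \<delta>"
      using V'(2) \<delta>0 by (intro powr_mono2 order_trans[OF V'le] mult_right_mono) auto
    also have "\<dots> = max 1 (1 / v) powr \<delta> * 2 powr (n * (- real_of_int k * \<delta>))"
      by (subst powr_mult) (auto simp: powr_powr algebra_simps)
    also have "\<dots> \<le> max 1 (1 / v) powr (c1 / ln 2) * 2 powr (n * (- real_of_int k * \<delta>))"
    proof (intro mult_right_mono powr_mono)
      have "1 * ln 2 \<le> - real_of_int k * ln 2" using k by (intro mult_right_mono) auto
      then show "\<delta> \<le> c1 / ln 2"
        unfolding \<delta>_def using mult_pos_pos[OF kl, of "ln 2"] by (intro divide_left_mono c1) auto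
    qed auto
    also have "- real_of_int k * \<delta> = c1 / ln 2"
      using k by (simp add: \<delta>_def)
    also have "2 powr (n * (c1 / ln 2)) = exp (n * c1)"
      by (simp add: powr_def)
    finally show ?thesis
      by (simp add: diening_const_def mult_right_mono)
  qed
  have "ball_mean ?r (\<lambda>y. ennreal (f y)) x \<le> ennreal (V' powr (1 / \<rho>))"
    using A V' by simp
  also have "\<dots> \<le> ennreal (diening_const * V' powr (1 / r))"
    by (rule ennreal_leI[OF B])
  also have "\<dots> = ennreal diening_const * epow V (t / p x)"
    using V' diening_const_ge by (simp add: ennreal_mult r_def)
  finally show ?thesis
    unfolding V_def .
qed

text \<open>
  Hedberg's inequality with \<open>b = n / p x\<close>, applied to \<open>f\<close> restricted to the ball of radius 1/2 about
  \<open>x\<close>. For \<open>g = f\<^bsup>p(.)/t\<^esup>\<close> the uniform bound comes from the maximal function of \<open>g\<close> and the decay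
  from \<open>\<integral> g\<^sup>t \<le> 1\<close>, both through \<open>diening_local_estimate\<close>. The exponents are arranged so that the
  potential to the power \<open>sobolev (p x)\<close> is bounded by the maximal function of \<open>g\<close> to the power \<open>t\<close>.
\<close>

lemma modular_bound_near:
  "\<exists>C\<ge>0. \<forall>f. f \<in> borel_measurable borel \<longrightarrow> (\<forall>x. f x = 0 \<or> 1 < f x) \<longrightarrow>
     (\<integral>\<^sup>+ x. ennreal (f x powr p x) \<partial>lborel) \<le> 1 \<longrightarrow>
     (\<integral>\<^sup>+ x. epow (riesz_potential a (\<lambda>y. ennreal (f y * indicator (ball x (1/2)) y)) x) (sobolev (p x)) \<partial>lborel) \<le> ennreal C"
proof -
  define D2 where "D2 = max 1 (1 / v)"
  define D where "D = diening_const * D2"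
  define E where "E = hedberg_const * D"
  define Cm where "Cm = 2 powr t * 5 ^ DIM('a) * t / (t - 1)"
  define C where "C = E powr Q * Cm"
  have D2: "1 \<le> D2" by (simp add: D2_def)
  have D: "1 \<le> D" "diening_const \<le> D"
    unfolding D_def using D2 diening_const_ge mult_mono[of 1 diening_const 1 D2] mult_left_mono[of 1 D2 diening_const] by auto
  have E: "1 \<le> E" unfolding E_def using D mult_mono[of 1 hedberg_const 1 D] by (simp add: hedberg_const_def)
  have Cm: "0 \<le> Cm" using t by (simp add: Cm_def)
  have "(\<integral>\<^sup>+ x. epow (riesz_potential a (\<lambda>y. ennreal (f y * indicator (ball x (1/2)) y)) x) (sobolev (p x)) \<partial>lborel) \<le> ennreal C"
    if [measurable]: "f \<in> borel_measurable borel" and f: "\<And>x. f x = 0 \<or> 1 < f x"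
     and fp: "(\<integral>\<^sup>+ x. ennreal (f x powr p x) \<partial>lborel) \<le> 1" for f
  proof -
    have f0: "0 \<le> f y" for y using f[of y] by auto
    define g where "g y = f y powr (p y / t)" for y
    have [measurable]: "g \<in> borel_measurable borel" unfolding g_def by measurable
    define M where "M = dyadic_maximal (\<lambda>x. ennreal (g x))"
    have [measurable]: "M \<in> borel_measurable borel" unfolding M_def by measurable
    have gt: "(\<integral>\<^sup>+ x. ennreal (g x powr t) \<partial>lborel) \<le> ennreal 1"
      using fp t by (simp add: g_def powr_powr)
    have IM: "(\<integral>\<^sup>+ x. epow (M x) t \<partial>lborel) \<le> ennreal Cm"
    proof -
      have "(\<integral>\<^sup>+ x. epow (M x) t \<partial>lborel) \<le> ennreal Cm * (\<integral>\<^sup>+ x. ennreal (g x powr t) \<partial>lborel)"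
        unfolding M_def Cm_def using t by (intro dyadic_maximal_strong_type) (auto simp: g_def)
      also have "\<dots> \<le> ennreal Cm * ennreal 1"
        using gt by (rule mult_left_mono) simp
      finally show ?thesis by simp
    qed
    have I: "riesz_potential a (\<lambda>y. ennreal (f y * indicator (ball x (1/2)) y)) x \<le>
       ennreal E * epow (epow (M x) (t / p x)) (1 - a / (n / p x))" for x
    proof -
      have px: "0 < p x" "t \<le> p x" using t p_ge[of x] by auto
      define m where "m k = ball_mean (2 powr real_of_int k) (\<lambda>y. ennreal (f y)) x" for k :: int
      have m1: "m k \<le> ennreal D * epow (M x) (t / p x)" if "k \<le> -1" for k
      proof -
        have "m k \<le> ennreal diening_const * epow (ball_mean (2 powr real_of_int k) (\<lambda>y. ennreal (g y)) x) (t / p x)"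
          unfolding m_def g_def using f fp that by (intro diening_local_estimate) auto
        also have "\<dots> \<le> ennreal D * epow (M x) (t / p x)"
          unfolding M_def using D px t by (intro mult_mono epow_mono ball_mean_le_dyadic_maximal ennreal_leI) auto
        finally show ?thesis .
      qed
      have m2: "m k \<le> ennreal (D * 2 powr (- (n / p x) * real_of_int k))" if "k \<le> -1" for k
      proof -
        have "m k \<le> ennreal diening_const * epow (ball_mean (2 powr real_of_int k) (\<lambda>y. ennreal (g y)) x) (t / p x)"
          unfolding m_def g_def using f fp that by (intro diening_local_estimate) auto
        also have "\<dots> \<le> ennreal diening_const * epow (ennreal ((1 / v) powr (1 / t) * 2 powr (- (n / t) * real_of_int k))) (t / p x)"
        proof (intro mult_left_mono epow_mono)
          show "ball_mean (2 powr real_of_int k) (\<lambda>y. ennreal (g y)) x \<le> ennreal ((1 / v) powr (1 / t) * 2 powr (- (n / t) * real_of_int k))"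
            unfolding v_eq[symmetric] n_eq[symmetric] using gt t by (intro ball_mean_decay) (auto simp: g_def)
        qed (use px t in auto)
        also have "epow (ennreal ((1 / v) powr (1 / t) * 2 powr (- (n / t) * real_of_int k))) (t / p x) =
            ennreal ((1 / v) powr (1 / p x) * 2 powr (- (n / p x) * real_of_int k))"
          using t px by (subst epow_ennreal, simp, subst powr_mult) (auto simp: powr_powr)
        also have "ennreal diening_const * \<dots> = ennreal (diening_const * ((1 / v) powr (1 / p x) * 2 powr (- (n / p x) * real_of_int k)))"
          using diening_const_ge by (subst ennreal_mult) auto
        also have "\<dots> \<le> ennreal (D * 2 powr (- (n / p x) * real_of_int k))"
        proof -
          have "(1 / v) powr (1 / p x) \<le> D2 powr (1 / p x)"
            using v_pos px by (intro powr_mono2) (auto simp: D2_def)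
          also have "\<dots> \<le> D2 powr 1" using D2 px t by (intro powr_mono) auto
          finally have "(1 / v) powr (1 / p x) \<le> D2" using D2 by simp
          then show ?thesis
            unfolding D_def mult.assoc using diening_const_ge by (intro ennreal_leI mult_left_mono mult_right_mono) auto
        qed
        finally show ?thesis .
      qed
      define fx where "fx = (\<lambda>y. ennreal (f y * indicator (ball x (1/2)) y))"
      have [measurable]: "fx \<in> borel_measurable borel" unfolding fx_def by measurable
      define mx where "mx k = ball_mean (2 powr real_of_int k) fx x" for k :: int
      have mx_le: "mx k \<le> m k" for k
        unfolding mx_def m_def fx_def using f0 by (intro ball_mean_mono) (auto simp: indicator_def)
      \<comment> \<open>Beyond radius 1/2 the restricted function contributes no new mass, so its means only lose
        volume; this extends both bounds from the scales \<open>k \<le> -1\<close> to all scales.\<close>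
      have mx_large: "mx k \<le> ennreal (2 powr (- n * (real_of_int k + 1))) * m (-1)" for k
      proof -
        have "(\<integral>\<^sup>+ y. fx y * indicator (ball x (2 powr real_of_int k)) y \<partial>lborel) \<le>
           (\<integral>\<^sup>+ y. ennreal (f y) * indicator (ball x (2 powr real_of_int (-1))) y \<partial>lborel)"
          by (intro nn_integral_mono) (auto simp: fx_def indicator_def powr_minus)
        also have "\<dots> = emeasure lborel (ball x (2 powr real_of_int (-1))) * m (-1)"
          unfolding m_def by (rule ball_mean_eq_integral) simp
        finally have "mx k \<le> emeasure lborel (ball x (2 powr real_of_int (-1))) * m (-1) / emeasure lborel (ball x (2 powr real_of_int k))"
          unfolding mx_def ball_mean_def by (rule divide_right_mono_ennreal)
        also have "\<dots> = emeasure lborel (ball x (2 powr real_of_int (-1))) / emeasure lborel (ball x (2 powr real_of_int k)) * m (-1)"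
          by (simp add: ennreal_times_divide ennreal_divide_times mult.commute)
        also have "emeasure lborel (ball x (2 powr real_of_int (-1))) / emeasure lborel (ball x (2 powr real_of_int k)) =
           ennreal (2 powr (- n * (real_of_int k + 1)))"
        proof -
          have "emeasure lborel (ball x (2 powr real_of_int j)) = ennreal (v * 2 powr (n * real_of_int j))" for j
            by (simp add: emeasure_ball powr_power mult.commute)
          moreover have "ennreal (v * 2 powr (n * real_of_int (-1))) / ennreal (v * 2 powr (n * real_of_int k)) =
             ennreal (2 powr (n * real_of_int (-1)) / 2 powr (n * real_of_int k))"
            using v_pos by (subst divide_ennreal) auto
          moreover have "2 powr (n * real_of_int (-1)) / 2 powr (n * real_of_int k) = 2 powr (- n * (real_of_int k + 1))"
            by (simp add: powr_diff[symmetric] algebra_simps)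
          ultimately show ?thesis by (simp only:)
        qed
        finally show ?thesis .
      qed
      have "riesz_potential a fx x \<le> ennreal (hedberg_const * D) * epow (epow (M x) (t / p x)) (1 - a / (n / p x))"
      proof (rule hedberg_uniform[OF _ p_ge[of x] p_le[of x]])
        fix k :: int
        show "ball_mean (2 powr real_of_int k) fx x \<le> ennreal D * epow (M x) (t / p x)"
        proof (cases "k \<le> -1")
          case True
          then show ?thesis using mx_le[of k] m1[of k] by (simp add: mx_def)
        next
          case False
          have "mx k \<le> ennreal (2 powr (- n * (real_of_int k + 1))) * m (-1)" by (rule mx_large)
          also have "\<dots> \<le> ennreal (2 powr 0) * m (-1)"
            using False n_pos by (intro mult_right_mono ennreal_leI powr_mono) (auto simp: mult_nonpos_nonneg)
          also have "\<dots> \<le> ennreal D * epow (M x) (t / p x)" using m1[of "-1"] by simp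
          finally show ?thesis by (simp add: mx_def)
        qed
        show "ball_mean (2 powr real_of_int k) fx x \<le> ennreal (D * 2 powr (- (n / p x) * real_of_int k))"
        proof (cases "k \<le> -1")
          case True
          then show ?thesis using mx_le[of k] m2[of k] by (simp add: mx_def)
        next
          case False
          have "mx k \<le> ennreal (2 powr (- n * (real_of_int k + 1))) * m (-1)" by (rule mx_large)
          also have "\<dots> \<le> ennreal (2 powr (- (n / p x) * (real_of_int k + 1))) * ennreal (D * 2 powr (- (n / p x) * real_of_int (-1)))"
          proof -
            have "n / p x \<le> n" using t px n_pos mult_left_mono[of 1 "p x" n] by (simp add: divide_le_eq)
            then have "- n * (real_of_int k + 1) \<le> - (n / p x) * (real_of_int k + 1)"
              using False by (intro mult_right_mono) auto
            then have "2 powr (- n * (real_of_int k + 1)) \<le> 2 powr (- (n / p x) * (real_of_int k + 1))"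
              by (intro powr_mono) auto
            then show ?thesis using m2[of "-1"] by (intro mult_mono ennreal_leI) auto
          qed
          also have "\<dots> = ennreal (D * (2 powr (- (n / p x) * (real_of_int k + 1)) * 2 powr (- (n / p x) * real_of_int (-1))))"
            using D by (simp add: mult_ac flip: ennreal_mult)
          also have "2 powr (- (n / p x) * (real_of_int k + 1)) * 2 powr (- (n / p x) * real_of_int (-1)) = 2 powr (- (n / p x) * real_of_int k)"
            unfolding powr_add[symmetric] by (simp add: ring_distribs)
          finally show ?thesis by (simp add: mx_def)
        qed
      qed (use D in auto)
      then show ?thesis unfolding fx_def E_def .
    qed
    have "(\<integral>\<^sup>+ x. epow (riesz_potential a (\<lambda>y. ennreal (f y * indicator (ball x (1/2)) y)) x) (sobolev (p x)) \<partial>lborel) \<le>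
       (\<integral>\<^sup>+ x. ennreal (E powr Q) * epow (epow (epow (M x) (t / p x)) (1 - a / (n / p x))) (sobolev (p x)) \<partial>lborel)"
      using I E sobolev_facts[OF p_ge p_le] by (intro nn_integral_mono epow_scaled_le) auto
    also have "\<dots> = (\<integral>\<^sup>+ x. ennreal (E powr Q) * epow (M x) t \<partial>lborel)"
    proof (rule nn_integral_cong)
      fix x
      have "t / p x * ((1 - a / (n / p x)) * sobolev (p x)) = t"
        unfolding sobolev_facts(8)[OF p_ge p_le] using t p_ge[of x] by simp
      then show "ennreal (E powr Q) * epow (epow (epow (M x) (t / p x)) (1 - a / (n / p x))) (sobolev (p x)) = ennreal (E powr Q) * epow (M x) t"
        unfolding epow_epow by (simp add: mult.assoc)
    qed
    also have "\<dots> = ennreal (E powr Q) * (\<integral>\<^sup>+ x. epow (M x) t \<partial>lborel)"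
      by (rule nn_integral_cmult) measurable
    also have "\<dots> \<le> ennreal (E powr Q) * ennreal Cm"
      using IM by (rule mult_left_mono) simp
    also have "\<dots> = ennreal C"
      unfolding C_def by (subst ennreal_mult) (use Cm in auto)
    finally show ?thesis .
  qed
  then show ?thesis
    using Cm by (intro exI[of _ C]) (auto simp: C_def)
qed

text \<open>
  The three partial bounds are added; the powers of sums cost factors \<open>2\<^sup>Q\<close> only because the Sobolev
  exponent is bounded by \<open>Q\<close>.
\<close>

theorem riesz_potential_modular_bound:
  "\<exists>C\<ge>0. \<forall>f. f \<in> borel_measurable borel \<longrightarrow> (\<forall>x. 0 \<le> f x) \<longrightarrow>
     (\<integral>\<^sup>+ x. ennreal (f x powr p x) \<partial>lborel) \<le> 1 \<longrightarrow>
     (\<integral>\<^sup>+ x. epow (riesz_potential a (\<lambda>y. ennreal (f y)) x) (sobolev (p x)) \<partial>lborel) \<le> ennreal C"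
proof -
  obtain C1 where C1: "0 \<le> C1" and low: "\<And>f. f \<in> borel_measurable borel \<Longrightarrow> (\<And>x. 0 \<le> f x \<and> f x \<le> (1::real)) \<Longrightarrow>
     (\<integral>\<^sup>+ x. ennreal (f x powr p x) \<partial>lborel) \<le> 1 \<Longrightarrow>
     (\<integral>\<^sup>+ x. epow (riesz_potential a (\<lambda>y. ennreal (f y)) x) (sobolev (p x)) \<partial>lborel) \<le> ennreal C1"
    using modular_bound_small_values by blast
  obtain C2 where C2: "0 \<le> C2" and far: "\<And>f. f \<in> borel_measurable borel \<Longrightarrow> (\<And>x. 0 \<le> f x) \<Longrightarrow>
     (\<integral>\<^sup>+ x. ennreal (f x) \<partial>lborel) \<le> 1 \<Longrightarrow>
     (\<integral>\<^sup>+ x. epow (\<integral>\<^sup>+ y. ennreal (f y) * ennreal (norm (x - y) powr (a - n) * indicator {z. 1/2 \<le> norm z} (x - y)) \<partial>lborel)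
        (sobolev (p x)) \<partial>lborel) \<le> ennreal C2"
    using modular_bound_far by blast
  obtain C3 where C3: "0 \<le> C3" and near: "\<And>f. f \<in> borel_measurable borel \<Longrightarrow> (\<And>x. f x = 0 \<or> 1 < f x) \<Longrightarrow>
     (\<integral>\<^sup>+ x. ennreal (f x powr p x) \<partial>lborel) \<le> 1 \<Longrightarrow>
     (\<integral>\<^sup>+ x. epow (riesz_potential a (\<lambda>y. ennreal (f y * indicator (ball x (1/2)) y)) x) (sobolev (p x)) \<partial>lborel) \<le> ennreal C3"
    using modular_bound_near by blast
  define c where "c = 2 powr Q"
  define C where "C = c * (C1 + c * (C3 + C2))"
  have c: "0 < c" by (simp add: c_def)
  have "(\<integral>\<^sup>+ x. epow (riesz_potential a (\<lambda>y. ennreal (f y)) x) (sobolev (p x)) \<partial>lborel) \<le> ennreal C"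
    if [measurable]: "f \<in> borel_measurable borel" and f0: "\<And>x. 0 \<le> f x"
     and fp: "(\<integral>\<^sup>+ x. ennreal (f x powr p x) \<partial>lborel) \<le> 1" for f
  proof -
    define g where "g x = f x * indicator {..1} (f x)" for x
    define h where "h x = f x * indicator {1<..} (f x)" for x
    have [measurable]: "g \<in> borel_measurable borel" "h \<in> borel_measurable borel"
      unfolding g_def h_def by measurable
    have g: "0 \<le> g x \<and> g x \<le> 1" and h: "h x = 0 \<or> 1 < h x" and h0: "0 \<le> h x" for x
      using f0[of x] by (auto simp: g_def h_def indicator_def)
    have px: "1 \<le> p x" for x using t p_ge[of x] by linarith
    have "(\<integral>\<^sup>+ x. ennreal (g x powr p x) \<partial>lborel) \<le> (\<integral>\<^sup>+ x. ennreal (f x powr p x) \<partial>lborel)"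
      by (intro nn_integral_mono) (auto simp: g_def indicator_def)
    then have gp: "(\<integral>\<^sup>+ x. ennreal (g x powr p x) \<partial>lborel) \<le> 1" using fp by simp
    have "(\<integral>\<^sup>+ x. ennreal (h x powr p x) \<partial>lborel) \<le> (\<integral>\<^sup>+ x. ennreal (f x powr p x) \<partial>lborel)"
      by (intro nn_integral_mono) (auto simp: h_def indicator_def)
    then have hp: "(\<integral>\<^sup>+ x. ennreal (h x powr p x) \<partial>lborel) \<le> 1" using fp by simp
    have "(\<integral>\<^sup>+ x. ennreal (h x) \<partial>lborel) \<le> (\<integral>\<^sup>+ x. ennreal (h x powr p x) \<partial>lborel)"
    proof (intro nn_integral_mono ennreal_leI)
      fix x
      show "h x \<le> h x powr p x" using h[of x] powr_mono[of 1 "p x" "h x"] px[of x] by auto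
    qed
    then have h1: "(\<integral>\<^sup>+ x. ennreal (h x) \<partial>lborel) \<le> 1" using hp by simp
    define X where "X x = riesz_potential a (\<lambda>y. ennreal (g y)) x" for x
    define Y where "Y x = riesz_potential a (\<lambda>y. ennreal (h y * indicator (ball x (1/2)) y)) x" for x
    define Z where "Z x = (\<integral>\<^sup>+ y. ennreal (h y) * ennreal (norm (x - y) powr (a - n) * indicator {z. 1/2 \<le> norm z} (x - y)) \<partial>lborel)" for x
    have [measurable]: "X \<in> borel_measurable borel" "Z \<in> borel_measurable borel"
      unfolding X_def Z_def by measurable
    have [measurable]: "Y \<in> borel_measurable borel"
    proof -
      have "Y = (\<lambda>x. \<integral>\<^sup>+ y. ennreal (h y * (if dist x y < 1/2 then 1 else 0)) * ennreal (norm (x - y) powr (a - n)) \<partial>lborel)"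
        unfolding Y_def riesz_potential_def by (auto simp: fun_eq_iff indicator_def intro!: nn_integral_cong)
      then show ?thesis by simp
    qed
    have "riesz_potential a (\<lambda>y. ennreal (f y)) x = X x + (Y x + Z x)" for x
    proof -
      have "riesz_potential a (\<lambda>y. ennreal (f y)) x = (\<integral>\<^sup>+ y. ennreal (g y) * ennreal (norm (x - y) powr (a - n)) +
         (ennreal (h y * indicator (ball x (1/2)) y) * ennreal (norm (x - y) powr (a - n)) +
          ennreal (h y) * ennreal (norm (x - y) powr (a - n) * indicator {z. 1/2 \<le> norm z} (x - y))) \<partial>lborel)"
        unfolding riesz_potential_def n_eq
        by (intro nn_integral_cong) (auto simp: g_def h_def indicator_def dist_norm)
      also have "\<dots> = X x + (Y x + Z x)"
        unfolding X_def Y_def Z_def riesz_potential_def n_eq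
        by (subst nn_integral_add, simp, simp, subst nn_integral_add) auto
      finally show ?thesis .
    qed
    then have "(\<integral>\<^sup>+ x. epow (riesz_potential a (\<lambda>y. ennreal (f y)) x) (sobolev (p x)) \<partial>lborel) \<le>
      (\<integral>\<^sup>+ x. ennreal c * (epow (X x) (sobolev (p x)) + ennreal c * (epow (Y x) (sobolev (p x)) + epow (Z x) (sobolev (p x)))) \<partial>lborel)"
    proof (intro nn_integral_mono)
      fix x
      let ?s = "sobolev (p x)"
      note sx = sobolev_facts[OF p_ge[of x] p_le[of x]]
      have add: "epow (u + w) ?s \<le> ennreal c * (epow u ?s + epow w ?s)" for u w
      proof -
        have "epow (u + w) ?s \<le> ennreal (2 powr ?s) * (epow u ?s + epow w ?s)"
          using sx by (intro epow_add) auto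
        also have "\<dots> \<le> ennreal c * (epow u ?s + epow w ?s)"
          unfolding c_def using sx by (intro mult_right_mono ennreal_leI powr_mono) auto
        finally show ?thesis .
      qed
      have "epow (X x + (Y x + Z x)) ?s \<le> ennreal c * (epow (X x) ?s + epow (Y x + Z x) ?s)" by (rule add)
      also have "\<dots> \<le> ennreal c * (epow (X x) ?s + ennreal c * (epow (Y x) ?s + epow (Z x) ?s))"
        by (intro mult_left_mono add_left_mono add) auto
      finally show "epow (riesz_potential a (\<lambda>y. ennreal (f y)) x) ?s \<le> \<dots>"
        using \<open>riesz_potential a (\<lambda>y. ennreal (f y)) x = X x + (Y x + Z x)\<close> by simp
    qed
    also have "\<dots> = ennreal c * ((\<integral>\<^sup>+ x. epow (X x) (sobolev (p x)) \<partial>lborel) + ennreal c * ((\<integral>\<^sup>+ x. epow (Y x) (sobolev (p x)) \<partial>lborel) + (\<integral>\<^sup>+ x. epow (Z x) (sobolev (p x)) \<partial>lborel)))"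
      by (simp add: nn_integral_add nn_integral_cmult)
    also have "\<dots> \<le> ennreal c * (ennreal C1 + ennreal c * (ennreal C3 + ennreal C2))"
      unfolding X_def Y_def Z_def
      using g h h0 gp hp h1 by (intro mult_left_mono add_mono low near far) auto
    also have "\<dots> = ennreal C"
      using c C1 C2 C3 by (simp add: C_def ennreal_mult)
    finally show ?thesis .
  qed
  then show ?thesis using c C1 C2 C3 by (intro exI[of _ C]) (auto simp: C_def)
qed

end

section \<open>Lebesgue measure on tuples of points\<close>

lemma measurable_vec_component [measurable]: "(\<lambda>y :: 'a::euclidean_space^'m. y $ j) \<in> borel_measurable borel"
  by (intro borel_measurable_continuous_onI continuous_intros)

lemma measurable_vec_lambda [measurable]:
  "vec_lambda \<in> measurable (Pi\<^sub>M UNIV (\<lambda>_. lborel)) (borel :: ('a::euclidean_space^'m::finite) measure)"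
proof (subst borel_measurable_euclidean_space, safe)
  fix b :: "'a^'m" assume "b \<in> Basis"
  then obtain i u where "b = axis i u" by (auto simp: Basis_vec_def)
  moreover have "(\<lambda>x :: 'm \<Rightarrow> 'a. x i \<bullet> u) \<in> borel_measurable (Pi\<^sub>M UNIV (\<lambda>_. lborel))"
    by measurable
  ultimately show "(\<lambda>x. vec_lambda x \<bullet> b) \<in> borel_measurable (Pi\<^sub>M UNIV (\<lambda>_. lborel))"
    by (simp add: inner_axis)
qed

lemma lborel_vec_eq_product:
  "distr (Pi\<^sub>M (UNIV :: 'm::finite set) (\<lambda>_. lborel :: 'a::euclidean_space measure)) borel vec_lambda = lborel"
proof (rule lborel_eqI[symmetric])
  interpret product_sigma_finite "\<lambda>_ :: 'm. lborel :: 'a measure" by standard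
  fix l u :: "'a^'m"
  assume lu: "\<And>b. b \<in> Basis \<Longrightarrow> l \<bullet> b \<le> u \<bullet> b"
  have lu': "l $ i \<bullet> b \<le> u $ i \<bullet> b" if "b \<in> Basis" for i b
    using lu[of "axis i b"] that by (auto simp: Basis_vec_def inner_axis)
  have "vec_lambda -` box l u \<inter> space (Pi\<^sub>M UNIV (\<lambda>_. lborel)) = (\<Pi>\<^sub>E i\<in>UNIV. box (l $ i) (u $ i))"
    by (auto simp: mem_box Basis_vec_def inner_axis space_PiM PiE_def Pi_def)
  then have "emeasure (distr (Pi\<^sub>M UNIV (\<lambda>_. lborel)) borel vec_lambda) (box l u) =
      emeasure (Pi\<^sub>M UNIV (\<lambda>_. lborel)) (\<Pi>\<^sub>E i\<in>UNIV. box (l $ i) (u $ i))"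
    by (subst emeasure_distr) auto
  also have "\<dots> = (\<Prod>i\<in>UNIV. emeasure lborel (box (l $ i) (u $ i)))"
    by (rule emeasure_PiM) auto
  also have "\<dots> = (\<Prod>i\<in>UNIV. ennreal (\<Prod>b\<in>Basis. (u $ i - l $ i) \<bullet> b))"
    using lu' by (intro prod.cong refl) (subst emeasure_lborel_box, auto)
  also have "\<dots> = ennreal (\<Prod>i\<in>UNIV. \<Prod>b\<in>Basis. (u $ i - l $ i) \<bullet> b)"
    using lu' by (intro prod_ennreal prod_nonneg) (auto simp: inner_diff_left)
  also have "(\<Prod>i\<in>UNIV. \<Prod>b\<in>Basis. (u $ i - l $ i) \<bullet> b) = (\<Prod>b\<in>Basis. (u - l) \<bullet> b)"
  proof -
    have "(\<Prod>b\<in>Basis. (u - l) \<bullet> b) = (\<Prod>b\<in>(\<lambda>(i, b). axis i b) ` (UNIV \<times> (Basis :: 'a set)). (u - l) \<bullet> b)"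
      by (intro prod.cong) (auto simp: Basis_vec_def)
    also have "\<dots> = (\<Prod>(i, b)\<in>UNIV \<times> Basis. (u - l) \<bullet> axis i b)"
    proof (subst prod.reindex)
      show "inj_on (\<lambda>(i :: 'm, b). axis i b) (UNIV \<times> (Basis :: 'a set))"
        by (auto simp: inj_on_def axis_eq_axis)
    qed (simp add: split_beta' o_def)
    also have "\<dots> = (\<Prod>i\<in>UNIV. \<Prod>b\<in>Basis. (u $ i - l $ i) \<bullet> b)"
      by (subst prod.cartesian_product[symmetric]) (simp add: inner_axis)
    finally show ?thesis by simp
  qed
  finally show "emeasure (distr (Pi\<^sub>M UNIV (\<lambda>_. lborel)) borel vec_lambda) (box l u) = (\<Prod>b\<in>Basis. (u - l) \<bullet> b)" .
qed simp

lemma nn_integral_vec_prod: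
  fixes f :: "'m::finite \<Rightarrow> 'a::euclidean_space \<Rightarrow> ennreal"
  assumes [measurable]: "\<And>j. f j \<in> borel_measurable borel"
  shows "(\<integral>\<^sup>+ y. (\<Prod>j\<in>UNIV. f j (y $ j)) \<partial>lborel) = (\<Prod>j\<in>UNIV. \<integral>\<^sup>+ x. f j x \<partial>lborel)"
proof -
  interpret product_sigma_finite "\<lambda>_ :: 'm. lborel :: 'a measure" by standard
  have "(\<integral>\<^sup>+ y. (\<Prod>j\<in>UNIV. f j (y $ j)) \<partial>lborel) =
      (\<integral>\<^sup>+ y. (\<Prod>j\<in>UNIV. f j (y $ j)) \<partial>distr (Pi\<^sub>M UNIV (\<lambda>_. lborel)) borel vec_lambda)"
    by (simp only: lborel_vec_eq_product)
  also have "\<dots> = (\<integral>\<^sup>+ y. (\<Prod>j\<in>UNIV. f j (y j)) \<partial>Pi\<^sub>M UNIV (\<lambda>_. lborel))"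
    by (subst nn_integral_distr) auto
  also have "\<dots> = (\<Prod>j\<in>UNIV. \<integral>\<^sup>+ x. f j x \<partial>lborel)"
    by (rule product_nn_integral_prod) auto
  finally show ?thesis .
qed

text \<open>
  The preimage of a null set under a coordinate is a product with one factor of measure 0.
\<close>

lemma AE_lborel_vec_nth:
  fixes j :: "'m::finite"
  assumes "AE x in (lborel :: 'a::euclidean_space measure). P x"
  shows "AE y in (lborel :: ('a^'m) measure). P (y $ j)"
proof -
  obtain N where N: "{x. \<not> P x} \<subseteq> N" "N \<in> null_sets lborel"
    using assms by (auto simp: eventually_ae_filter)
  then have [measurable]: "N \<in> sets borel" by auto
  let ?f = "\<lambda>i x. if i = j then indicator N x else (1::ennreal)"
  have "emeasure lborel {y :: 'a^'m. y $ j \<in> N} = (\<integral>\<^sup>+ y. indicator {y :: 'a^'m. y $ j \<in> N} y \<partial>lborel)"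
    by (subst nn_integral_indicator) auto
  also have "\<dots> = (\<integral>\<^sup>+ y. (\<Prod>i\<in>UNIV. ?f i (y $ i)) \<partial>(lborel :: ('a^'m) measure))"
  proof (rule nn_integral_cong)
    fix y :: "'a^'m"
    have "(\<Prod>i\<in>UNIV. ?f i (y $ i)) = ?f j (y $ j)"
      by (subst prod.remove[of UNIV j]) auto
    then show "indicator {y :: 'a^'m. y $ j \<in> N} y = (\<Prod>i\<in>UNIV. ?f i (y $ i))"
      by (simp add: indicator_def)
  qed
  also have "\<dots> = (\<Prod>i\<in>UNIV. \<integral>\<^sup>+ x. ?f i x \<partial>lborel)"
    by (rule nn_integral_vec_prod) auto
  also have "\<dots> = 0"
    using N by (intro prod_zero bexI[of _ j]) (auto simp: null_setsD1)
  finally have "{y :: 'a^'m. y $ j \<in> N} \<in> null_sets lborel"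
    by (intro null_setsI) auto
  then show ?thesis
    by (rule AE_I') (use N in auto)
qed

section \<open>Integrals against a kernel that satisfies the size condition\<close>

text \<open>
  A direct instance of \<open>hedberg_estimate\<close> with \<open>b = n\<close>, where \<open>D = \<rho>\<^sup>n\<close> and \<open>G = \<rho>\<^bsup>-n\<^esup>\<close> encode that the
  means of the indicator are at most 1 and that its integral is a multiple of \<open>\<rho>\<^sup>n\<close>.
\<close>

lemma riesz_potential_indicator_ball:
  fixes a :: real
  assumes a: "0 < a" "a < DIM('a)"
  obtains C where "0 \<le> C"
    "\<And>(x :: 'a::euclidean_space) \<rho>. 0 < \<rho> \<Longrightarrow> riesz_potential a (indicator (ball x \<rho>)) x \<le> ennreal (C * \<rho> powr a)"
proof -
  let ?n = "real (DIM('a))"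
  define C where "C = 2 powr (?n - a) * unit_ball_vol ?n * (1 / (1 - 2 powr - a) + 1 / (1 - 2 powr (a - ?n)))"
  have le: "2 powr - a < (1::real)" "2 powr (a - ?n) < (1::real)"
    using a powr_less_cancel_iff[of 2 "- a" 0] powr_less_cancel_iff[of 2 "a - ?n" 0] by auto
  then have C: "0 \<le> C" unfolding C_def by (intro mult_nonneg_nonneg add_nonneg_nonneg) auto
  have "riesz_potential a (indicator (ball x \<rho>)) x \<le> ennreal (C * \<rho> powr a)" if \<rho>: "0 < \<rho>" for x :: 'a and \<rho>
  proof -
    have n: "0 < ?n" by simp
    have unit_ball: "unit_ball_vol ?n \<noteq> 0"
      using unit_ball_vol_pos[of ?n] by (metis less_irrefl of_nat_0_le_iff)
    have "riesz_potential a (indicator (ball x \<rho>)) x \<le> ennreal (C * \<rho> powr ?n) * epow (ennreal (\<rho> powr (- ?n))) (1 - a / ?n)"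
      unfolding C_def
    proof (rule hedberg_estimate)
      fix k :: int
      have "ball_mean (2 powr real_of_int k) (indicator (ball x \<rho>)) x \<le> 1"
        by (intro ball_mean_const_le) (auto simp: indicator_def)
      then show "ball_mean (2 powr real_of_int k) (indicator (ball x \<rho>)) x \<le> ennreal (\<rho> powr ?n) * ennreal (\<rho> powr (- ?n))"
        using \<rho> by (simp flip: ennreal_mult powr_add)
      have "(\<integral>\<^sup>+ y. indicator (ball x \<rho>) y \<partial>lborel) \<le> ennreal (unit_ball_vol ?n * \<rho> powr ?n)"
        using \<rho> by (simp add: emeasure_ball powr_realpow)
      from ball_mean_le_integral[OF this, of k x]
      show "ball_mean (2 powr real_of_int k) (indicator (ball x \<rho>)) x \<le> ennreal (\<rho> powr ?n * 2 powr (- ?n * real_of_int k))"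
        by (simp add: unit_ball)
    qed (use a in auto)
    also have "\<dots> = ennreal (C * (\<rho> powr ?n * \<rho> powr (a - ?n)))"
    proof -
      have "(\<rho> powr (- ?n)) powr (1 - a / ?n) = \<rho> powr (a - ?n)"
      proof -
        have "- ?n * (1 - a / ?n) = a - ?n" using n by (simp add: right_diff_distrib)
        then show ?thesis by (simp only: powr_powr)
      qed
      then show ?thesis using C by (simp add: mult_ac flip: ennreal_mult)
    qed
    also have "\<rho> powr ?n * \<rho> powr (a - ?n) = \<rho> powr a" by (simp flip: powr_add)
    finally show ?thesis .
  qed
  with C that show ?thesis by blast
qed

lemma complex_borel_version:
  fixes f :: "'a::euclidean_space \<Rightarrow> complex"
  assumes "f \<in> borel_measurable lebesgue"
  obtains g where "g \<in> borel_measurable borel" "AE x in lborel. f x = g x"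
proof -
  have "(\<lambda>x. Re (f x)) \<in> borel_measurable lebesgue" "(\<lambda>x. Im (f x)) \<in> borel_measurable lebesgue"
    using assms by measurable
  then obtain u w where "u \<in> borel_measurable lborel" "AE x in lborel. Re (f x) = u x"
      and "w \<in> borel_measurable lborel" "AE x in lborel. Im (f x) = w x"
    using completion_ex_borel_measurable_real[of _ lborel] by metis
  then have [measurable]: "u \<in> borel_measurable borel" "w \<in> borel_measurable borel"
     and "AE x in lborel. f x = Complex (u x) (w x)"
    by (auto elim!: eventually_elim2 simp: complex_eq_iff)
  moreover have "(\<lambda>x. Complex (u x) (w x)) = (\<lambda>x. complex_of_real (u x) + \<i> * complex_of_real (w x))"
    by (simp add: fun_eq_iff complex_eq_iff)
  then have "(\<lambda>x. Complex (u x) (w x)) \<in> borel_measurable borel"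
    by simp
  ultimately show ?thesis using that by blast
qed

lemma riesz_potential_cong_AE:
  assumes "AE y in lborel. f y = g y"
  shows "riesz_potential a f x = riesz_potential a g x"
  unfolding riesz_potential_def
  by (rule nn_integral_cong_AE) (use assms in \<open>auto elim!: eventually_mono\<close>)

lemma riesz_potential_mono:
  assumes "\<And>y. f y \<le> g y"
  shows "riesz_potential a f x \<le> riesz_potential a g x"
  unfolding riesz_potential_def by (intro nn_integral_mono mult_right_mono assms) auto

lemma open_off_diagonal: "open (off_diagonal :: ((real^'n) \<times> ((real^'n)^'m::finite)) set)"
proof -
  have *: "(off_diagonal :: ((real^'n) \<times> ((real^'n)^'m)) set) = (\<Union>j. {z :: (real^'n) \<times> ((real^'n)^'m). snd z $ j \<noteq> fst z})"
    by (auto simp: off_diagonal_def)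
  show ?thesis
    unfolding * by (intro open_UN ballI open_Collect_neq continuous_intros)
qed

definition kernel_integral ::
    "(real^'n \<Rightarrow> (real^'n)^'m \<Rightarrow> complex) \<Rightarrow> ('m::finite \<Rightarrow> real^'n \<Rightarrow> complex) \<Rightarrow> real^'n \<Rightarrow> complex" where
  "kernel_integral K f x = (LINT y|lebesgue. K x y * (\<Prod>j\<in>UNIV. f j (y $ j)))"

locale dominated_kernel =
  fixes K :: "real^'n::finite \<Rightarrow> (real^'n)^'m::finite \<Rightarrow> complex" and A :: real and as :: "'m \<Rightarrow> real"
  assumes A: "0 < A" and as: "\<And>j. 0 < as j \<and> as j < real CARD('n)"
    and size: "\<And>x y. (x, y) \<in> off_diagonal \<Longrightarrow>
       cmod (K x y) \<le> A * (\<Sum>j\<in>UNIV. norm (x - y $ j)) powr (- (real CARD('m) * real CARD('n) - sum as UNIV))"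
    and local_integrable: "\<And>S. compact S \<Longrightarrow> S \<subseteq> off_diagonal \<Longrightarrow> set_integrable lebesgue S (\<lambda>(x, y). K x y)"
begin

text \<open>
  Local integrability on compact sets makes the kernel Lebesgue measurable on the off-diagonal set,
  which is a countable union of compact sets. A Borel version on the product space is needed for
  Fubini arguments; for fixed \<open>x\<close> the diagonal is a single point and does not matter.
\<close>

lemma kernel_borel_version:
  obtains K0 :: "(real^'n) \<times> ((real^'n)^'m) \<Rightarrow> complex"
  where "K0 \<in> borel_measurable borel" "AE x in lborel. AE y in lborel. K x y = K0 (x, y)"
proof -
  let ?O = "off_diagonal :: ((real^'n) \<times> ((real^'n)^'m)) set"
  define k where "k z = indicator ?O z *\<^sub>R K (fst z) (snd z)" for z
  obtain C where C: "\<And>i. compact (C i)" "\<And>i. C i \<subseteq> ?O" "\<And>i::nat. C i \<subseteq> interior (C (Suc i))" "\<Union>(range C) = ?O"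
    using open_Union_compact_subsets[OF open_off_diagonal] by metis
  have meas: "(\<lambda>z. indicator (C i) z *\<^sub>R K (fst z) (snd z)) \<in> borel_measurable lebesgue" for i
    using local_integrable[OF C(1,2), of i] unfolding set_integrable_def
    by (auto simp: split_beta' dest: borel_measurable_integrable)
  have mono: "C i \<subseteq> C j" if "i \<le> j" for i j
    using that by (rule lift_Suc_mono_le[rotated]) (use C(3) interior_subset in blast)
  have "(\<lambda>i. indicator (C i) z *\<^sub>R K (fst z) (snd z)) \<longlonglongrightarrow> k z" for z
  proof (cases "z \<in> ?O")
    case True
    then obtain i where "z \<in> C i" using C(4) by blast
    then have "\<forall>\<^sub>F j in sequentially. indicator (C j) z *\<^sub>R K (fst z) (snd z) = k z"
      using mono True by (intro eventually_sequentiallyI[of i]) (auto simp: k_def indicator_def)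
    then show ?thesis by (rule tendsto_eventually)
  next
    case False
    then have "z \<notin> C i" for i using C(2) by blast
    then show ?thesis using False by (simp add: k_def)
  qed
  then have "k \<in> borel_measurable lebesgue"
    by (rule borel_measurable_LIMSEQ_metric[OF meas])
  then obtain K0 where K0: "K0 \<in> borel_measurable borel" "AE z in lborel. k z = K0 z"
    by (rule complex_borel_version)
  have "AE z in lborel \<Otimes>\<^sub>M lborel. k z = K0 z"
    unfolding lborel_prod by (rule K0(2))
  then have k1: "AE x in lborel. AE y in lborel. k (x, y) = K0 (x, y)"
    by (rule lborel_pair.AE_pair)
  have k2: "AE y in lborel. k (x, y) = K x y" for x
    using AE_lborel_singleton[of "\<chi> j. x"]
    by eventually_elim (auto simp: k_def off_diagonal_def indicator_def vec_eq_iff)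
  have "AE x in lborel. AE y in lborel. K x y = K0 (x, y)"
    using k1
  proof eventually_elim
    case (elim x)
    then show ?case using k2[of x] by eventually_elim simp
  qed
  with K0(1) that show ?thesis by blast
qed

lemma AE_vec_all:
  fixes P :: "'m \<Rightarrow> real^'n \<Rightarrow> bool"
  assumes "\<And>j. AE x in lborel. P j x"
  shows "AE y in (lborel :: ((real^'n)^'m) measure). \<forall>j. P j (y $ j)"
proof -
  have "AE y in (lborel :: ((real^'n)^'m) measure). \<forall>j\<in>UNIV. P j (y $ j)"
    by (intro AE_finite_allI AE_lborel_vec_nth assms) auto
  then show ?thesis by simp
qed

lemma integrand_borel_version:
  assumes f: "\<And>j. f j \<in> borel_measurable lebesgue"
  obtains G :: "(real^'n) \<times> ((real^'n)^'m) \<Rightarrow> complex"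
  where "G \<in> borel_measurable borel"
    "AE x in lborel. AE y in lborel. K x y * (\<Prod>j\<in>UNIV. f j (y $ j)) = G (x, y)"
proof -
  obtain K0 where [measurable]: "K0 \<in> borel_measurable borel" and K0: "AE x in lborel. AE y in lborel. K x y = K0 (x, y)"
    by (rule kernel_borel_version)
  have "\<exists>g. g \<in> borel_measurable borel \<and> (AE x in lborel. f j x = g x)" for j
    using complex_borel_version[OF f[of j]] by metis
  then obtain g where g [measurable]: "\<And>j. g j \<in> borel_measurable borel" and fg: "\<And>j. AE x in lborel. f j x = g j x"
    by metis
  have m: "(\<lambda>z :: (real^'n) \<times> ((real^'n)^'m). g j (snd z $ j)) \<in> borel_measurable borel" for j
  proof -
    have "(\<lambda>z :: (real^'n) \<times> ((real^'n)^'m). snd z $ j) \<in> borel_measurable borel"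
      by (intro borel_measurable_continuous_onI continuous_intros)
    then show ?thesis by measurable
  qed
  show ?thesis
  proof (rule that[of "\<lambda>z. K0 z * (\<Prod>j\<in>UNIV. g j (snd z $ j))"])
    show "(\<lambda>z. K0 z * (\<Prod>j\<in>UNIV. g j (snd z $ j))) \<in> borel_measurable borel"
      using m by measurable
    have ae: "AE y in (lborel :: ((real^'n)^'m) measure). \<forall>j. f j (y $ j) = g j (y $ j)"
      by (rule AE_vec_all[OF fg])
    show "AE x in lborel. AE y in lborel. K x y * (\<Prod>j\<in>UNIV. f j (y $ j)) = K0 (x, y) * (\<Prod>j\<in>UNIV. g j (snd (x, y) $ j))"
      using K0
    proof eventually_elim
      case (elim x)
      then show ?case using ae by eventually_elim simp
    qed
  qed
qed

lemma integrand_measurable: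
  assumes f: "\<And>j. f j \<in> borel_measurable lebesgue"
  shows "AE x in lebesgue. (\<lambda>y. K x y * (\<Prod>j\<in>UNIV. f j (y $ j))) \<in> borel_measurable lebesgue"
proof -
  obtain G where [measurable]: "G \<in> borel_measurable borel"
      and G: "AE x in lborel. AE y in lborel. K x y * (\<Prod>j\<in>UNIV. f j (y $ j)) = G (x, y)"
    using integrand_borel_version[of f, OF f] .
  have "AE x in lborel. (\<lambda>y. K x y * (\<Prod>j\<in>UNIV. f j (y $ j))) \<in> borel_measurable lebesgue"
    using G
  proof eventually_elim
    case (elim x)
    then have "AE y in lebesgue. G (x, y) = K x y * (\<Prod>j\<in>UNIV. f j (y $ j))"
      by (intro AE_completion) (auto elim!: eventually_mono)
    moreover have "(\<lambda>y. G (x, y)) \<in> borel_measurable lebesgue"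
      by (intro measurable_completion) measurable
    ultimately show ?case by (rule borel_measurable_AE[rotated])
  qed
  then show ?thesis by (rule AE_completion)
qed

lemma measurable_kernel_integral:
  assumes f: "\<And>j. f j \<in> borel_measurable lebesgue"
  shows "kernel_integral K f \<in> borel_measurable lebesgue"
proof -
  obtain G where [measurable]: "G \<in> borel_measurable borel"
      and G: "AE x in lborel. AE y in lborel. K x y * (\<Prod>j\<in>UNIV. f j (y $ j)) = G (x, y)"
    using integrand_borel_version[of f, OF f] .
  have [measurable]: "(\<lambda>x. LINT y|lborel. G (x, y)) \<in> borel_measurable borel"
    using lborel.borel_measurable_lebesgue_integral[of "\<lambda>x y. G (x, y)" borel]
    by (simp add: case_prod_unfold borel_prod[symmetric])
  have "AE x in lborel. (LINT y|lborel. G (x, y)) = kernel_integral K f x"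
    using G
  proof eventually_elim
    case (elim x)
    have ae: "AE y in lebesgue. K x y * (\<Prod>j\<in>UNIV. f j (y $ j)) = G (x, y)"
      using elim by (rule AE_completion)
    have meas: "(\<lambda>y. G (x, y)) \<in> borel_measurable lebesgue"
      by (intro measurable_completion) measurable
    have "kernel_integral K f x = (LINT y|lebesgue. G (x, y))"
      unfolding kernel_integral_def
    proof (rule integral_cong_AE)
      show "(\<lambda>y. K x y * (\<Prod>j\<in>UNIV. f j (y $ j))) \<in> borel_measurable lebesgue"
        by (rule borel_measurable_AE[OF meas]) (use ae in \<open>auto elim!: eventually_mono\<close>)
    qed (use ae meas in auto)
    also have "\<dots> = (LINT y|lborel. G (x, y))"
      by (rule integral_completion) measurable
    finally show ?case by simp
  qed
  then have "AE x in lebesgue. (LINT y|lborel. G (x, y)) = kernel_integral K f x"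
    by (rule AE_completion)
  moreover have "(\<lambda>x. LINT y|lborel. G (x, y)) \<in> borel_measurable lebesgue"
    by (intro measurable_completion) measurable
  ultimately show ?thesis by (rule borel_measurable_AE[rotated])
qed

definition potential_bound :: "('m \<Rightarrow> real^'n \<Rightarrow> complex) \<Rightarrow> real^'n \<Rightarrow> ennreal" where
  "potential_bound f x = ennreal A * (\<Prod>j\<in>UNIV. riesz_potential (as j) (\<lambda>y. ennreal (cmod (f j y))) x)"

text \<open>
  The total exponent \<open>mn - \<Sum>\<^sub>j as j\<close> is distributed over the factors, and each factor is
  estimated by \<open>|x - y\<^sub>j| \<le> \<Sum>\<^sub>j |x - y\<^sub>j|\<close> with a negative exponent. No \<open>y\<^sub>j\<close> may equal \<open>x\<close>
  because \<open>0 powr c = 0\<close>.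
\<close>

lemma kernel_le_product:
  assumes "\<And>j. y $ j \<noteq> x"
  shows "cmod (K x y) \<le> A * (\<Prod>j\<in>UNIV. norm (x - y $ j) powr (as j - real CARD('n)))"
proof -
  let ?S = "\<Sum>j\<in>UNIV. norm (x - y $ j)"
  have pos: "0 < norm (x - y $ j)" "norm (x - y $ j) \<le> ?S" for j
    using assms[of j] by (auto intro: member_le_sum)
  then have S: "0 < ?S" by (meson order_less_le_trans)
  have "(x, y) \<in> off_diagonal" using assms by (auto simp: off_diagonal_def)
  then have "cmod (K x y) \<le> A * ?S powr (- (real CARD('m) * real CARD('n) - sum as UNIV))"
    by (rule size)
  also have "- (real CARD('m) * real CARD('n) - sum as UNIV) = (\<Sum>j\<in>UNIV. as j - real CARD('n))"
    by (simp add: sum_subtractf)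
  also have "?S powr (\<Sum>j\<in>UNIV. as j - real CARD('n)) = (\<Prod>j\<in>UNIV. ?S powr (as j - real CARD('n)))"
    using S by (intro powr_sum) auto
  also have "A * \<dots> \<le> A * (\<Prod>j\<in>UNIV. norm (x - y $ j) powr (as j - real CARD('n)))"
    using A pos as by (intro mult_left_mono prod_mono conjI powr_mono2') (auto simp: less_imp_le)
  finally show ?thesis .
qed

lemma nn_integral_integrand_le:
  assumes f: "\<And>j. f j \<in> borel_measurable lebesgue"
  shows "(\<integral>\<^sup>+ y. ennreal (cmod (K x y * (\<Prod>j\<in>UNIV. f j (y $ j)))) \<partial>lebesgue) \<le> potential_bound f x"
proof -
  have "\<exists>g. g \<in> borel_measurable borel \<and> (AE x in lborel. f j x = g x)" for j
    using complex_borel_version[OF f[of j]] by metis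
  then obtain g where g [measurable]: "\<And>j. g j \<in> borel_measurable borel" and fg: "\<And>j. AE x in lborel. f j x = g j x"
    by metis
  have "AE y in lborel. f j y = g j y \<and> y \<noteq> x" for j
    using fg[of j] AE_lborel_singleton[of x] by eventually_elim auto
  then have ae: "AE y in (lborel :: ((real^'n)^'m) measure). \<forall>j. f j (y $ j) = g j (y $ j) \<and> y $ j \<noteq> x"
    by (rule AE_vec_all)
  let ?h = "\<lambda>j y. ennreal (cmod (g j y)) * ennreal (norm (x - y) powr (as j - real CARD('n)))"
  have "(\<integral>\<^sup>+ y. ennreal (cmod (K x y * (\<Prod>j\<in>UNIV. f j (y $ j)))) \<partial>lebesgue) =
      (\<integral>\<^sup>+ y. ennreal (cmod (K x y * (\<Prod>j\<in>UNIV. f j (y $ j)))) \<partial>lborel)"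
    by (rule nn_integral_completion)
  also have "\<dots> \<le> (\<integral>\<^sup>+ y. ennreal A * (\<Prod>j\<in>UNIV. ?h j (y $ j)) \<partial>lborel)"
  proof (rule nn_integral_mono_AE, use ae in eventually_elim)
    case (elim y)
    have "cmod (K x y * (\<Prod>j\<in>UNIV. f j (y $ j))) = cmod (K x y) * (\<Prod>j\<in>UNIV. cmod (g j (y $ j)))"
      using elim by (simp add: norm_mult prod_norm)
    also have "\<dots> \<le> (A * (\<Prod>j\<in>UNIV. norm (x - y $ j) powr (as j - real CARD('n)))) * (\<Prod>j\<in>UNIV. cmod (g j (y $ j)))"
      using elim by (intro mult_right_mono kernel_le_product prod_nonneg) auto
    also have "\<dots> = A * (\<Prod>j\<in>UNIV. cmod (g j (y $ j)) * norm (x - y $ j) powr (as j - real CARD('n)))"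
      by (simp add: prod.distrib mult_ac)
    finally have "ennreal (cmod (K x y * (\<Prod>j\<in>UNIV. f j (y $ j)))) \<le> ennreal (\<dots>)"
      by (rule ennreal_leI)
    also have "\<dots> = ennreal A * (\<Prod>j\<in>UNIV. ?h j (y $ j))"
      using A by (subst ennreal_mult) (auto intro!: prod_nonneg simp: prod_ennreal ennreal_mult[symmetric])
    finally show ?case .
  qed
  also have "\<dots> = ennreal A * (\<integral>\<^sup>+ y. (\<Prod>j\<in>UNIV. ?h j (y $ j)) \<partial>lborel)"
    by (rule nn_integral_cmult) measurable
  also have "(\<integral>\<^sup>+ y. (\<Prod>j\<in>UNIV. ?h j (y $ j)) \<partial>lborel) = (\<Prod>j\<in>UNIV. \<integral>\<^sup>+ y. ?h j y \<partial>lborel)"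
    by (rule nn_integral_vec_prod) measurable
  also have "(\<lambda>j. \<integral>\<^sup>+ y. ?h j y \<partial>lborel) = (\<lambda>j. riesz_potential (as j) (\<lambda>y. ennreal (cmod (f j y))) x)"
  proof
    fix j
    have "AE y in lborel. ennreal (cmod (f j y)) = ennreal (cmod (g j y))"
      using fg[of j] by eventually_elim simp
    then show "(\<integral>\<^sup>+ y. ?h j y \<partial>lborel) = riesz_potential (as j) (\<lambda>y. ennreal (cmod (f j y))) x"
      by (subst riesz_potential_cong_AE) (auto simp: riesz_potential_def)
  qed
  finally show ?thesis
    unfolding potential_bound_def .
qed

lemma kernel_integral_le:
  assumes f: "\<And>j. f j \<in> borel_measurable lebesgue"
  shows "ennreal (cmod (kernel_integral K f x)) \<le> potential_bound f x"
proof (cases "integrable lebesgue (\<lambda>y. K x y * (\<Prod>j\<in>UNIV. f j (y $ j)))")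
  case True
  then have "ennreal (cmod (kernel_integral K f x)) \<le> (\<integral>\<^sup>+ y. ennreal (cmod (K x y * (\<Prod>j\<in>UNIV. f j (y $ j)))) \<partial>lebesgue)"
    unfolding kernel_integral_def by (rule integral_norm_bound_ennreal)
  also have "\<dots> \<le> potential_bound f x" by (rule nn_integral_integrand_le[OF f])
  finally show ?thesis .
next
  case False
  then show ?thesis by (simp add: kernel_integral_def not_integrable_integral_eq)
qed

lemma integrand_integrable:
  assumes f: "\<And>j. f j \<in> borel_measurable lebesgue" and fin: "AE x in lebesgue. potential_bound f x < top"
  shows "AE x in lebesgue. integrable lebesgue (\<lambda>y. K x y * (\<Prod>j\<in>UNIV. f j (y $ j)))"
  using integrand_measurable[of f, OF f] fin
proof eventually_elim
  case (elim x)
  then show ?case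
    using nn_integral_integrand_le[of f x, OF f] by (simp add: integrable_iff_bounded order_le_less_trans)
qed

lemma kernel_integral_multilinear:
  assumes X: "\<And>j g. g \<in> X j \<Longrightarrow> g \<in> borel_measurable lebesgue"
    and fin: "\<And>f. (\<forall>j. f j \<in> X j) \<Longrightarrow> AE x in lebesgue. potential_bound f x < top"
  shows "multilinear_ae X (kernel_integral K)"
  unfolding multilinear_ae_def
proof (intro allI impI conjI ballI)
  fix f :: "'m \<Rightarrow> real^'n \<Rightarrow> complex" and j g
  assume f: "\<forall>i. f i \<in> X i" and g: "g \<in> X j"
  have split: "(\<Prod>i\<in>UNIV. (f(j := h)) i (y $ i)) = h (y $ j) * (\<Prod>i\<in>UNIV - {j}. f i (y $ i))" for h and y :: "(real^'n)^'m"
    by (subst prod.remove[of UNIV j]) (auto intro!: arg_cong2[where f="(*)"] prod.cong)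
  have split0: "(\<Prod>i\<in>UNIV. f i (y $ i)) = f j (y $ j) * (\<Prod>i\<in>UNIV - {j}. f i (y $ i))" for y :: "(real^'n)^'m"
    by (rule prod.remove) auto
  have fg: "\<forall>i. (f(j := g)) i \<in> X i" using f g by auto
  have 1: "AE x in lebesgue. integrable lebesgue (\<lambda>y. K x y * (\<Prod>i\<in>UNIV. f i (y $ i)))"
    using f X fin by (intro integrand_integrable) blast+
  have 2: "AE x in lebesgue. integrable lebesgue (\<lambda>y. K x y * (\<Prod>i\<in>UNIV. (f(j := g)) i (y $ i)))"
    using X fg fin[OF fg] by (intro integrand_integrable) blast+
  from 1 2 show "AE x in lebesgue. kernel_integral K (f(j := (\<lambda>x. f j x + g x))) x = kernel_integral K f x + kernel_integral K (f(j := g)) x"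
  proof eventually_elim
    case (elim x)
    have "(\<lambda>y. K x y * (\<Prod>i\<in>UNIV. (f(j := (\<lambda>x. f j x + g x))) i (y $ i))) =
       (\<lambda>y. K x y * (\<Prod>i\<in>UNIV. f i (y $ i)) + K x y * (\<Prod>i\<in>UNIV. (f(j := g)) i (y $ i)))"
      by (simp only: split split0) (simp add: algebra_simps)
    then show ?case
      unfolding kernel_integral_def using Bochner_Integration.integral_add[OF elim] by simp
  qed
next
  fix f :: "'m \<Rightarrow> real^'n \<Rightarrow> complex" and j c
  have split: "(\<Prod>i\<in>UNIV. (f(j := h)) i (y $ i)) = h (y $ j) * (\<Prod>i\<in>UNIV - {j}. f i (y $ i))" for h and y :: "(real^'n)^'m"
    by (subst prod.remove[of UNIV j]) (auto intro!: arg_cong2[where f="(*)"] prod.cong)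
  have split0: "(\<Prod>i\<in>UNIV. f i (y $ i)) = f j (y $ j) * (\<Prod>i\<in>UNIV - {j}. f i (y $ i))" for y :: "(real^'n)^'m"
    by (rule prod.remove) auto
  have "(\<lambda>y. K x y * (\<Prod>i\<in>UNIV. (f(j := (\<lambda>x. c * f j x))) i (y $ i))) = (\<lambda>y. c * (K x y * (\<Prod>i\<in>UNIV. f i (y $ i))))" for x
    by (simp only: split split0) (simp add: algebra_simps)
  then show "AE x in lebesgue. kernel_integral K (f(j := (\<lambda>x. c * f j x))) x = c * kernel_integral K f x"
    unfolding kernel_integral_def by simp
qed

end

section \<open>The operator is integration against its kernel\<close>

definition restrict_to :: "'a set \<Rightarrow> ('a \<Rightarrow> 'b::zero) \<Rightarrow> 'a \<Rightarrow> 'b" where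
  "restrict_to U f = (\<lambda>x. if x \<in> U then f x else 0)"

lemma bounded_compact_suppD:
  assumes "f \<in> bounded_compact_supp"
  obtains M R where "0 \<le> M" "0 < R" "\<And>y. cmod (f y) \<le> M" "\<And>y. f y \<noteq> 0 \<Longrightarrow> norm y < R"
proof -
  obtain M where M: "\<And>y. cmod (f y) \<le> M"
    using assms by (auto simp: bounded_compact_supp_def bounded_iff)
  have "bounded (fun_supp f)"
    using assms by (auto simp: bounded_compact_supp_def intro: compact_imp_bounded)
  then obtain R where R: "0 < R" "\<And>y. y \<in> fun_supp f \<Longrightarrow> norm y < R"
    unfolding bounded_pos_less by auto
  have supp: "y \<in> fun_supp f" if "f y \<noteq> 0" for y
    using that closure_subset[of "{x. f x \<noteq> 0}"] by (auto simp: fun_supp_def)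
  show ?thesis
  proof (rule that[of M R])
    show "0 \<le> M" using order_trans[OF norm_ge_zero M] .
  qed (use M R supp in auto)
qed

lemma bounded_compact_supp_restrict:
  assumes f: "f \<in> bounded_compact_supp" and [measurable]: "U \<in> sets lebesgue"
  shows "restrict_to U f \<in> bounded_compact_supp"
proof -
  have [measurable]: "f \<in> borel_measurable lebesgue" and b: "bounded (range f)" and c: "compact (fun_supp f)"
    using f by (auto simp: bounded_compact_supp_def)
  have "restrict_to U f \<in> borel_measurable lebesgue"
    unfolding restrict_to_def by measurable
  moreover have "bounded (range (restrict_to U f))"
    by (rule bounded_subset[of "insert 0 (range f)"]) (use b in \<open>auto simp: restrict_to_def\<close>)
  moreover have "compact (fun_supp (restrict_to U f))"
  proof -
    have "fun_supp (restrict_to U f) \<subseteq> fun_supp f"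
      unfolding fun_supp_def by (intro closure_mono) (auto simp: restrict_to_def)
    then have "fun_supp (restrict_to U f) = fun_supp f \<inter> fun_supp (restrict_to U f)" by auto
    moreover have "closed (fun_supp (restrict_to U f))" by (simp add: fun_supp_def)
    ultimately show ?thesis using compact_Int_closed[OF c] by metis
  qed
  ultimately show ?thesis by (simp add: bounded_compact_supp_def)
qed

lemma bounded_compact_supp_in_Lp:
  assumes f: "f \<in> bounded_compact_supp" and s: "1 \<le> s"
  shows "f \<in> Lp s"
proof -
  obtain M R where M: "0 \<le> M" "0 < R" "\<And>y. cmod (f y) \<le> M" "\<And>y. f y \<noteq> 0 \<Longrightarrow> norm y < R"
    by (rule bounded_compact_suppD[OF f]) blast
  have [measurable]: "f \<in> borel_measurable lebesgue"
    using f by (auto simp: bounded_compact_supp_def)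
  have "integrable lebesgue (\<lambda>x. cmod (f x) powr s)"
  proof (rule Bochner_Integration.integrable_bound)
    show "integrable lebesgue (\<lambda>x :: real^'a. M powr s * indicator (ball 0 R) x)"
      by (intro integrable_mult_right integrable_real_indicator) (use emeasure_ball_pos(2)[OF M(2)] in \<open>auto simp: less_top\<close>)
    have "cmod (f x) powr s \<le> M powr s * indicator (ball 0 R) x" for x
      using M(3)[of x] M(4)[of x] s by (cases "f x = 0") (auto simp: powr_mono2)
    then show "AE x in lebesgue. norm (cmod (f x) powr s) \<le> norm (M powr s * indicator (ball 0 R) x :: real)"
      by (intro AE_I2) (metis abs_ge_self norm_ge_zero norm_powr_real_powr order_trans powr_ge_zero real_norm_def abs_of_nonneg)
  qed measurable
  then show ?thesis by (simp add: Lp_def)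
qed

lemma Lp_norm_restrict_le:
  assumes f: "f \<in> bounded_compact_supp" and s: "1 \<le> s" and M: "0 \<le> M" "\<And>y. cmod (f y) \<le> M"
    and U: "U \<in> lmeasurable"
  shows "Lp_norm s (restrict_to U f) \<le> M * measure lebesgue U powr (1 / s)"
proof -
  have "restrict_to U f \<in> Lp s"
    using U by (intro bounded_compact_supp_in_Lp bounded_compact_supp_restrict f s) auto
  then have i: "integrable lebesgue (\<lambda>x. cmod (restrict_to U f x) powr s)" by (simp add: Lp_def)
  have "(LINT x|lebesgue. cmod (restrict_to U f x) powr s) \<le> (LINT x|lebesgue. M powr s * indicator U x)"
  proof (rule integral_mono[OF i])
    show "integrable lebesgue (\<lambda>x. M powr s * indicator U x :: real)"
      using U by (intro integrable_mult_right integrable_real_indicator) (auto simp: fmeasurable_def)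
    show "cmod (restrict_to U f x) powr s \<le> M powr s * indicator U x" for x
      using M(2)[of x] s by (auto simp: restrict_to_def powr_mono2)
  qed
  also have "\<dots> = M powr s * measure lebesgue U" using U by simp
  finally have "Lp_norm s (restrict_to U f) \<le> (M powr s * measure lebesgue U) powr (1 / s)"
    unfolding Lp_norm_def using s by (intro powr_mono2) auto
  also have "\<dots> = M * measure lebesgue U powr (1 / s)"
    using M(1) s by (subst powr_mult) (auto simp: powr_powr)
  finally show ?thesis .
qed

lemma Lp_norm_nonneg: "0 \<le> Lp_norm s f"
  by (simp add: Lp_norm_def)

lemma weak_Lp_measure_le:
  assumes f: "f \<in> weak_Lp r" and N: "weak_Lp_norm r f \<le> N" and r: "0 < r" and l: "0 < l"
  shows "emeasure lebesgue {x. l < cmod (f x)} \<le> ennreal ((N / l) powr r)"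
proof -
  let ?m = "measure lebesgue {x. l < cmod (f x)}"
  have "l * ?m powr (1 / r) \<le> weak_Lp_norm r f"
    unfolding weak_Lp_norm_def using f l by (intro cSUP_upper) (auto simp: weak_Lp_def)
  then have "?m powr (1 / r) \<le> N / l"
    using N l by (simp add: field_simps)
  then have "(?m powr (1 / r)) powr r \<le> (N / l) powr r"
    using r by (intro powr_mono2) auto
  then have "?m \<le> (N / l) powr r"
    using r by (simp add: powr_powr)
  moreover have "emeasure lebesgue {x. l < cmod (f x)} = ennreal ?m"
    using f l by (intro emeasure_eq_ennreal_measure) (auto simp: weak_Lp_def less_top)
  ultimately show ?thesis by (simp add: ennreal_leI)
qed

text \<open>
  Round \<open>k x\<close> down in every coordinate: each of the \<open>n\<close> coordinates of \<open>x\<close> differs by at most \<open>1/k\<close>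
  from that of the grid point.
\<close>

lemma grid_ball_cover:
  fixes x :: "real^'n::finite" and k R :: nat
  assumes k: "0 < k" and x: "\<And>i. \<bar>x $ i\<bar> \<le> real R"
  shows "\<exists>c\<in>PiE UNIV (\<lambda>_. {- int (R * k)..int (R * k)}).
     x \<in> ball (\<chi> i. real_of_int (c i) / real k) ((real CARD('n) + 1) / real k)"
proof (intro bexI)
  define c where "c i = \<lfloor>real k * x $ i\<rfloor>" for i
  show "c \<in> PiE UNIV (\<lambda>_. {- int (R * k)..int (R * k)})"
  proof (rule PiE_I)
    fix i
    have "real k * \<bar>x $ i\<bar> \<le> real k * real R" using x[of i] by (intro mult_left_mono) auto
    then have "\<bar>real k * x $ i\<bar> \<le> real R * real k" by (simp add: abs_mult mult.commute)
    then have "- (real R * real k) \<le> real k * x $ i" "real k * x $ i \<le> real R * real k" by linarith+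
    then show "c i \<in> {- int (R * k)..int (R * k)}"
      unfolding c_def by (auto simp: le_floor_iff floor_le_iff)
  qed simp
  have "norm (x - (\<chi> i. real_of_int (c i) / real k)) \<le> (\<Sum>i\<in>UNIV. \<bar>(x - (\<chi> i. real_of_int (c i) / real k)) $ i\<bar>)"
    by (rule norm_le_l1_cart)
  also have "\<dots> \<le> (\<Sum>i\<in>(UNIV :: 'n set). 1 / real k)"
  proof (rule sum_mono)
    fix i
    have "\<bar>real k * x $ i - real_of_int (c i)\<bar> \<le> 1" unfolding c_def by linarith
    moreover have "real k * x $ i - real_of_int (c i) = real k * (x $ i - real_of_int (c i) / real k)"
      using k by (simp add: field_simps)
    ultimately have "real k * \<bar>x $ i - real_of_int (c i) / real k\<bar> \<le> 1"
      by (simp add: abs_mult)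
    then show "\<bar>(x - (\<chi> i. real_of_int (c i) / real k)) $ i\<bar> \<le> 1 / real k"
      using k by (simp add: field_simps)
  qed
  also have "\<dots> < (real CARD('n) + 1) / real k" using k by (simp add: field_simps)
  finally show "x \<in> ball (\<chi> i. real_of_int (c i) / real k) ((real CARD('n) + 1) / real k)"
    by (simp add: dist_norm norm_minus_commute)
qed

context dominated_kernel
begin

lemma riesz_potential_bounded_le:
  fixes j :: 'm
  obtains C where "0 \<le> C"
    "\<And>(f :: real^'n \<Rightarrow> complex) x M \<rho>. 0 < \<rho> \<Longrightarrow> 0 \<le> M \<Longrightarrow> (\<And>y. cmod (f y) \<le> M * indicator (ball x \<rho>) y) \<Longrightarrow>
      riesz_potential (as j) (\<lambda>y. ennreal (cmod (f y))) x \<le> ennreal (M * (C * \<rho> powr as j))"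
proof -
  have "0 < as j" "as j < DIM(real^'n)" using as[of j] by auto
  then obtain C where C: "0 \<le> C" "\<And>(x :: real^'n) \<rho>. 0 < \<rho> \<Longrightarrow> riesz_potential (as j) (indicator (ball x \<rho>)) x \<le> ennreal (C * \<rho> powr as j)"
    using riesz_potential_indicator_ball by blast
  have "riesz_potential (as j) (\<lambda>y. ennreal (cmod (f y))) x \<le> ennreal (M * (C * \<rho> powr as j))"
    if r: "0 < \<rho>" and M: "0 \<le> M" and f: "\<And>y. cmod (f y) \<le> M * indicator (ball x \<rho>) y" for f :: "real^'n \<Rightarrow> complex" and x M \<rho>
  proof -
    have "riesz_potential (as j) (\<lambda>y. ennreal (cmod (f y))) x \<le> riesz_potential (as j) (\<lambda>y. ennreal M * indicator (ball x \<rho>) y) x"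
    proof (rule riesz_potential_mono)
      fix y
      have "ennreal (cmod (f y)) \<le> ennreal (M * indicator (ball x \<rho>) y)" by (rule ennreal_leI[OF f])
      then show "ennreal (cmod (f y)) \<le> ennreal M * indicator (ball x \<rho>) y"
        using M by (simp add: ennreal_mult ennreal_indicator)
    qed
    also have "\<dots> = ennreal M * riesz_potential (as j) (indicator (ball x \<rho>)) x"
      unfolding riesz_potential_def mult.assoc by (rule nn_integral_cmult) measurable
    also have "\<dots> \<le> ennreal M * ennreal (C * \<rho> powr as j)"
      by (intro mult_left_mono C(2) r) auto
    also have "\<dots> = ennreal (M * (C * \<rho> powr as j))"
      using M C(1) by (simp add: ennreal_mult)
    finally show ?thesis .
  qed
  with C(1) that show ?thesis by blast
qed

lemma potential_bound_finite:
  assumes "\<And>j. f j \<in> bounded_compact_supp"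
  shows "potential_bound f x < top"
proof -
  have "riesz_potential (as j) (\<lambda>y. ennreal (cmod (f j y))) x < top" for j
  proof -
    obtain M R where M: "0 \<le> M" "0 < R" "\<And>y. cmod (f j y) \<le> M" "\<And>y. f j y \<noteq> 0 \<Longrightarrow> norm y < R"
      by (rule bounded_compact_suppD[OF assms[of j]]) blast
    obtain C where C: "0 \<le> C"
      "\<And>(f :: real^'n \<Rightarrow> complex) x M \<rho>. 0 < \<rho> \<Longrightarrow> 0 \<le> M \<Longrightarrow> (\<And>y. cmod (f y) \<le> M * indicator (ball x \<rho>) y) \<Longrightarrow>
        riesz_potential (as j) (\<lambda>y. ennreal (cmod (f y))) x \<le> ennreal (M * (C * \<rho> powr as j))"
      by (rule riesz_potential_bounded_le[of j]) blast
    have "cmod (f j y) \<le> M * indicator (ball x (norm x + R)) y" for y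
    proof (cases "f j y = 0")
      case False
      then have "norm (x - y) < norm x + R"
        using M(4)[of y] norm_triangle_ineq4[of x y] by linarith
      then show ?thesis using M(3)[of y] by (simp add: dist_norm)
    qed (use M in \<open>auto simp: indicator_def\<close>)
    then have "riesz_potential (as j) (\<lambda>y. ennreal (cmod (f j y))) x \<le> ennreal (M * (C * (norm x + R) powr as j))"
      using M by (intro C(2)) (auto simp: add_nonneg_pos)
    then show ?thesis using ennreal_less_top order_le_less_trans by blast
  qed
  then have "(\<Prod>j\<in>UNIV. riesz_potential (as j) (\<lambda>y. ennreal (cmod (f j y))) x) \<noteq> top"
    by (simp add: ennreal_prod_eq_top less_top[symmetric])
  then show ?thesis
    unfolding potential_bound_def by (simp add: ennreal_mult_less_top less_top)
qed

lemma kernel_integral_multilinear_compact: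
  "multilinear_ae (\<lambda>_. bounded_compact_supp) (kernel_integral K)"
  by (rule kernel_integral_multilinear)
     (auto simp: bounded_compact_supp_def intro!: AE_I2 potential_bound_finite)

text \<open>
  The function \<open>f j\<close> is the sum of its restrictions to \<open>U\<close> and to the complement of \<open>U\<close>. The second
  one has no support in \<open>U\<close>, so that on \<open>U\<close> the kernel formula applies to the tuple containing it and
  its defect vanishes.
\<close>

lemma defect_restrict_one:
  fixes T :: "('m \<Rightarrow> real^'n \<Rightarrow> complex) \<Rightarrow> real^'n \<Rightarrow> complex"
  assumes formula: "\<And>f. (\<forall>j. f j \<in> bounded_compact_supp) \<Longrightarrow> kernel_formula K T f"
    and T: "multilinear_ae (\<lambda>_. bounded_compact_supp) T"
    and U: "open U" and f: "\<forall>j. f j \<in> bounded_compact_supp"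
  shows "AE x in lebesgue. x \<in> U \<longrightarrow> T f x - kernel_integral K f x =
     T (f(j := restrict_to U (f j))) x - kernel_integral K (f(j := restrict_to U (f j))) x"
proof -
  define f' where "f' = f(j := restrict_to U (f j))"
  define g where "g = restrict_to (- U) (f j)"
  have U': "U \<in> sets lebesgue" "- U \<in> sets lebesgue"
    using U by (auto intro: lebesgue_openin)
  have f': "\<forall>i. f' i \<in> bounded_compact_supp" and g: "g \<in> bounded_compact_supp"
    using f U' by (auto simp: f'_def g_def intro!: bounded_compact_supp_restrict)
  have f'g: "\<forall>i. (f'(j := g)) i \<in> bounded_compact_supp" using f' g by auto
  have eq: "f'(j := (\<lambda>x. f' j x + g x)) = f"
    by (auto simp: f'_def g_def restrict_to_def fun_eq_iff)
  have "AE x in lebesgue. T (f'(j := (\<lambda>x. f' j x + g x))) x = T f' x + T (f'(j := g)) x"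
    using T f' g unfolding multilinear_ae_def by blast
  moreover have "AE x in lebesgue. kernel_integral K (f'(j := (\<lambda>x. f' j x + g x))) x = kernel_integral K f' x + kernel_integral K (f'(j := g)) x"
    using kernel_integral_multilinear_compact f' g unfolding multilinear_ae_def by blast
  moreover have "AE x in lebesgue. x \<notin> (\<Inter>i. fun_supp ((f'(j := g)) i)) \<longrightarrow> T (f'(j := g)) x = kernel_integral K (f'(j := g)) x"
    using formula[OF f'g] unfolding kernel_formula_def kernel_integral_def .
  ultimately show ?thesis
    unfolding eq f'_def[symmetric]
  proof eventually_elim
    case (elim x)
    have "x \<notin> fun_supp g" if "x \<in> U"
    proof -
      have "fun_supp g \<subseteq> - U"
        unfolding fun_supp_def using U by (intro closure_minimal) (auto simp: g_def restrict_to_def)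
      then show ?thesis using that by auto
    qed
    then have "x \<in> U \<Longrightarrow> x \<notin> (\<Inter>i. fun_supp ((f'(j := g)) i))" by (auto intro!: exI[of _ j])
    then show ?case using elim by auto
  qed
qed

lemma defect_restrict:
  fixes T :: "('m \<Rightarrow> real^'n \<Rightarrow> complex) \<Rightarrow> real^'n \<Rightarrow> complex"
  assumes formula: "\<And>f. (\<forall>j. f j \<in> bounded_compact_supp) \<Longrightarrow> kernel_formula K T f"
    and T: "multilinear_ae (\<lambda>_. bounded_compact_supp) T"
    and U: "open U" and f: "\<forall>j. f j \<in> bounded_compact_supp"
  shows "AE x in lebesgue. x \<in> U \<longrightarrow> T f x - kernel_integral K f x =
     T (\<lambda>j. restrict_to U (f j)) x - kernel_integral K (\<lambda>j. restrict_to U (f j)) x"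
proof -
  define F where "F J = (\<lambda>j. if j \<in> J then restrict_to U (f j) else f j)" for J
  have U': "U \<in> sets lebesgue" using U by (auto intro: lebesgue_openin)
  have F: "\<forall>j. F J j \<in> bounded_compact_supp" for J
    using f U' by (auto simp: F_def intro!: bounded_compact_supp_restrict)
  have "AE x in lebesgue. x \<in> U \<longrightarrow> T f x - kernel_integral K f x = T (F J) x - kernel_integral K (F J) x"
    if "finite J" for J
    using that
  proof induction
    case empty
    have "F {} = f" by (simp add: F_def)
    then show ?case by simp
  next
    case (insert j J)
    have "(F J)(j := restrict_to U (F J j)) = F (insert j J)"
      using insert(2) by (auto simp: F_def fun_eq_iff)
    then have "AE x in lebesgue. x \<in> U \<longrightarrow> T (F J) x - kernel_integral K (F J) x = T (F (insert j J)) x - kernel_integral K (F (insert j J)) x"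
      using defect_restrict_one[OF formula T U F, of J j] by simp
    with insert(3) show ?case by eventually_elim auto
  qed
  from this[of UNIV] show ?thesis by (simp add: F_def)
qed

text \<open>
  The defect \<open>W\<close> is estimated on balls \<open>U\<close> of radius \<open>\<rho> k = (n + 1) / k\<close> about the points of the grid
  of mesh \<open>1/k\<close>. On \<open>U\<close> it equals the defect of the tuple cut off to \<open>U\<close>: the integral against the
  kernel contributes at most \<open>\<kappa> k\<close>, which tends to 0, and the operator exceeds \<open>l\<close> only on a set of
  measure \<open>O(k\<^bsup>-n r \<sigma>\<^esup>)\<close> by the weak type bound, where \<open>\<sigma> = \<Sum>\<^sub>j 1 / s j\<close>. A bounded set needs \<open>O(k\<^sup>n)\<close>
  balls and \<open>r \<sigma> > 1\<close>, so that \<open>W\<close> exceeds \<open>2 l\<close> only on a null set.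
\<close>

theorem operator_eq_kernel_integral:
  fixes T :: "('m \<Rightarrow> real^'n \<Rightarrow> complex) \<Rightarrow> real^'n \<Rightarrow> complex" and s :: "'m \<Rightarrow> real" and r B :: real
  assumes formula: "\<And>f. (\<forall>j. f j \<in> bounded_compact_supp) \<Longrightarrow> kernel_formula K T f"
    and T: "multilinear_ae (\<lambda>j. Lp (s j)) T" and s: "\<And>j. 1 \<le> s j"
    and weak: "\<And>f. (\<forall>j. f j \<in> Lp (s j)) \<Longrightarrow> T f \<in> weak_Lp r \<and> weak_Lp_norm r (T f) \<le> B * (\<Prod>j\<in>UNIV. Lp_norm (s j) (f j))"
    and r: "0 < r" and rs: "1 < r * (\<Sum>j\<in>UNIV. 1 / s j)"
    and f: "\<forall>j. f j \<in> bounded_compact_supp"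
  shows "AE x in lebesgue. T f x = kernel_integral K f x"
proof -
  let ?n = "CARD('n)"
  define \<sigma> where "\<sigma> = (\<Sum>j\<in>UNIV. 1 / s j)"
  have T': "multilinear_ae (\<lambda>_. bounded_compact_supp) T"
    using T s bounded_compact_supp_in_Lp unfolding multilinear_ae_def by blast
  have in_Lp: "f j \<in> Lp (s j)" if "\<forall>j. f j \<in> bounded_compact_supp" for f j
    using that s bounded_compact_supp_in_Lp by blast
  define W where "W x = T f x - kernel_integral K f x" for x
  have fL: "f j \<in> borel_measurable lebesgue" for j using f by (simp add: bounded_compact_supp_def)
  have [measurable]: "T f \<in> borel_measurable lebesgue"
    using weak[of f] in_Lp[OF f] by (auto simp: weak_Lp_def)
  have [measurable]: "kernel_integral K f \<in> borel_measurable lebesgue"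
    by (rule measurable_kernel_integral[OF fL])
  have [measurable]: "W \<in> borel_measurable lebesgue" unfolding W_def by measurable
  have "\<exists>M\<ge>0. \<forall>y. cmod (f j y) \<le> M" for j
    using bounded_compact_suppD[of "f j"] f by metis
  then obtain Mj where Mj: "\<And>j. 0 \<le> Mj j" "\<And>j y. cmod (f j y) \<le> Mj j" by metis
  define M where "M = (\<Sum>j\<in>UNIV. Mj j)"
  have M0: "0 \<le> M" unfolding M_def by (intro sum_nonneg Mj)
  have M: "cmod (f j y) \<le> M" for j y
  proof -
    have "Mj j \<le> M" unfolding M_def by (intro member_le_sum Mj) auto
    then show ?thesis using Mj(2)[of j y] by linarith
  qed
  have "\<exists>C\<ge>0. \<forall>(f :: real^'n \<Rightarrow> complex) x M \<rho>. 0 < \<rho> \<longrightarrow> 0 \<le> M \<longrightarrow> (\<forall>y. cmod (f y) \<le> M * indicator (ball x \<rho>) y) \<longrightarrow>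
      riesz_potential (as j) (\<lambda>y. ennreal (cmod (f y))) x \<le> ennreal (M * (C * \<rho> powr as j))" for j
    using riesz_potential_bounded_le[of j] by metis
  then obtain C where C0: "\<And>j. 0 \<le> C j" and C: "\<And>j (f :: real^'n \<Rightarrow> complex) x M \<rho>. 0 < \<rho> \<Longrightarrow> 0 \<le> M \<Longrightarrow> (\<And>y. cmod (f y) \<le> M * indicator (ball x \<rho>) y) \<Longrightarrow>
      riesz_potential (as j) (\<lambda>y. ennreal (cmod (f y))) x \<le> ennreal (M * (C j * \<rho> powr as j))"
    by metis
  define \<rho> where "\<rho> k = (real ?n + 1) / real k" for k :: nat
  have \<rho>: "0 < \<rho> k" if "0 < k" for k using that by (simp add: \<rho>_def add_nonneg_pos)
  \<comment> \<open>For \<open>x\<close> in a ball of radius \<open>\<rho> k\<close>, that ball lies in the one of twice the radius about \<open>x\<close>.\<close>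
  define \<kappa> where "\<kappa> k = A * (\<Prod>j\<in>UNIV. M * (C j * (2 * \<rho> k) powr as j))" for k
  have \<kappa>_lim: "\<kappa> \<longlonglongrightarrow> 0"
  proof -
    have r0: "(\<lambda>k. 2 * \<rho> k) \<longlonglongrightarrow> 0"
      unfolding \<rho>_def using tendsto_mult_right_zero[OF lim_const_over_n[of "real ?n + 1"], of 2] by simp
    have "(\<lambda>k. M * (C j * (2 * \<rho> k) powr as j)) \<longlonglongrightarrow> 0" for j
    proof -
      have "(\<lambda>k. (2 * \<rho> k) powr as j) \<longlonglongrightarrow> 0"
        using as[of j] by (intro tendsto_zero_powrI[OF r0 tendsto_const]) (auto simp: \<rho>_def)
      then show ?thesis by (intro tendsto_mult_right_zero)
    qed
    then have "(\<lambda>k. \<Prod>j\<in>UNIV. M * (C j * (2 * \<rho> k) powr as j)) \<longlonglongrightarrow> (\<Prod>j\<in>(UNIV::'m set). 0)"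
      by (intro tendsto_prod)
    then have "\<kappa> \<longlonglongrightarrow> A * (\<Prod>j\<in>(UNIV::'m set). 0)"
      unfolding \<kappa>_def by (intro tendsto_mult tendsto_const)
    then show ?thesis by (simp add: zero_power)
  qed
  have kernel_small: "cmod (kernel_integral K (\<lambda>j. restrict_to (ball c (\<rho> k)) (f j)) x) \<le> \<kappa> k"
    if "0 < k" "x \<in> ball c (\<rho> k)" for k c x
  proof -
    have "ennreal (cmod (kernel_integral K (\<lambda>j. restrict_to (ball c (\<rho> k)) (f j)) x)) \<le> potential_bound (\<lambda>j. restrict_to (ball c (\<rho> k)) (f j)) x"
    proof (rule kernel_integral_le)
      show "restrict_to (ball c (\<rho> k)) (f j) \<in> borel_measurable lebesgue" for j
        using bounded_compact_supp_restrict[of "f j" "ball c (\<rho> k)"] f by (auto simp: bounded_compact_supp_def)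
    qed
    also have "\<dots> \<le> ennreal A * (\<Prod>j\<in>UNIV. ennreal (M * (C j * (2 * \<rho> k) powr as j)))"
    proof -
      have "riesz_potential (as j) (\<lambda>y. ennreal (cmod (restrict_to (ball c (\<rho> k)) (f j) y))) x \<le>
          ennreal (M * (C j * (2 * \<rho> k) powr as j))" for j
      proof (rule C)
        fix y
        show "cmod (restrict_to (ball c (\<rho> k)) (f j) y) \<le> M * indicator (ball x (2 * \<rho> k)) y"
        proof (cases "y \<in> ball c (\<rho> k)")
          case True
          then have "dist x y < 2 * \<rho> k"
            using that(2) dist_triangle2[of x y c] by (auto simp: dist_commute)
          then show ?thesis using M[of j y] M0 by (simp add: restrict_to_def)
        next
          case False
          then show ?thesis using M0 by (auto simp: restrict_to_def indicator_def)
        qed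
      qed (use \<rho>[OF that(1)] M0 in auto)
      then show ?thesis
        unfolding potential_bound_def by (intro mult_left_mono prod_mono_ennreal) auto
    qed
    also have "\<dots> = ennreal (\<kappa> k)"
      unfolding \<kappa>_def using A M0 C0 by (subst prod_ennreal, simp, subst ennreal_mult) (auto intro!: prod_nonneg)
    finally show ?thesis
      using A M0 C0 by (subst (asm) ennreal_le_iff) (auto simp: \<kappa>_def intro!: mult_nonneg_nonneg prod_nonneg)
  qed
  \<comment> \<open>The sign of \<open>B\<close> is not prescribed, hence the maximum with 0.\<close>
  have T_small: "emeasure lebesgue {x. l < cmod (T (\<lambda>j. restrict_to (ball c (\<rho> k)) (f j)) x)} \<le>
      ennreal ((max B 0 * M ^ CARD('m) * (unit_ball_vol (real ?n) * \<rho> k ^ ?n) powr \<sigma> / l) powr r)"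
    if "0 < k" "0 < l" for k c l
  proof -
    let ?f = "\<lambda>j. restrict_to (ball c (\<rho> k)) (f j)"
    have fb: "\<forall>j. ?f j \<in> bounded_compact_supp"
      using f by (auto intro!: bounded_compact_supp_restrict)
    note w = weak[of ?f] in_Lp[OF fb]
    have mb: "measure lebesgue (ball c (\<rho> k)) = unit_ball_vol (real ?n) * \<rho> k ^ ?n"
      using content_ball[of "\<rho> k" c] \<rho>[OF that(1)] by (simp add: measure_completion)
    have "weak_Lp_norm r (T ?f) \<le> B * (\<Prod>j\<in>UNIV. Lp_norm (s j) (?f j))" using w by blast
    also have "\<dots> \<le> max B 0 * (\<Prod>j\<in>UNIV. Lp_norm (s j) (?f j))"
      by (intro mult_right_mono prod_nonneg) (auto simp: Lp_norm_nonneg)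
    also have "\<dots> \<le> max B 0 * (\<Prod>j\<in>UNIV. M * measure lebesgue (ball c (\<rho> k)) powr (1 / s j))"
      using f s M M0 by (intro mult_left_mono prod_mono conjI Lp_norm_nonneg Lp_norm_restrict_le) auto
    also have "(\<Prod>j\<in>UNIV. M * measure lebesgue (ball c (\<rho> k)) powr (1 / s j)) =
        M ^ CARD('m) * measure lebesgue (ball c (\<rho> k)) powr \<sigma>"
    proof -
      have "0 < measure lebesgue (ball c (\<rho> k))"
        unfolding mb using \<rho>[OF that(1)] by (intro mult_pos_pos) auto
      then show ?thesis
        by (simp add: prod.distrib \<sigma>_def powr_sum)
    qed
    finally have N: "weak_Lp_norm r (T ?f) \<le> max B 0 * M ^ CARD('m) * (unit_ball_vol (real ?n) * \<rho> k ^ ?n) powr \<sigma>"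
      unfolding mb by (simp add: mult.assoc)
    show ?thesis
      using w r that(2) by (intro weak_Lp_measure_le[OF _ N]) auto
  qed
  have null: "emeasure lebesgue ({x. 2 * l < cmod (W x)} \<inter> {x. \<forall>i. \<bar>x $ i\<bar> \<le> real R}) = 0"
    if l: "0 < l" for l and R :: nat
  proof -
    let ?E = "{x. 2 * l < cmod (W x)} \<inter> {x. \<forall>i. \<bar>x $ i\<bar> \<le> real R}"
    define V where "V k = (PiE UNIV (\<lambda>_. {- int (R * k)..int (R * k)}) :: ('n \<Rightarrow> int) set)" for k
    define ctr where "ctr k v = (\<chi> i. real_of_int (v i) / real k)" for k :: nat and v :: "'n \<Rightarrow> int"
    define u where "u k = (max B 0 * M ^ CARD('m) * (unit_ball_vol (real ?n) * \<rho> k ^ ?n) powr \<sigma> / l) powr r" for k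
    have le: "emeasure lebesgue ?E \<le> ennreal (real ((2 * R * k + 1) ^ ?n) * u k)" if k: "0 < k" "\<kappa> k < l" for k
    proof -
      define Tv where "Tv v = {x. l < cmod (T (\<lambda>j. restrict_to (ball (ctr k v) (\<rho> k)) (f j)) x)}" for v
      have finV: "finite (V k)" unfolding V_def by (intro finite_PiE) auto
      have cardV: "card (V k) = (2 * R * k + 1) ^ ?n"
      proof -
        have "card {- int (R * k)..int (R * k)} = nat (int (2 * R * k + 1))"
          unfolding card_atLeastAtMost_int by (rule arg_cong[where f=nat]) simp
        then have "card {- int (R * k)..int (R * k)} = 2 * R * k + 1" by (simp only: nat_int)
        then show ?thesis
          unfolding V_def by (subst card_PiE) (simp_all only: finite_class.finite_UNIV prod_constant)
      qed
      have TvM: "Tv v \<in> sets lebesgue" for v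
      proof -
        have "\<forall>j. restrict_to (ball (ctr k v) (\<rho> k)) (f j) \<in> bounded_compact_supp"
          using f by (auto intro!: bounded_compact_supp_restrict)
        then have "\<forall>j. restrict_to (ball (ctr k v) (\<rho> k)) (f j) \<in> Lp (s j)"
          using in_Lp[of "\<lambda>j. restrict_to (ball (ctr k v) (\<rho> k)) (f j)"] by simp
        then have "T (\<lambda>j. restrict_to (ball (ctr k v) (\<rho> k)) (f j)) \<in> weak_Lp r"
          by (rule weak[THEN conjunct1])
        then have [measurable]: "T (\<lambda>j. restrict_to (ball (ctr k v) (\<rho> k)) (f j)) \<in> borel_measurable lebesgue"
          by (simp add: weak_Lp_def)
        have "{x \<in> space lebesgue. l < cmod (T (\<lambda>j. restrict_to (ball (ctr k v) (\<rho> k)) (f j)) x)} \<in> sets lebesgue"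
          by measurable
        then show ?thesis by (simp add: Tv_def)
      qed
      have "AE x in lebesgue. \<forall>v\<in>V k. x \<in> ball (ctr k v) (\<rho> k) \<longrightarrow> W x =
           T (\<lambda>j. restrict_to (ball (ctr k v) (\<rho> k)) (f j)) x - kernel_integral K (\<lambda>j. restrict_to (ball (ctr k v) (\<rho> k)) (f j)) x"
        unfolding W_def by (intro AE_finite_allI finV defect_restrict formula T' f) auto
      then have "AE x in lebesgue. x \<in> ?E \<longrightarrow> x \<in> (\<Union>v\<in>V k. Tv v)"
      proof eventually_elim
        case (elim x)
        show ?case
        proof
          assume x: "x \<in> ?E"
          then obtain v where v: "v \<in> V k" "x \<in> ball (ctr k v) (\<rho> k)"
            using grid_ball_cover[OF k(1), of x R] unfolding V_def ctr_def \<rho>_def by auto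
          let ?g = "\<lambda>j. restrict_to (ball (ctr k v) (\<rho> k)) (f j)"
          have "W x = T ?g x - kernel_integral K ?g x" using elim v by blast
          then have "cmod (W x) \<le> cmod (T ?g x) + cmod (kernel_integral K ?g x)"
            by (metis norm_triangle_ineq4)
          moreover have "cmod (kernel_integral K ?g x) \<le> \<kappa> k" using k(1) v(2) by (rule kernel_small)
          ultimately have "l < cmod (T ?g x)" using x k(2) by auto
          then show "x \<in> (\<Union>v\<in>V k. Tv v)" using v by (auto simp: Tv_def)
        qed
      qed
      then have "emeasure lebesgue ?E \<le> emeasure lebesgue (\<Union>v\<in>V k. Tv v)"
        using finV TvM by (intro emeasure_mono_AE sets.finite_UN) auto
      also have "\<dots> \<le> (\<Sum>v\<in>V k. emeasure lebesgue (Tv v))"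
        using finV TvM by (intro emeasure_subadditive_finite) auto
      also have "\<dots> \<le> (\<Sum>v\<in>V k. ennreal (u k))"
        unfolding Tv_def u_def using k l by (intro sum_mono T_small) auto
      also have "\<dots> = ennreal (real ((2 * R * k + 1) ^ ?n) * u k)"
      proof -
        have "0 \<le> u k" by (simp add: u_def)
        then have "(\<Sum>v\<in>V k. ennreal (u k)) = ennreal (\<Sum>v\<in>V k. u k)"
          by (intro sum_ennreal)
        then show ?thesis by (simp only: sum_constant cardV)
      qed
      finally show ?thesis .
    qed
    have lim: "(\<lambda>k. real ((2 * R * k + 1) ^ ?n) * u k) \<longlonglongrightarrow> 0"
    proof -
      define b where "b = (max B 0 * M ^ CARD('m) * (unit_ball_vol (real ?n) * (real ?n + 1) ^ ?n) powr \<sigma> / l) powr r"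
      have "(\<lambda>k. (real (2 * R + 1) ^ ?n * b) * real k powr (real ?n * (1 - r * \<sigma>))) \<longlonglongrightarrow> (real (2 * R + 1) ^ ?n * b) * 0"
        using rs by (intro tendsto_mult tendsto_const tendsto_neg_powr filterlim_real_sequentially)
          (auto simp: \<sigma>_def mult_pos_neg)
      then have lim0: "(\<lambda>k. (real (2 * R + 1) ^ ?n * b) * real k powr (real ?n * (1 - r * \<sigma>))) \<longlonglongrightarrow> 0" by simp
      have ub: "real ((2 * R * k + 1) ^ ?n) * u k \<le> (real (2 * R + 1) ^ ?n * b) * real k powr (real ?n * (1 - r * \<sigma>))"
        if k: "1 \<le> k" for k
      proof -
        have k0: "0 < real k" using k by simp
        have "2 * R * k + 1 \<le> (2 * R + 1) * k" using k by simp
        then have "real (2 * R * k + 1) \<le> real (2 * R + 1) * real k" by (metis of_nat_le_iff of_nat_mult)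
        then have 1: "real ((2 * R * k + 1) ^ ?n) \<le> real (2 * R + 1) ^ ?n * real k powr ?n"
          using k0 power_mono[of "real (2 * R * k + 1)" "real (2 * R + 1) * real k" ?n]
          by (simp add: powr_realpow power_mult_distrib)
        have 2: "u k = b * real k powr (- (real ?n * (r * \<sigma>)))"
        proof -
          have "unit_ball_vol (real ?n) * \<rho> k ^ ?n = (unit_ball_vol (real ?n) * (real ?n + 1) ^ ?n) * real k powr (- real ?n)"
            using k0 by (simp add: \<rho>_def power_divide powr_minus powr_realpow field_simps)
          then have "(unit_ball_vol (real ?n) * \<rho> k ^ ?n) powr \<sigma> =
              (unit_ball_vol (real ?n) * (real ?n + 1) ^ ?n) powr \<sigma> * real k powr (- (real ?n * \<sigma>))"
            by (simp only:) (subst powr_mult, auto simp: powr_powr)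
          then have "max B 0 * M ^ CARD('m) * (unit_ball_vol (real ?n) * \<rho> k ^ ?n) powr \<sigma> / l =
             (max B 0 * M ^ CARD('m) * (unit_ball_vol (real ?n) * (real ?n + 1) ^ ?n) powr \<sigma> / l) * real k powr (- (real ?n * \<sigma>))"
            by simp
          then show ?thesis
            unfolding u_def b_def using M0 l by (simp only:) (subst powr_mult, auto simp: powr_powr mult_ac)
        qed
        have "real ((2 * R * k + 1) ^ ?n) * u k \<le> (real (2 * R + 1) ^ ?n * real k powr ?n) * u k"
          using 1 by (rule mult_right_mono) (simp add: u_def)
        also have "\<dots> = (real (2 * R + 1) ^ ?n * b) * (real k powr ?n * real k powr (- (real ?n * (r * \<sigma>))))"
          unfolding 2 by simp
        also have "real k powr ?n * real k powr (- (real ?n * (r * \<sigma>))) = real k powr (real ?n * (1 - r * \<sigma>))"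
          by (simp add: algebra_simps flip: powr_add)
        finally show ?thesis .
      qed
      show ?thesis
        by (rule tendsto_sandwich[OF _ _ tendsto_const lim0])
           (use ub in \<open>auto intro!: always_eventually eventually_sequentiallyI[of 1] mult_nonneg_nonneg simp: u_def\<close>)
    qed
    have "(\<lambda>k. ennreal (real ((2 * R * k + 1) ^ ?n) * u k)) \<longlonglongrightarrow> ennreal 0"
      by (rule tendsto_ennrealI[OF lim])
    moreover have "\<forall>\<^sub>F k in sequentially. emeasure lebesgue ?E \<le> ennreal (real ((2 * R * k + 1) ^ ?n) * u k)"
      using order_tendstoD(2)[OF \<kappa>_lim l] eventually_gt_at_top[of 0] by eventually_elim (rule le)
    ultimately have "emeasure lebesgue ?E \<le> ennreal 0"
      by (intro tendsto_lowerbound) auto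
    then show ?thesis by simp
  qed
  \<comment> \<open>The levels \<open>2 l = 1 / (i + 1)\<close> and the cubes of half side \<open>R\<close> exhaust the set where \<open>W\<close> does not
    vanish.\<close>
  have "AE x in lebesgue. \<forall>i R. x \<notin> {x. 2 * (1 / (2 * (real i + 1))) < cmod (W x)} \<inter> {x. \<forall>i. \<bar>x $ i\<bar> \<le> real R}"
  proof (subst AE_all_countable, rule allI, subst AE_all_countable, rule allI)
    fix i R :: nat
    have "{x. 2 * (1 / (2 * (real i + 1))) < cmod (W x)} \<inter> {x. \<forall>i. \<bar>x $ i\<bar> \<le> real R} \<in> null_sets lebesgue"
    proof (rule null_setsI)
      have "{x \<in> space lebesgue. 2 * (1 / (2 * (real i + 1))) < cmod (W x)} \<in> sets lebesgue" by measurable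
      moreover have "closed {x :: real^'n. \<forall>i. \<bar>x $ i\<bar> \<le> real R}"
        by (intro closed_Collect_all closed_Collect_le continuous_intros)
      ultimately show "{x. 2 * (1 / (2 * (real i + 1))) < cmod (W x)} \<inter> {x. \<forall>i. \<bar>x $ i\<bar> \<le> real R} \<in> sets lebesgue"
        by (intro sets.Int) auto
    qed (intro null, simp)
    then show "AE x in lebesgue. x \<notin> {x. 2 * (1 / (2 * (real i + 1))) < cmod (W x)} \<inter> {x. \<forall>i. \<bar>x $ i\<bar> \<le> real R}"
      by (rule AE_not_in)
  qed
  then show ?thesis
  proof eventually_elim
    case (elim x)
    obtain R :: nat where R: "norm x \<le> real R" using real_arch_simple by blast
    have xi: "\<bar>x $ i\<bar> \<le> real R" for i using component_le_norm_cart[of x i] R by linarith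
    have "W x = 0"
    proof (rule ccontr)
      assume "W x \<noteq> 0"
      then obtain i :: nat where "inverse (real (Suc i)) < cmod (W x)"
        using reals_Archimedean[of "cmod (W x)"] by auto
      moreover have "2 * (1 / (2 * (real i + 1))) = inverse (real (Suc i))" by (simp add: field_simps)
      ultimately have "2 * (1 / (2 * (real i + 1))) < cmod (W x)" by simp
      then show False using elim[rule_format, of i R] xi by simp
    qed
    then show ?case by (simp add: W_def)
  qed
qed

end

section \<open>Norm estimates in variable Lebesgue spaces\<close>

lemma log_hoelder_continuous:
  fixes p :: "'a::real_normed_vector \<Rightarrow> real"
  assumes c: "0 \<le> c" and h: "\<And>x y. x \<noteq> y \<Longrightarrow> norm (x - y) \<le> 1 / 2 \<Longrightarrow> \<bar>p x - p y\<bar> \<le> c / (- ln (norm (x - y)))"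
  shows "continuous_on UNIV p"
proof (rule continuous_onI)
  fix x :: 'a and e :: real
  assume e: "0 < e"
  define d where "d = min (1/2) (exp (- ((c + 1) / e)))"
  have d: "0 < d" by (simp add: d_def)
  have "dist (p y) (p x) \<le> e" if "dist y x < d" for y
  proof (cases "y = x")
    case False
    let ?r = "norm (y - x)"
    have r: "0 < ?r" "?r < 1/2" "?r < exp (- ((c + 1) / e))"
      using that False by (auto simp: d_def dist_norm)
    then have "ln ?r < - ((c + 1) / e)"
      using ln_less_cancel_iff[of ?r "exp (- ((c + 1) / e))"] by simp
    then have l: "(c + 1) / e < - ln ?r" by simp
    moreover have "0 < (c + 1) / e" using c e by simp
    ultimately have l0: "0 < - ln ?r" by linarith
    have "\<bar>p y - p x\<bar> \<le> c / (- ln ?r)" using h[of y x] False r by simp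
    also have "\<dots> \<le> e"
    proof -
      have "c + 1 < e * (- ln ?r)" using l e by (simp add: field_simps)
      then have "c \<le> e * (- ln ?r)" by linarith
      then show ?thesis using l0 by (simp only: pos_divide_le_eq)
    qed
    finally show ?thesis by (simp add: dist_real_def)
  qed (use e in simp)
  then show "\<exists>d>0. \<forall>x'\<in>UNIV. dist x' x < d \<longrightarrow> dist (p x') (p x) \<le> e"
    using d by blast
qed

text \<open>
  A continuous function that exceeded its essential bound somewhere would do so on a nonempty open set,
  which is not null. Thus bounds on log-Hoelder exponents hold at every point.
\<close>

lemma continuous_AE_le_imp_le:
  fixes p :: "real^'n::finite \<Rightarrow> real"
  assumes cont: "continuous_on UNIV p" and P: "AE x in lebesgue. p x \<le> P"
  shows "p x \<le> P"
proof (rule ccontr)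
  assume "\<not> p x \<le> P"
  then have "{x. P < p x} \<noteq> {}" by (auto intro: exI[of _ x])
  moreover have "open {x. P < p x}"
    using cont by (intro open_Collect_less) auto
  ultimately have "\<not> negligible {x. P < p x}" using open_not_negligible by blast
  moreover have "negligible {x. P < p x}"
    using P unfolding negligible_iff_null_sets completion.AE_iff_null_sets by (simp add: not_le)
  ultimately show False by blast
qed

text \<open>
  The hypotheses are made for \<open>p/t\<close>, whose values exceed 1. Hence \<open>p \<ge> t > 1\<close>, which makes the maximal
  theorem on \<open>L\<^sup>t\<close> available.
\<close>

lemma riesz_exponent_of_log_exponents:
  fixes p :: "real^'n::finite \<Rightarrow> real"
  assumes t: "1 < t" and log: "(\<lambda>x. p x / t) \<in> log_exponents"
    and a: "0 < a" "a < real CARD('n) / real_of_ereal (ess_sup p)"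
  obtains P c1 c2 pinf v W where "riesz_exponent p t P a c1 c2 pinf (real CARD('n)) v W"
proof -
  obtain C where C: "0 < C" "\<And>x y. x \<noteq> y \<Longrightarrow> norm (x - y) \<le> 1 / 2 \<Longrightarrow> \<bar>p x / t - p y / t\<bar> \<le> - C / ln (norm (x - y))"
    using log by (auto simp: log_exponents_def log_holder_def)
  obtain l C' where l: "((\<lambda>x. p x / t) \<longlongrightarrow> l) at_infinity" and C': "0 < C'" "\<And>x. \<bar>p x / t - l\<bar> \<le> C' / ln (exp 1 + norm x)"
    using log by (auto simp: log_exponents_def log_holder_def)
  have p1: "1 < p x / t" for x
    using log by (auto simp: log_exponents_def exponents_def)
  have ess: "ess_sup (\<lambda>x. p x / t) < \<infinity>"
    using log by (auto simp: log_exponents_def exponents_def)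
  have pt: "t < p x" for x using p1[of x] t by (simp add: field_simps)
  have loc: "\<bar>p x - p y\<bar> \<le> (t * C) / (- ln (norm (x - y)))" if "x \<noteq> y" "norm (x - y) \<le> 1 / 2" for x y
  proof -
    have "p x - p y = t * (p x / t - p y / t)" using t by (simp add: field_simps)
    then have "\<bar>p x - p y\<bar> = t * \<bar>p x / t - p y / t\<bar>" using t by (simp only: abs_mult)
    also have "t * \<bar>p x / t - p y / t\<bar> \<le> t * (- C / ln (norm (x - y)))" using C(2)[OF that] t by (intro mult_left_mono) auto
    finally show ?thesis by simp
  qed
  have dec: "\<bar>p x - t * l\<bar> \<le> (t * C') / ln (exp 1 + norm x)" for x
  proof -
    have "p x - t * l = t * (p x / t - l)" using t by (simp add: field_simps)
    then have "\<bar>p x - t * l\<bar> = t * \<bar>p x / t - l\<bar>" using t by (simp only: abs_mult)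
    also have "t * \<bar>p x / t - l\<bar> \<le> t * (C' / ln (exp 1 + norm x))" using C'(2)[of x] t by (intro mult_left_mono) auto
    finally show ?thesis by simp
  qed
  have cont: "continuous_on UNIV p"
    by (rule log_hoelder_continuous[OF _ loc]) (use t C in auto)
  then have [measurable]: "p \<in> borel_measurable borel" by (rule borel_measurable_continuous_onI)
  have pleb: "(\<lambda>x. ereal (p x)) \<in> borel_measurable lebesgue"
    by (intro measurable_completion) measurable
  have nontriv: "emeasure lebesgue (space lebesgue :: (real^'n) set) \<noteq> 0" by simp
  define P where "P = real_of_ereal (ess_sup p)"
  have "ess_sup p \<noteq> \<infinity>"
  proof -
    obtain b where b: "ess_sup (\<lambda>x. p x / t) \<le> ereal b"
      using ess by (cases "ess_sup (\<lambda>x. p x / t)") auto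
    have "AE x in lebesgue. ereal (p x / t) \<le> ess_sup (\<lambda>x. p x / t)"
      unfolding ess_sup_def by (rule esssup_AE)
    then have "AE x in lebesgue. ereal (p x) \<le> ereal (t * b)"
    proof eventually_elim
      case (elim x)
      then have "p x / t \<le> b" using b order_trans by fastforce
      then show ?case using t by (simp add: field_simps)
    qed
    then have "ess_sup p \<le> ereal (t * b)"
      unfolding ess_sup_def using pleb by (intro esssup_I)
    then show ?thesis by auto
  qed
  moreover have "ereal t \<le> ess_sup p"
  proof -
    have "ereal t = esssup lebesgue (\<lambda>x :: real^'n. ereal t)" by (rule esssup_const[OF nontriv, symmetric])
    also have "\<dots> \<le> ess_sup p"
      unfolding ess_sup_def using pt by (intro esssup_mono) (auto simp: less_imp_le)
    finally show ?thesis .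
  qed
  ultimately have P: "ess_sup p = ereal P" "t \<le> P"
    unfolding P_def by (cases "ess_sup p"; simp)+
  have "AE x in lebesgue. p x \<le> P"
    using esssup_AE[of "\<lambda>x. ereal (p x)" lebesgue] P(1) by (simp add: ess_sup_def)
  then have pP: "p x \<le> P" for x by (rule continuous_AE_le_imp_le[OF cont])
  have "((\<lambda>x. t * (p x / t)) \<longlongrightarrow> t * l) at_infinity" by (intro tendsto_mult tendsto_const l)
  then have lim: "(p \<longlongrightarrow> t * l) at_infinity" using t by simp
  have "t \<le> t * l" "t * l \<le> P"
    using tendsto_lowerbound[OF lim, of t] tendsto_upperbound[OF lim, of P] pt pP
    by (auto simp: less_imp_le trivial_limit_at_infinity)
  moreover have "a * P < real CARD('n)"
    using a P t by (simp add: field_simps)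
  ultimately have "riesz_exponent p t P a (t * C) (t * C') (t * l) (real CARD('n)) (unit_ball_vol (real CARD('n)))
      (enn2real (\<integral>\<^sup>+ x. ennreal ((exp 1 + norm x) powr (- (real (DIM(real^'n)) + 1))) \<partial>(lborel :: (real^'n) measure)))"
    using t pt pP a C C' loc dec weight_integral_finite[where 'a="real^'n"]
    by unfold_locales (auto simp: less_imp_le)
  then show ?thesis by (rule that)
qed

lemma measurable_riesz_potential_lebesgue:
  fixes f :: "'a::euclidean_space \<Rightarrow> complex"
  assumes "f \<in> borel_measurable lebesgue"
  shows "riesz_potential a (\<lambda>y. ennreal (cmod (f y) / \<eta>)) \<in> borel_measurable borel"
proof -
  obtain g where [measurable]: "g \<in> borel_measurable borel" and fg: "AE x in lborel. f x = g x"
    using complex_borel_version[OF assms] .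
  have "riesz_potential a (\<lambda>y. ennreal (cmod (f y) / \<eta>)) = riesz_potential a (\<lambda>y. ennreal (cmod (g y) / \<eta>))"
    using fg by (intro ext riesz_potential_cong_AE) (auto elim!: eventually_mono)
  then show ?thesis by simp
qed

lemma riesz_potential_var_modular_bound:
  fixes p :: "real^'n::finite \<Rightarrow> real"
  assumes t: "1 < t" and log: "(\<lambda>x. p x / t) \<in> log_exponents"
    and a: "0 < a" "a < real CARD('n) / real_of_ereal (ess_sup p)"
  obtains C where "0 \<le> C" "a < real CARD('n)" "p \<in> borel_measurable borel" "\<And>x. 1 < p x" "\<And>x. 0 < 1 / p x - a / real CARD('n)"
    "\<And>f \<eta>. f \<in> borel_measurable lebesgue \<Longrightarrow> 0 < \<eta> \<Longrightarrow> var_modular p f \<eta> \<le> 1 \<Longrightarrow>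
      (\<integral>\<^sup>+ x. epow (riesz_potential a (\<lambda>y. ennreal (cmod (f y) / \<eta>)) x) (1 / (1 / p x - a / real CARD('n))) \<partial>lborel) \<le> ennreal C"
proof -
  obtain P c1 c2 pinf v W where "riesz_exponent p t P a c1 c2 pinf (real CARD('n)) v W"
    using riesz_exponent_of_log_exponents[OF assms] .
  then interpret riesz_exponent p t P a c1 c2 pinf "real CARD('n)" v W .
  obtain C where C: "0 \<le> C" "\<And>f. f \<in> borel_measurable borel \<Longrightarrow> (\<And>x. 0 \<le> f x) \<Longrightarrow>
     (\<integral>\<^sup>+ x. ennreal (f x powr p x) \<partial>lborel) \<le> 1 \<Longrightarrow>
     (\<integral>\<^sup>+ x. epow (riesz_potential a (\<lambda>y. ennreal (f y)) x) (sobolev (p x)) \<partial>lborel) \<le> ennreal C"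
    using riesz_potential_modular_bound by blast
  have "(\<integral>\<^sup>+ x. epow (riesz_potential a (\<lambda>y. ennreal (cmod (f y) / \<eta>)) x) (1 / (1 / p x - a / real CARD('n))) \<partial>lborel) \<le> ennreal C"
    if f: "f \<in> borel_measurable lebesgue" and \<eta>: "0 < \<eta>" and m: "var_modular p f \<eta> \<le> 1" for f \<eta>
  proof -
    obtain g where [measurable]: "g \<in> borel_measurable borel" and fg: "AE x in lborel. f x = g x"
      using complex_borel_version[OF f] .
    have "(\<integral>\<^sup>+ x. ennreal ((cmod (g x) / \<eta>) powr p x) \<partial>lborel) = (\<integral>\<^sup>+ x. ennreal ((cmod (f x) / \<eta>) powr p x) \<partial>lborel)"
      using fg by (intro nn_integral_cong_AE) (auto elim!: eventually_mono)
    also have "\<dots> = var_modular p f \<eta>"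
      unfolding var_modular_def by (simp add: nn_integral_completion)
    finally have "(\<integral>\<^sup>+ x. ennreal ((cmod (g x) / \<eta>) powr p x) \<partial>lborel) \<le> 1" using m by simp
    then have "(\<integral>\<^sup>+ x. epow (riesz_potential a (\<lambda>y. ennreal (cmod (g y) / \<eta>)) x) (sobolev (p x)) \<partial>lborel) \<le> ennreal C"
      using \<eta> by (intro C(2)) auto
    moreover have "riesz_potential a (\<lambda>y. ennreal (cmod (f y) / \<eta>)) x = riesz_potential a (\<lambda>y. ennreal (cmod (g y) / \<eta>)) x" for x
      using fg by (intro riesz_potential_cong_AE) (auto elim!: eventually_mono)
    ultimately show ?thesis by (simp add: sobolev_def)
  qed
  moreover have "1 < p x" for x using t p_ge[of x] by linarith
  moreover have "0 < 1 / p x - a / real CARD('n)" for x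
    using sobolev_facts(1,2)[OF p_ge[of x] p_le[of x]] by linarith
  ultimately show ?thesis using C(1) a_lt_n p_measurable by (intro that[of C]) auto
qed

text \<open>
  With \<open>M\<close> the right-hand side, each factor is at most \<open>M\<close> to the power \<open>1 / r i\<close>, so the product is at
  most \<open>M\<close> to the power \<open>1 / q\<close>.
\<close>

lemma epow_prod_le_sum:
  fixes R :: "'i \<Rightarrow> ennreal" and r :: "'i \<Rightarrow> real"
  assumes I: "finite I" "I \<noteq> {}" and r: "\<And>i. i \<in> I \<Longrightarrow> 0 < r i" and q: "0 < q" "1 / q = (\<Sum>i\<in>I. 1 / r i)"
  shows "epow (\<Prod>i\<in>I. R i) q \<le> (\<Sum>i\<in>I. epow (R i) (r i))"
proof (cases "\<exists>i\<in>I. R i = top")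
  case True
  then obtain i where i: "i \<in> I" "epow (R i) (r i) = top" by auto
  then have "(\<Sum>i\<in>I. epow (R i) (r i)) = top"
    using I by (metis ennreal_sum_eq_top)
  then show ?thesis by simp
next
  case False
  then have "\<forall>i\<in>I. \<exists>u\<ge>0. R i = ennreal u"
    by (metis ennreal_cases)
  then obtain u where u: "\<And>i. i \<in> I \<Longrightarrow> 0 \<le> u i \<and> R i = ennreal (u i)" by metis
  define M where "M = (\<Sum>i\<in>I. u i powr r i)"
  have M0: "0 \<le> M" unfolding M_def by (intro sum_nonneg) auto
  have le: "u i \<le> M powr (1 / r i)" if "i \<in> I" for i
  proof -
    have "u i powr r i \<le> M" unfolding M_def using that I by (intro member_le_sum) auto
    then have "(u i powr r i) powr (1 / r i) \<le> M powr (1 / r i)" using r[OF that] by (intro powr_mono2) auto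
    then show ?thesis using r[OF that] u[OF that] by (simp add: powr_powr)
  qed
  have "(\<Prod>i\<in>I. u i) powr q \<le> M"
  proof (cases "M = 0")
    case True
    obtain i where "i \<in> I" using I by auto
    then have "u i = 0" using le[of i] u[of i] True by simp
    then have "(\<Prod>i\<in>I. u i) = 0" using \<open>i \<in> I\<close> I by (intro prod_zero) auto
    then show ?thesis using True by simp
  next
    case False
    have "(\<Prod>i\<in>I. u i) \<le> (\<Prod>i\<in>I. M powr (1 / r i))"
      using le u by (intro prod_mono) auto
    also have "\<dots> = M powr (1 / q)" unfolding q using False by (simp add: powr_sum I)
    finally have "(\<Prod>i\<in>I. u i) powr q \<le> (M powr (1 / q)) powr q"
      using u q by (intro powr_mono2) (auto intro!: prod_nonneg)
    also have "\<dots> = M" using q(1) M0 by (simp add: powr_powr)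
    finally show ?thesis .
  qed
  then have "ennreal ((\<Prod>i\<in>I. u i) powr q) \<le> ennreal M" by (rule ennreal_leI)
  moreover have "(\<Prod>i\<in>I. R i) = ennreal (\<Prod>i\<in>I. u i)"
    using u by (simp add: prod_ennreal)
  moreover have "(\<Sum>i\<in>I. epow (R i) (r i)) = ennreal M"
    unfolding M_def using u by (subst sum_ennreal[symmetric]) auto
  ultimately show ?thesis
    using u by (simp add: prod_nonneg)
qed

lemma var_modular_antimono:
  assumes "0 < \<eta>" "\<eta> \<le> \<eta>'" "\<And>x. 0 \<le> p x"
  shows "var_modular p f \<eta>' \<le> var_modular p f \<eta>"
  unfolding var_modular_def using assms
  by (intro nn_integral_mono ennreal_leI powr_mono2 divide_left_mono) auto

text \<open>
  The norm is an infimum over a set that is upward closed, and nonempty because for exponents of at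
  least 1 dividing a function by \<open>c \<ge> 1\<close> divides a finite modular by at least \<open>c\<close>.
\<close>

lemma var_modular_le_one:
  fixes p :: "real^'n::finite \<Rightarrow> real"
  assumes f: "f \<in> var_Lp p" and p: "p \<in> borel_measurable borel" "\<And>x. 1 \<le> p x" and \<eta>: "var_Lp_norm p f < \<eta>"
  shows "0 \<le> var_Lp_norm p f" "var_modular p f \<eta> \<le> 1"
proof -
  have [measurable]: "f \<in> borel_measurable lebesgue" using f by (simp add: var_Lp_def)
  have pl [measurable]: "p \<in> borel_measurable lebesgue" using p(1) by (intro measurable_completion) simp
  let ?S = "{\<eta>. 0 < \<eta> \<and> var_modular p f \<eta> \<le> 1}"
  obtain \<eta>0 where \<eta>0: "0 < \<eta>0" "var_modular p f \<eta>0 < \<infinity>"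
    using f by (auto simp: var_Lp_def)
  define c where "c = max 1 (enn2real (var_modular p f \<eta>0))"
  have c: "1 \<le> c" by (simp add: c_def)
  have "var_modular p f (\<eta>0 * c) \<le> (\<integral>\<^sup>+ x. ennreal (1 / c) * ennreal ((cmod (f x) / \<eta>0) powr p x) \<partial>lebesgue)"
    unfolding var_modular_def
  proof (rule nn_integral_mono)
    fix x
    have "(cmod (f x) / (\<eta>0 * c)) powr p x = (1 / c) powr p x * (cmod (f x) / \<eta>0) powr p x"
      using c \<eta>0 by (subst powr_mult[symmetric]) (auto simp: mult.commute)
    also have "\<dots> \<le> (1 / c) powr 1 * (cmod (f x) / \<eta>0) powr p x"
      using c p(2)[of x] by (intro mult_right_mono powr_mono') auto
    finally show "ennreal ((cmod (f x) / (\<eta>0 * c)) powr p x) \<le> ennreal (1 / c) * ennreal ((cmod (f x) / \<eta>0) powr p x)"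
      using c by (simp add: ennreal_leI flip: ennreal_mult)
  qed
  also have "\<dots> = ennreal (1 / c) * var_modular p f \<eta>0"
    unfolding var_modular_def by (rule nn_integral_cmult) measurable
  also have "\<dots> \<le> ennreal (1 / c) * ennreal c"
  proof (rule mult_left_mono)
    show "var_modular p f \<eta>0 \<le> ennreal c"
      using \<eta>0(2) unfolding c_def by (cases "var_modular p f \<eta>0") auto
  qed simp
  also have "\<dots> = 1" using c by (simp flip: ennreal_mult)
  finally have ne: "?S \<noteq> {}" using \<eta>0(1) c by (intro ex_in_conv[THEN iffD1] exI[of _ "\<eta>0 * c"]) auto
  show "0 \<le> var_Lp_norm p f"
    unfolding var_Lp_norm_def using ne by (intro cInf_greatest) auto
  obtain \<eta>' where "\<eta>' \<in> ?S" "\<eta>' < \<eta>"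
    using \<eta> cInf_lessD[OF ne] unfolding var_Lp_norm_def by blast
  then have "var_modular p f \<eta> \<le> var_modular p f \<eta>'" "var_modular p f \<eta>' \<le> 1"
    using order_trans[OF zero_le_one p(2)] by (auto intro: var_modular_antimono)
  then show "var_modular p f \<eta> \<le> 1" by (rule order_trans)
qed

theorem theorem3p1:
  fixes T :: "('m::finite \<Rightarrow> real^'n::finite \<Rightarrow> complex) \<Rightarrow> real^'n \<Rightarrow> complex"
    and K :: "real^'n \<Rightarrow> (real^'n)^'m \<Rightarrow> complex"
    and Ck :: "nat \<Rightarrow> real"
    and p0 p0' \<alpha> :: real
    and \<alpha>s :: "'m \<Rightarrow> real"
    and ps :: "'m \<Rightarrow> real^'n \<Rightarrow> real"
    and p q :: "real^'n \<Rightarrow> real"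
  assumes "2 \<le> CARD('m)"
    and "1 < p0" and "1 / p0 + 1 / p0' = 1"
    and "fractional_operator \<alpha> p0 p0' Ck K T"
    and "summable (\<lambda>k. Ck (Suc k))"
    and "\<And>i. (\<lambda>x. ps i x / p0') \<in> log_exponents"
    and "\<And>i. 0 < \<alpha>s i \<and> \<alpha>s i < real CARD('n) / real_of_ereal (ess_sup (ps i))"
    and "\<alpha> = (\<Sum>i\<in>UNIV. \<alpha>s i)"
    and "\<And>x. 1 / p x = (\<Sum>i\<in>UNIV. 1 / ps i x)"
    and "\<And>x. 1 / q x = 1 / p x - \<alpha> / real CARD('n)"
    and "q \<in> maximal_exponents"
  shows "\<exists>T' C. 0 < C \<and>
    multilinear_ae (\<lambda>j. var_Lp (ps j)) T' \<and>
    (\<forall>f. (\<forall>j. f j \<in> bounded_compact_supp) \<longrightarrow> (AE x in lebesgue. T' f x = T f x)) \<and>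
    (\<forall>f. (\<forall>j. f j \<in> var_Lp (ps j)) \<longrightarrow>
      T' f \<in> var_Lp q \<and> var_Lp_norm q (T' f) \<le> C * (\<Prod>j\<in>UNIV. var_Lp_norm (ps j) (f j)))"
proof -
  let ?n = "real CARD('n)"
  note \<alpha>_eq = assms(8)
  have p0': "1 < p0'"
  proof -
    have "1 / p0' = 1 - 1 / p0" using assms(3) by simp
    then have "0 < 1 / p0'" "1 / p0' < 1" using assms(2) by auto
    then show ?thesis by (simp add: field_simps)
  qed
  have \<alpha>p: "0 < \<alpha> * p0'" "\<alpha> * p0' < real CARD('m) * ?n" and kernel: "fractional_kernel \<alpha> p0 p0' Ck K"
    and formula: "\<And>f. (\<forall>j. f j \<in> bounded_compact_supp) \<Longrightarrow> kernel_formula K T f"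
    using assms(4) unfolding fractional_operator_def by auto
  obtain s s' B where s: "\<And>j. 1 \<le> s j \<and> s j \<le> p0'" and s': "1 / s' = (\<Sum>j\<in>UNIV. 1 / s j)"
    and Tlin: "multilinear_ae (\<lambda>j. Lp (s j)) T"
    and weak: "\<And>f. (\<forall>j. f j \<in> Lp (s j)) \<Longrightarrow> T f \<in> weak_Lp (s' * ?n / (?n - s' * \<alpha>)) \<and>
        weak_Lp_norm (s' * ?n / (?n - s' * \<alpha>)) (T f) \<le> B * (\<Prod>j\<in>UNIV. Lp_norm (s j) (f j))"
    using assms(4) unfolding fractional_operator_def Let_def by blast
  define bounded_by where "bounded_by i C \<longleftrightarrow> (\<forall>f \<eta>. f \<in> borel_measurable lebesgue \<longrightarrow> 0 < \<eta> \<longrightarrow> var_modular (ps i) f \<eta> \<le> 1 \<longrightarrow>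
      (\<integral>\<^sup>+ x. epow (riesz_potential (\<alpha>s i) (\<lambda>y. ennreal (cmod (f y) / \<eta>)) x) (1 / (1 / ps i x - \<alpha>s i / ?n)) \<partial>lborel) \<le> ennreal C)"
    for i C
  note riesz_bound = riesz_potential_var_modular_bound[OF p0' assms(6) conjunct1[OF assms(7)] conjunct2[OF assms(7)]]
  have "\<exists>C. 0 \<le> C \<and> bounded_by i C" for i
    by (rule riesz_bound[of i]) (auto simp: bounded_by_def)
  then obtain C where C_nonneg: "\<And>i. 0 \<le> C i" and C': "\<And>i. bounded_by i (C i)"
    by metis
  have C: "(\<integral>\<^sup>+ x. epow (riesz_potential (\<alpha>s i) (\<lambda>y. ennreal (cmod (f y) / \<eta>)) x) (1 / (1 / ps i x - \<alpha>s i / ?n)) \<partial>lborel) \<le> ennreal (C i)"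
    if "f \<in> borel_measurable lebesgue" "0 < \<eta>" "var_modular (ps i) f \<eta> \<le> 1" for i f \<eta>
    using C'[of i] that unfolding bounded_by_def by simp
  have as_n: "\<alpha>s i < ?n" and ps_meas: "ps i \<in> borel_measurable borel" for i
    by (rule riesz_bound[of i], assumption)+
  have ps1: "1 < ps i x" and qpos: "0 < 1 / ps i x - \<alpha>s i / ?n" for i x
    by (rule riesz_bound[of i], blast)+
  have "\<exists>A>0. \<forall>(x, y)\<in>off_diagonal.
      cmod (K x y) \<le> A * (\<Sum>j\<in>UNIV. norm (x - y $ j)) powr (- (real CARD('m) * ?n - \<alpha>))"
    using kernel unfolding fractional_kernel_def Let_def by (elim conjE)
  then obtain A where A: "0 < A" and size': "\<forall>(x, y)\<in>off_diagonal.
      cmod (K x y) \<le> A * (\<Sum>j\<in>UNIV. norm (x - y $ j)) powr (- (real CARD('m) * ?n - \<alpha>))"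
    by blast
  have size: "cmod (K x y) \<le> A * (\<Sum>j\<in>UNIV. norm (x - y $ j)) powr (- (real CARD('m) * ?n - \<alpha>))"
    if "(x, y) \<in> off_diagonal" for x y
    using bspec[OF size' that] by simp
  have "\<forall>S. compact S \<and> S \<subseteq> off_diagonal \<longrightarrow> set_integrable lebesgue S (\<lambda>(x, y). K x y)"
    using kernel unfolding fractional_kernel_def Let_def by (elim conjE)
  then have locint: "\<And>S. compact S \<Longrightarrow> S \<subseteq> off_diagonal \<Longrightarrow> set_integrable lebesgue S (\<lambda>(x, y). K x y)"
    by blast
  interpret dominated_kernel K A \<alpha>s
    by unfold_locales (use A as_n assms(7) size locint in \<open>auto simp: \<alpha>_eq\<close>)
  define r where "r j x = 1 / (1 / ps j x - \<alpha>s j / ?n)" for j x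
  have r0: "0 < r j x" for j x using qpos[of j x] by (simp add: r_def)
  have r_meas: "r j \<in> borel_measurable borel" for j
    unfolding r_def using ps_meas[of j] by measurable
  have q_sum: "1 / q x = (\<Sum>j\<in>UNIV. 1 / r j x)" for x
    unfolding assms(10) assms(9) r_def \<alpha>_eq by (simp add: sum_subtractf sum_divide_distrib)
  have q1: "1 < q x" for x
    using assms(11) by (auto simp: maximal_exponents_def exponents_def)
  \<comment> \<open>Since \<open>q > 1\<close>, dividing by \<open>C0 \<ge> 1\<close> brings a modular of at most \<open>C0\<close> down to 1.\<close>
  define C0 where "C0 = max 1 (\<Sum>j\<in>UNIV. C j)"
  have C0_ge: "1 \<le> C0" by (simp add: C0_def)
  define R where "R f \<eta> j x = riesz_potential (\<alpha>s j) (\<lambda>y. ennreal (cmod (f j y) / \<eta> j)) x" for f :: "'m \<Rightarrow> real^'n \<Rightarrow> complex" and \<eta> :: "'m \<Rightarrow> real" and j x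
  have pot: "potential_bound f x = ennreal (A * (\<Prod>j\<in>UNIV. \<eta> j)) * (\<Prod>j\<in>UNIV. R f \<eta> j x)"
    if \<eta>: "\<And>j. 0 < \<eta> j" and f: "\<And>j. f j \<in> borel_measurable lebesgue" for f \<eta> x
  proof -
    have "riesz_potential (\<alpha>s j) (\<lambda>y. ennreal (cmod (f j y))) x = ennreal (\<eta> j) * R f \<eta> j x" for j
    proof -
      obtain g where [measurable]: "g \<in> borel_measurable borel" and fg: "AE x in lborel. f j x = g x"
        using complex_borel_version[OF f[of j]] .
      have "riesz_potential (\<alpha>s j) (\<lambda>y. ennreal (cmod (f j y))) x = riesz_potential (\<alpha>s j) (\<lambda>y. ennreal (\<eta> j) * ennreal (cmod (g y) / \<eta> j)) x"
        using fg \<eta>[of j] by (intro riesz_potential_cong_AE) (auto elim!: eventually_mono simp flip: ennreal_mult)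
      also have "\<dots> = ennreal (\<eta> j) * riesz_potential (\<alpha>s j) (\<lambda>y. ennreal (cmod (g y) / \<eta> j)) x"
        unfolding riesz_potential_def mult.assoc by (rule nn_integral_cmult) measurable
      also have "riesz_potential (\<alpha>s j) (\<lambda>y. ennreal (cmod (g y) / \<eta> j)) x = R f \<eta> j x"
        unfolding R_def using fg by (intro riesz_potential_cong_AE) (auto elim!: eventually_mono)
      finally show ?thesis .
    qed
    then have "potential_bound f x = ennreal A * ((\<Prod>j\<in>UNIV. ennreal (\<eta> j)) * (\<Prod>j\<in>UNIV. R f \<eta> j x))"
      unfolding potential_bound_def by (simp add: prod.distrib)
    also have "(\<Prod>j\<in>UNIV. ennreal (\<eta> j)) = ennreal (\<Prod>j\<in>UNIV. \<eta> j)"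
      using \<eta> by (intro prod_ennreal) (auto simp: less_imp_le)
    finally show ?thesis
      using A \<eta> by (simp add: ennreal_mult prod_nonneg less_imp_le mult.assoc)
  qed
  have R_int: "(\<integral>\<^sup>+ x. epow (R f \<eta> j x) (r j x) \<partial>lborel) \<le> ennreal (C j)"
    if "f j \<in> borel_measurable lebesgue" "0 < \<eta> j" "var_modular (ps j) (f j) (\<eta> j) \<le> 1" for f \<eta> j
    unfolding R_def r_def by (rule C[OF that])
  have R_meas: "R f \<eta> j \<in> borel_measurable borel" if "f j \<in> borel_measurable lebesgue" for f \<eta> j
    unfolding R_def using measurable_riesz_potential_lebesgue[OF that] .
  \<comment> \<open>The norm may be 0, which is not admissible as a divisor, so numbers above it are used
    first and the limit is taken at the end.\<close>
  have good_\<eta>: "var_modular (ps j) g \<eta> \<le> 1" "0 \<le> var_Lp_norm (ps j) g" if "g \<in> var_Lp (ps j)" "var_Lp_norm (ps j) g < \<eta>" for j g \<eta>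
    using var_modular_le_one[OF that(1) ps_meas _ that(2)] ps1[of j] by (auto simp: less_imp_le)
  have meas: "f j \<in> borel_measurable lebesgue" if "\<forall>j. f j \<in> var_Lp (ps j)" for f j
    using that by (auto simp: var_Lp_def)
  have fin: "AE x in lebesgue. potential_bound f x < top" if f: "\<forall>j. f j \<in> var_Lp (ps j)" for f
  proof -
    define \<eta> where "\<eta> j = var_Lp_norm (ps j) (f j) + 1" for j
    have \<eta>: "0 < \<eta> j" "var_modular (ps j) (f j) (\<eta> j) \<le> 1" for j
      using good_\<eta>[of "f j" j "\<eta> j"] f by (auto simp: \<eta>_def)
    have "AE x in lborel. R f \<eta> j x \<noteq> top" for j
    proof -
      have "AE x in lborel. epow (R f \<eta> j x) (r j x) \<noteq> \<infinity>"
      proof (rule nn_integral_PInf_AE)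
        show "(\<lambda>x. epow (R f \<eta> j x) (r j x)) \<in> borel_measurable lborel"
          using R_meas[of f j \<eta>] meas[OF f] r_meas[of j] by measurable
        show "(\<integral>\<^sup>+ x. epow (R f \<eta> j x) (r j x) \<partial>lborel) \<noteq> \<infinity>"
          using R_int[of f j \<eta>] meas[OF f] \<eta> by (metis ennreal_neq_top infinity_ennreal_def top.extremum_uniqueI)
      qed
      then show ?thesis by eventually_elim (auto simp: epow_eq_top_iff)
    qed
    then have "AE x in lborel. \<forall>j\<in>UNIV. R f \<eta> j x \<noteq> top" by (intro AE_finite_allI) auto
    then have "AE x in lborel. potential_bound f x < top"
    proof eventually_elim
      case (elim x)
      then have "(\<Prod>j\<in>UNIV. R f \<eta> j x) \<noteq> top" by (simp add: ennreal_prod_eq_top)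
      then show ?case
        unfolding pot[where f=f and \<eta>=\<eta> and x=x, OF \<eta>(1) meas[OF f]] by (simp add: ennreal_mult_less_top less_top)
    qed
    then show ?thesis by (rule AE_completion)
  qed
  have lin: "multilinear_ae (\<lambda>j. var_Lp (ps j)) (kernel_integral K)"
    by (rule kernel_integral_multilinear) (auto simp: var_Lp_def intro!: fin)
  have agree: "AE x in lebesgue. kernel_integral K f x = T f x" if f: "\<forall>j. f j \<in> bounded_compact_supp" for f
  proof -
    define \<sigma> where "\<sigma> = (\<Sum>j\<in>UNIV. 1 / s j)"
    have "(\<Sum>j\<in>(UNIV :: 'm set). 1 / p0') \<le> \<sigma>"
      unfolding \<sigma>_def
    proof (intro sum_mono divide_left_mono)
      fix j
      show "s j \<le> p0'" "0 < p0' * s j" using s[of j] p0' by auto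
    qed simp
    then have "real CARD('m) / p0' \<le> \<sigma>" by simp
    moreover have "\<alpha> / ?n < real CARD('m) / p0'" using \<alpha>p p0' by (simp add: field_simps)
    ultimately have \<sigma>: "\<alpha> / ?n < \<sigma>" by linarith
    have \<alpha>0: "0 < \<alpha>" using \<alpha>p(1) p0' by (simp add: zero_less_mult_iff)
    then have "0 < \<alpha> / ?n" by simp
    then have \<sigma>0: "0 < \<sigma>" using \<sigma> by linarith
    have s'_eq: "s' = 1 / \<sigma>" using s' \<sigma>0 unfolding \<sigma>_def[symmetric] by (metis div_by_1 divide_divide_eq_right mult_1)
    have d: "0 < ?n - s' * \<alpha>" using \<sigma> \<sigma>0 by (simp add: s'_eq field_simps)
    have "AE x in lebesgue. T f x = kernel_integral K f x"
    proof (rule operator_eq_kernel_integral[OF formula Tlin _ weak _ _ f])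
      show "0 < s' * ?n / (?n - s' * \<alpha>)" using d \<sigma>0 by (simp add: s'_eq)
      have "1 < ?n / (?n - s' * \<alpha>)" using d \<alpha>0 \<sigma>0 by (simp add: s'_eq)
      also have "?n / (?n - s' * \<alpha>) = s' * ?n / (?n - s' * \<alpha>) * \<sigma>" using \<sigma>0 by (simp add: s'_eq)
      finally show "1 < s' * ?n / (?n - s' * \<alpha>) * (\<Sum>j\<in>UNIV. 1 / s j)" unfolding \<sigma>_def .
    qed (use s in auto)
    then show ?thesis by eventually_elim simp
  qed
  have modular: "var_modular q (kernel_integral K f) (A * (\<Prod>j\<in>UNIV. \<eta> j) * C0) \<le> 1"
    if f: "\<forall>j. f j \<in> var_Lp (ps j)" and \<eta>: "\<And>j. var_Lp_norm (ps j) (f j) < \<eta> j" for f \<eta>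
  proof -
    have \<eta>0: "0 < \<eta> j" "var_modular (ps j) (f j) (\<eta> j) \<le> 1" for j
      using good_\<eta>[of "f j" j "\<eta> j"] f \<eta>[of j] by auto
    define D where "D = A * (\<Prod>j\<in>UNIV. \<eta> j)"
    have D: "0 < D" unfolding D_def using A \<eta>0 by (intro mult_pos_pos prod_pos) auto
    have "var_modular q (kernel_integral K f) (D * C0) =
        (\<integral>\<^sup>+ x. ennreal ((cmod (kernel_integral K f x) / (D * C0)) powr q x) \<partial>lborel)"
      unfolding var_modular_def by (rule nn_integral_completion)
    also have "\<dots> \<le> (\<integral>\<^sup>+ x. ennreal (1 / C0) * (\<Sum>j\<in>UNIV. epow (R f \<eta> j x) (r j x)) \<partial>lborel)"
    proof (rule nn_integral_mono)
      fix x
      let ?X = "\<Prod>j\<in>UNIV. R f \<eta> j x"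
      have "ennreal (cmod (kernel_integral K f x)) \<le> ennreal D * ?X"
        using kernel_integral_le[of f x, OF meas[OF f]] unfolding D_def pot[where f=f and \<eta>=\<eta> and x=x, OF \<eta>0(1) meas[OF f]] .
      then have "ennreal ((cmod (kernel_integral K f x) / (D * C0)) powr q x) \<le> ennreal (1 / C0) * epow ?X (q x)"
      proof (cases ?X)
        case (real X)
        assume "ennreal (cmod (kernel_integral K f x)) \<le> ennreal D * ?X"
        then have "cmod (kernel_integral K f x) \<le> D * X"
          using real D by (simp flip: ennreal_mult)
        then have "cmod (kernel_integral K f x) / (D * C0) \<le> (1 / C0) * X"
          using D C0_ge by (simp add: field_simps)
        then have "(cmod (kernel_integral K f x) / (D * C0)) powr q x \<le> ((1 / C0) * X) powr q x"
          using D C0_ge q1[of x] by (intro powr_mono2) auto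
        also have "\<dots> = (1 / C0) powr q x * X powr q x"
          by (rule powr_mult)
        also have "\<dots> \<le> (1 / C0) powr 1 * X powr q x"
          using C0_ge q1[of x] by (intro mult_right_mono powr_mono') auto
        finally have "(cmod (kernel_integral K f x) / (D * C0)) powr q x \<le> (1 / C0) * X powr q x"
          using C0_ge by simp
        then show ?thesis
          using real C0_ge by (simp add: ennreal_leI flip: ennreal_mult)
      next
        case top
        then show ?thesis using C0_ge by (simp add: ennreal_mult_top)
      qed
      also have "\<dots> \<le> ennreal (1 / C0) * (\<Sum>j\<in>UNIV. epow (R f \<eta> j x) (r j x))"
        using q1[of x] r0 q_sum by (intro mult_left_mono epow_prod_le_sum) auto
      finally show "ennreal ((cmod (kernel_integral K f x) / (D * C0)) powr q x) \<le> \<dots>" .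
    qed
    also have "\<dots> = ennreal (1 / C0) * (\<Sum>j\<in>UNIV. \<integral>\<^sup>+ x. epow (R f \<eta> j x) (r j x) \<partial>lborel)"
    proof -
      have m: "(\<lambda>x. epow (R f \<eta> j x) (r j x)) \<in> borel_measurable lborel" for j
        using R_meas[of f j \<eta>] meas[OF f] r_meas[of j] by measurable
      show ?thesis using m by (simp add: nn_integral_cmult nn_integral_sum)
    qed
    also have "\<dots> \<le> ennreal (1 / C0) * (\<Sum>j\<in>UNIV. ennreal (C j))"
      using meas[OF f] \<eta>0 by (intro mult_left_mono sum_mono R_int) auto
    also have "\<dots> = ennreal (1 / C0 * (\<Sum>j\<in>UNIV. C j))"
      using C_nonneg C0_ge by (subst sum_ennreal, simp, subst ennreal_mult) (auto simp: sum_nonneg)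
    also have "\<dots> \<le> ennreal 1"
      using C0_ge by (intro ennreal_leI) (simp add: C0_def)
    finally show ?thesis by (simp add: D_def)
  qed
  have norm_bound: "kernel_integral K f \<in> var_Lp q \<and> var_Lp_norm q (kernel_integral K f) \<le> (A * C0) * (\<Prod>j\<in>UNIV. var_Lp_norm (ps j) (f j))"
    if f: "\<forall>j. f j \<in> var_Lp (ps j)" for f
  proof
    have N0: "0 \<le> var_Lp_norm (ps j) (f j)" for j
      using good_\<eta>(2)[of "f j" j "var_Lp_norm (ps j) (f j) + 1"] f by simp
    have pos: "0 < A * (\<Prod>j\<in>UNIV. var_Lp_norm (ps j) (f j) + e) * C0" if "0 < e" for e
      using A C0_ge N0 that by (intro mult_pos_pos prod_pos) (auto intro: add_nonneg_pos)
    show "kernel_integral K f \<in> var_Lp q"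
      unfolding var_Lp_def
    proof (intro CollectI conjI exI)
      show "kernel_integral K f \<in> borel_measurable lebesgue" by (rule measurable_kernel_integral[of f, OF meas[OF f]])
      show "0 < A * (\<Prod>j\<in>UNIV. var_Lp_norm (ps j) (f j) + 1) * C0" by (rule pos) simp
      have "var_modular q (kernel_integral K f) (A * (\<Prod>j\<in>UNIV. var_Lp_norm (ps j) (f j) + 1) * C0) \<le> 1"
        by (rule modular[OF f]) simp
      then show "var_modular q (kernel_integral K f) (A * (\<Prod>j\<in>UNIV. var_Lp_norm (ps j) (f j) + 1) * C0) < \<infinity>"
        using ennreal_one_less_top order_le_less_trans by (metis infinity_ennreal_def)
    qed
    have le: "var_Lp_norm q (kernel_integral K f) \<le> A * (\<Prod>j\<in>UNIV. var_Lp_norm (ps j) (f j) + e) * C0" if e: "0 < e" for e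
      unfolding var_Lp_norm_def[of q]
    proof (rule cInf_lower)
      show "A * (\<Prod>j\<in>UNIV. var_Lp_norm (ps j) (f j) + e) * C0 \<in> {\<eta>. 0 < \<eta> \<and> var_modular q (kernel_integral K f) \<eta> \<le> 1}"
        using pos[OF e] modular[OF f, of "\<lambda>j. var_Lp_norm (ps j) (f j) + e"] e by simp
      show "bdd_below {\<eta>. 0 < \<eta> \<and> var_modular q (kernel_integral K f) \<eta> \<le> 1}"
        by (rule bdd_belowI[of _ 0]) auto
    qed
    have "((\<lambda>e. A * (\<Prod>j\<in>UNIV. var_Lp_norm (ps j) (f j) + e) * C0) \<longlongrightarrow> A * (\<Prod>j\<in>UNIV. var_Lp_norm (ps j) (f j) + 0) * C0) (at_right 0)"
      by (intro tendsto_intros)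
    then have "var_Lp_norm q (kernel_integral K f) \<le> A * (\<Prod>j\<in>UNIV. var_Lp_norm (ps j) (f j) + 0) * C0"
      by (rule tendsto_lowerbound) (use le in \<open>auto simp: eventually_at_right_field intro!: exI[of _ 1]\<close>)
    then show "var_Lp_norm q (kernel_integral K f) \<le> (A * C0) * (\<Prod>j\<in>UNIV. var_Lp_norm (ps j) (f j))"
      by (simp add: mult_ac)
  qed
  show ?thesis
  proof (intro exI[of _ "kernel_integral K"] exI[of _ "A * C0"] conjI allI impI)
    show "0 < A * C0" using A C0_ge by simp
  qed (use lin agree norm_bound in blast)+
qed

end
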